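(* Let $k\ge 1$ be an integer and $0<\lambda<\min\{\lambda_1,\lambda_{\mathrm{AY}}\}$. For small $\varepsilon>0$ let $u_\varepsilon$ be the least energy nodal radial solution (in the sense of the context) of $$-\Delta u=\lambda u e^{u^2+|u|^{1+\varepsilon}}\ \text{ in } B,\qquad u=0\ \text{ on }\partial B,$$ with $k$ interior zeros $0=r_{0,\varepsilon}<r_{1,\varepsilon}<\dots<r_{k,\varepsilon}<r_{k+1,\varepsilon}=1$ and $u_\varepsilon(0)>0$. For $i=1,\dots,k$ let $A_{i,\varepsilon}=(r_{i-1,\varepsilon},r_{i,\varepsilon})$, let $M_{i,\varepsilon}\in[r_{i-1,\varepsilon},r_{i,\varepsilon})$ be the point such that $|u_\varepsilon(M_{i,\varepsilon})|=\|u_\varepsilon\|_{L^\infty(A_{i,\varepsilon})}$ (so $M_{1,\varepsilon}=0$), and let $\delta_{i,\varepsilon}=r_{i,\varepsilon}\gamma_{i,\varepsilon}$, where $\gamma_{i,\varepsilon}>0$ is defined by $$2\lambda\, r_{i,\varepsilon}^2\, e^{\|u_\varepsilon\|_{L^\infty(A_{i,\varepsilon})}^{2}+\|u_\varepsilon\|_{L^\infty(A_{i,\varepsilon})}^{1+\varepsilon}}\,\|u_\varepsilon\|_{L^\infty(A_{i,\varepsilon})}^2\,\gamma_{i,\varepsilon}^2=1 .$$ Then, for each $i=1,\dots,k$, as $\varepsilon\searrow0$, $\delta_{i,\varepsilon}\to0$ and $$2\|u_\varepsilon\|_{L^\infty(A_{i,\varepsilon})}\Big(|u_\varepsilon(M_{i,\varepsilon}+\delta_{i,\varepsilon}r)|-\|u_\varepsilon\|_{L^\infty(A_{i,\varepsilon})}\Big)\to\log\frac{1}{\left(1+\frac{r^2}{8}\right)^2}\quad\text{in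 } C^1_{\mathrm{loc}}(0,+\infty).$$
   Context: $B$ is the open unit ball of $\mathbb{R}^2$ and $\lambda_1$ is the first eigenvalue of $-\Delta$ on $B$ with Dirichlet boundary conditions. For $r>0$, $B_r$ is the ball of radius $r$ centred at $0$; $B(0,r)=B_r$ and $B(r,s)=B_s\setminus B_r$ for $0<r<s$. Radial functions are also regarded as functions of $r=|x|$. $\lambda_{\mathrm{AY}}>0$ is a constant (given by a theorem of Adimurthi and Yadava) such that for every $\lambda\in(0,\lambda_{\mathrm{AY}})$ the problem $-\Delta u=\lambda u e^{u^2+|u|}$ in $B$, $u=0$ on $\partial B$, has no sign-changing radial solution. For $\varepsilon\ge0$ put $f_\varepsilon(s)=\lambda s e^{s^2+|s|^{1+\varepsilon}}$, $F_\varepsilon(s)=\int_0^s f_\varepsilon(t)\,dt$, and $I_\varepsilon(u)=\frac12\int_B|\nabla u|^2dx-\int_BF_\varepsilon(u)\,dx$ for $u\in H^1_0(B)$. Let $H^1_{\mathrm{r},0}(B)$ be the subspace of radial functions in $H^1_0(B)$, and $$\mathcal N_\varepsilon=\Big\{u\in H^1_{\mathrm{r},0}(B)\setminus\{0\}:\int_B|\nabla u|^2dx=\int_Bf_\varepsilon(u)u\,dx\Big\}.$$ For $k\in\mathbb{N}$, $\mathcal N_{k,\varepsilon}$ is the set of $u\in H^1_{\mathrm{r},0}(B)$ for which there are $0=r_0<r_1<\dots<r_{k+1}=1$ with $u(r_i)=0$ for $1\le i\le k+1$ and such that, for $1\le i\le k+1$, the restriction $u_i$ of $u$ to $B(r_{i-1},r_i)$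 (extended by zero to $B$) satisfies $(-1)^{i-1}u_i>0$ for $r_{i-1}<|x|<r_i$ and $u_i\in\mathcal N_\varepsilon$. "The least energy nodal radial solution" $u_\varepsilon$ (whose existence is due to Adimurthi and Yadava) means: $u_\varepsilon\in\mathcal N_{k,\varepsilon}$ solves $-\Delta u=f_\varepsilon(u)$ in $B$, $u=0$ on $\partial B$, and $I_\varepsilon(u_\varepsilon)=\inf_{\mathcal N_{k,\varepsilon}}I_\varepsilon$. *)

theory Defs
  imports "HOL-Analysis.Analysis" "HOL-Probability.Essential_Supremum"
begin

type_synonym plane = "real^2"

abbreviation disc :: "plane set" where
  "disc \<equiv> ball 0 1"

subsection \<open>Differentiability and the Dirichlet problem\<close>

text \<open>For open \<open>S\<close>, this says that \<open>f\<close> is of class \<open>C\<close>-\<open>n\<close> on \<open>S\<close>.\<close>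

fun Ck_on :: "nat \<Rightarrow> ('a::euclidean_space \<Rightarrow> real) \<Rightarrow> 'a set \<Rightarrow> bool" where
  "Ck_on 0 f S \<longleftrightarrow> continuous_on S f"
| "Ck_on (Suc n) f S \<longleftrightarrow> (\<forall>x\<in>S. f differentiable (at x)) \<and>
     (\<forall>v. Ck_on n (\<lambda>x. frechet_derivative f (at x) v) S)"

definition gradient :: "(plane \<Rightarrow> real) \<Rightarrow> plane \<Rightarrow> plane" where
  "gradient u x = (\<chi> i. frechet_derivative u (at x) (axis i 1))"

definition laplacian :: "(plane \<Rightarrow> real) \<Rightarrow> plane \<Rightarrow> real" where
  "laplacian u x = (\<Sum>i\<in>UNIV. frechet_derivative (\<lambda>y. gradient u y $ i) (at x) (axis i 1))"

text \<open>Classical solutions of \<open>-\<Delta>u = g(u)\<close> in the disc with \<open>u = 0\<close> on the boundary.\<close>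

definition dirichlet_solution :: "(real \<Rightarrow> real) \<Rightarrow> (plane \<Rightarrow> real) \<Rightarrow> bool" where
  "dirichlet_solution g u \<longleftrightarrow>
     Ck_on 2 u disc \<and> continuous_on (cball 0 1) u \<and>
     (\<forall>x\<in>disc. - laplacian u x = g (u x)) \<and> (\<forall>x\<in>sphere 0 1. u x = 0)"

definition dirichlet_eigenvalue :: "real \<Rightarrow> bool" where
  "dirichlet_eigenvalue \<mu> \<longleftrightarrow>
     (\<exists>u. dirichlet_solution (\<lambda>s. \<mu> * s) u \<and> (\<exists>x\<in>disc. u x \<noteq> 0))"

definition lambda1 :: real where
  "lambda1 = Inf {\<mu>. dirichlet_eigenvalue \<mu>}"

subsection \<open>Sobolev spaces\<close>

text \<open>Sobolev functions are represented by everywhere defined functions whose values outside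
  \<open>U\<close> are irrelevant; no quotient by almost-everywhere equality is formed.\<close>

definition test_function :: "plane set \<Rightarrow> (plane \<Rightarrow> real) \<Rightarrow> bool" where
  "test_function U \<phi> \<longleftrightarrow> (\<forall>n. Ck_on n \<phi> UNIV) \<and>
     compact (closure {x. \<phi> x \<noteq> 0}) \<and> closure {x. \<phi> x \<noteq> 0} \<subseteq> U"

definition L2_on :: "plane set \<Rightarrow> (plane \<Rightarrow> 'b::euclidean_space) \<Rightarrow> bool" where
  "L2_on U f \<longleftrightarrow> set_borel_measurable lebesgue U f \<and>
     set_integrable lebesgue U (\<lambda>x. (norm (f x))\<^sup>2)"

definition has_weak_gradient :: "plane set \<Rightarrow> (plane \<Rightarrow> real) \<Rightarrow> (plane \<Rightarrow> plane) \<Rightarrow> bool" where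
  "has_weak_gradient U u G \<longleftrightarrow>
     (\<forall>\<phi> i. test_function U \<phi> \<longrightarrow>
        (LINT x:U|lebesgue. u x * gradient \<phi> x $ i) = - (LINT x:U|lebesgue. G x $ i * \<phi> x))"

definition H1 :: "plane set \<Rightarrow> (plane \<Rightarrow> real) set" where
  "H1 U = {u. L2_on U u \<and> (\<exists>G. L2_on U G \<and> has_weak_gradient U u G)}"

definition weak_gradient :: "plane set \<Rightarrow> (plane \<Rightarrow> real) \<Rightarrow> plane \<Rightarrow> plane" where
  "weak_gradient U u = (SOME G. L2_on U G \<and> has_weak_gradient U u G)"

definition H1_norm :: "plane set \<Rightarrow> (plane \<Rightarrow> real) \<Rightarrow> real" where
  "H1_norm U u = sqrt ((LINT x:U|lebesgue. (u x)\<^sup>2) +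
     (LINT x:U|lebesgue. (norm (weak_gradient U u x))\<^sup>2))"

definition H10 :: "plane set \<Rightarrow> (plane \<Rightarrow> real) set" where
  "H10 U = {u \<in> H1 U. \<exists>\<phi>. (\<forall>n. test_function U (\<phi> n)) \<and>
     (\<lambda>n. H1_norm U (\<lambda>x. u x - \<phi> n x)) \<longlonglongrightarrow> 0}"

subsection \<open>Radial functions\<close>

definition radial :: "(plane \<Rightarrow> real) \<Rightarrow> bool" where
  "radial u \<longleftrightarrow> (\<forall>x\<in>cball 0 1. \<forall>y\<in>cball 0 1. norm x = norm y \<longrightarrow> u x = u y)"

definition profile :: "(plane \<Rightarrow> real) \<Rightarrow> real \<Rightarrow> real" where
  "profile u t = u (t *\<^sub>R axis 1 1)"

text \<open>A radial \<open>H1\<close> function has a representative that is continuous away from the origin.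
  Pointwise conditions such as \<open>u(r) = 0\<close> refer to this representative, so it is the one
  required here.\<close>

definition H10_rad :: "(plane \<Rightarrow> real) set" where
  "H10_rad = {u \<in> H10 disc. radial u \<and> continuous_on (cball 0 1 - {0}) u}"

subsection \<open>The variational problem\<close>

definition f_nl :: "real \<Rightarrow> real \<Rightarrow> real \<Rightarrow> real" where
  "f_nl lam \<epsilon> s = lam * s * exp (s\<^sup>2 + \<bar>s\<bar> powr (1 + \<epsilon>))"

definition F_nl :: "real \<Rightarrow> real \<Rightarrow> real \<Rightarrow> real" where
  "F_nl lam \<epsilon> s = (LBINT t=ereal 0..ereal s. f_nl lam \<epsilon> t)"

definition energy :: "real \<Rightarrow> real \<Rightarrow> (plane \<Rightarrow> real) \<Rightarrow> real" where
  "energy lam \<epsilon> u =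
     1/2 * (LINT x:disc|lebesgue. (norm (weak_gradient disc u x))\<^sup>2)
     - (LINT x:disc|lebesgue. F_nl lam \<epsilon> (u x))"

definition nehari :: "real \<Rightarrow> real \<Rightarrow> (plane \<Rightarrow> real) set" where
  "nehari lam \<epsilon> = {u \<in> H10_rad. \<not> (AE x in lebesgue. x \<in> disc \<longrightarrow> u x = 0) \<and>
     (LINT x:disc|lebesgue. (norm (weak_gradient disc u x))\<^sup>2) =
     (LINT x:disc|lebesgue. f_nl lam \<epsilon> (u x) * u x)}"

text \<open>Since \<open>ball 0 0\<close> is empty, \<open>annulus 0 s\<close> is the full ball of radius \<open>s\<close>.\<close>

definition annulus :: "real \<Rightarrow> real \<Rightarrow> plane set" where
  "annulus r s = ball 0 s - ball 0 r"

definition nehari_nodal :: "nat \<Rightarrow> real \<Rightarrow> real \<Rightarrow> (plane \<Rightarrow> real) set" where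
  "nehari_nodal k lam \<epsilon> = {u \<in> H10_rad. \<exists>r :: nat \<Rightarrow> real.
     r 0 = 0 \<and> (\<forall>i\<le>k. r i < r (Suc i)) \<and> r (Suc k) = 1 \<and>
     (\<forall>i\<in>{1..Suc k}. profile u (r i) = 0 \<and>
        (\<forall>x. r (i - 1) < norm x \<and> norm x < r i \<longrightarrow> (- 1) ^ (i - 1) * u x > 0) \<and>
        (\<lambda>x. if x \<in> annulus (r (i - 1)) (r i) then u x else 0) \<in> nehari lam \<epsilon>)}"

definition least_energy_nodal_solution ::
    "nat \<Rightarrow> real \<Rightarrow> real \<Rightarrow> (plane \<Rightarrow> real) \<Rightarrow> bool" where
  "least_energy_nodal_solution k lam \<epsilon> u \<longleftrightarrow>
     u \<in> nehari_nodal k lam \<epsilon> \<and> dirichlet_solution (f_nl lam \<epsilon>) u \<and>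
     energy lam \<epsilon> u = (INF v\<in>nehari_nodal k lam \<epsilon>. energy lam \<epsilon> v)"

definition no_sign_changing_radial_solution :: "real \<Rightarrow> bool" where
  "no_sign_changing_radial_solution lam \<longleftrightarrow>
     \<not> (\<exists>u. radial u \<and> dirichlet_solution (f_nl lam 0) u \<and>
          (\<exists>x\<in>disc. u x > 0) \<and> (\<exists>x\<in>disc. u x < 0))"

definition interior_nodes :: "nat \<Rightarrow> (plane \<Rightarrow> real) \<Rightarrow> (nat \<Rightarrow> real) \<Rightarrow> bool" where
  "interior_nodes k u r \<longleftrightarrow>
     r 0 = 0 \<and> (\<forall>i\<le>k. r i < r (Suc i)) \<and> r (Suc k) = 1 \<and>
     {t \<in> {0<..<1}. profile u t = 0} = r ` {1..k}"

subsection \<open>Norms and convergence on intervals\<close>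

definition Linf_norm :: "real set \<Rightarrow> (real \<Rightarrow> real) \<Rightarrow> real" where
  "Linf_norm A v = real_of_ereal (esssup (restrict_space lborel A) (\<lambda>t. ereal \<bar>v t\<bar>))"

text \<open>\<open>C1\<close> convergence on every compact subset of \<open>S\<close>. The functions need not be \<open>C1\<close>
  on all of \<open>S\<close>: on a given compact set this is only required eventually.\<close>

definition C1_loc_limit ::
    "real set \<Rightarrow> ('i \<Rightarrow> real \<Rightarrow> real) \<Rightarrow> (real \<Rightarrow> real) \<Rightarrow> 'i filter \<Rightarrow> bool" where
  "C1_loc_limit S f g F \<longleftrightarrow>
     (\<forall>K. compact K \<and> K \<subseteq> S \<longrightarrow>
        (\<forall>\<^sub>F e in F. f e C1_differentiable_on K) \<and>
        uniform_limit K f g F \<and> uniform_limit K (\<lambda>e. deriv (f e)) (deriv g) F)"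

end

theory Submission
  imports Defs "HOL-Real_Asymp.Real_Asymp" "HOL-Complex_Analysis.Great_Picard"
begin

text \<open>
  Let \<open>w = \<plusminus>u\<close> be the absolute value of the solution on one nodal interval, as a function of
  the radius, and let \<open>p(r) = - r w'(r)\<close>.  The equation becomes the system \<open>w' = - p / r\<close>,
  \<open>p' = r f(w)\<close>.  Let \<open>S\<close> be the maximum of \<open>w\<close>, \<open>M\<close> the point where it is attained and \<open>R\<close> the
  right end of the interval; the scale of the statement is the \<open>\<delta>\<close> with \<open>2 S f(S) \<delta>\<^sup>2 = 1\<close>.  The rescaled
  function \<open>2 S (w(\<delta> x) - S)\<close> solves the radial Liouville equation \<open>- \<Delta> v = e\<^sup>v\<close> up to errors that vanish
  as \<open>S\<close> grows, and it starts with value and flux zero at \<open>x = M / \<delta>\<close>.  The radial solution with \<open>v(0) = 0\<close>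
  is \<open>- 2 ln (1 + x\<^sup>2 / 8)\<close>, so the theorem follows from a stability estimate
  (\<open>bubble_convergence_bound\<close>, \<open>rescaled_bumps_converge\<close>) once two facts are known on each of the
  first \<open>k\<close> intervals: \<open>S\<close> tends to infinity, and \<open>M / \<delta>\<close> tends to zero.  They are proved by induction
  over the intervals, from the centre outwards.

  The descent from \<open>M\<close> to \<open>R\<close>.  If \<open>ln f\<close> were affine with slope \<open>c\<close>, then
  \<open>c p\<^sup>2 / 2 - 2 p + r\<^sup>2 f(w)\<close> would be constant (\<open>Q_deriv\<close>).  Since \<open>ln f\<close> is convex above level one,
  comparing its slope with its values at two levels makes \<open>p\<close> satisfy a logistic differential
  inequality from each side.  The lower one says that \<open>w\<close> lies below a Liouville profile; as
  \<open>ln \<delta>\<close> is about \<open>- (S\<^sup>2 + S powr (1 + \<epsilon>)) / 2\<close>, that profile vanishes where \<open>ln r\<close> is about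
  \<open>- (1 - \<epsilon>) S powr (1 + \<epsilon>) / 4\<close>: the quadratic terms cancel and the perturbation of the exponent
  decides that \<open>R\<close> tends to zero.  The upper one gives \<open>p(R) \<le> (2 + o(1)) / S\<close>, hence also
  \<open>ln (1 / R) = o(S\<^sup>2)\<close>, and so \<open>p(R)\<^sup>2 ln (1 / R)\<close> tends to zero (\<open>bump_exit\<close>).

  The ascent on the next interval.  There \<open>w\<close> is a concave function of \<open>ln r\<close> which leaves zero with
  slope \<open>p(R)\<close>.  Its height is therefore at most \<open>p(R) ln (1 / R)\<close>, and it needs a logarithmic distance
  of at least \<open>S / p(R)\<close> to reach the height \<open>S\<close>.  Over such a distance it is almost flat near its top,
  and the nonlinearity leaves room for this only if \<open>M\<close> is small against \<open>\<delta>\<close>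
  (\<open>entry_max_point_vs_scale\<close>).

  The heights.  If \<open>S\<close> stayed bounded on one of the first \<open>k\<close> intervals while \<open>M\<close> tends to zero, then
  \<open>u / S\<close>, which is bounded by one beyond \<open>M\<close>, would have a limit on the whole disc.  According to
  whether \<open>S\<close> tends to zero or not, this limit is a function with a zero that solves
  \<open>- \<Delta> v = \<lambda> v\<close>, which makes a number not exceeding \<open>\<lambda> < \<lambda>\<^sub>1\<close> a Dirichlet eigenvalue,
  or a multiple of a sign-changing radial solution for \<open>\<epsilon> = 0\<close>, which the choice of \<open>\<lambda>\<close> excludes
  (\<open>heights_unbounded\<close>).  The change of sign survives in the limit because a further nodal interval
  follows, and a Pohozaev identity bounds its height from below.
\<close>

section \<open>Monotonicity from derivatives\<close>

lemma nondecreasing_by_deriv: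
  fixes \<phi> \<phi>' :: "real \<Rightarrow> real"
  assumes "a \<le> b" "continuous_on {a..b} \<phi>"
    and "\<And>x. a < x \<Longrightarrow> x < b \<Longrightarrow> (\<phi> has_real_derivative \<phi>' x) (at x)"
    and "\<And>x. a < x \<Longrightarrow> x < b \<Longrightarrow> 0 \<le> \<phi>' x"
  shows "\<phi> a \<le> \<phi> b"
  using DERIV_nonneg_imp_increasing_open[of a b \<phi>] assms by blast

lemma nonincreasing_by_deriv:
  fixes \<phi> \<phi>' :: "real \<Rightarrow> real"
  assumes "a \<le> b" "continuous_on {a..b} \<phi>"
    and "\<And>x. a < x \<Longrightarrow> x < b \<Longrightarrow> (\<phi> has_real_derivative \<phi>' x) (at x)"
    and "\<And>x. a < x \<Longrightarrow> x < b \<Longrightarrow> \<phi>' x \<le> 0"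
  shows "\<phi> b \<le> \<phi> a"
  using DERIV_nonpos_imp_decreasing_open[of a b \<phi>] assms by blast

lemma lipschitz_by_deriv:
  fixes \<phi> \<phi>' :: "real \<Rightarrow> real"
  assumes "a \<le> b" "continuous_on {a..b} \<phi>"
    and "\<And>x. a < x \<Longrightarrow> x < b \<Longrightarrow> (\<phi> has_real_derivative \<phi>' x) (at x)"
    and "\<And>x. a < x \<Longrightarrow> x < b \<Longrightarrow> \<bar>\<phi>' x\<bar> \<le> C"
  shows "\<bar>\<phi> b - \<phi> a\<bar> \<le> C * (b - a)"
proof -
  have "C * a - \<phi> a \<le> C * b - \<phi> b"
  proof (rule nondecreasing_by_deriv[where \<phi> = "\<lambda>x. C * x - \<phi> x"])
    fix x assume x: "a < x" "x < b"
    show "((\<lambda>x. C * x - \<phi> x) has_real_derivative C - \<phi>' x) (at x)"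
      using assms(3)[OF x] by (auto intro!: derivative_eq_intros)
    show "0 \<le> C - \<phi>' x" using assms(4)[OF x] by linarith
  qed (use assms in \<open>auto intro!: continuous_intros\<close>)
  moreover have "C * a + \<phi> a \<le> C * b + \<phi> b"
  proof (rule nondecreasing_by_deriv[where \<phi> = "\<lambda>x. C * x + \<phi> x"])
    fix x assume x: "a < x" "x < b"
    show "((\<lambda>x. C * x + \<phi> x) has_real_derivative C + \<phi>' x) (at x)"
      using assms(3)[OF x] by (auto intro!: derivative_eq_intros)
    show "0 \<le> C + \<phi>' x" using assms(4)[OF x] by linarith
  qed (use assms in \<open>auto intro!: continuous_intros\<close>)
  ultimately show ?thesis by (simp add: abs_le_iff algebra_simps)
qed

section \<open>The nonlinearity\<close>

definition hexp :: "real \<Rightarrow> real \<Rightarrow> real" where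
  "hexp \<epsilon> s = s\<^sup>2 + s powr (1 + \<epsilon>)"

text \<open>The derivative of \<open>ln f_nl\<close> on the positive half-line.\<close>
definition log_deriv :: "real \<Rightarrow> real \<Rightarrow> real" where
  "log_deriv \<epsilon> s = 1 / s + 2 * s + (1 + \<epsilon>) * s powr \<epsilon>"

lemma f_nl_eq: "0 \<le> s \<Longrightarrow> f_nl lam \<epsilon> s = lam * s * exp (hexp \<epsilon> s)"
  by (simp add: f_nl_def hexp_def)

lemma f_nl_odd: "f_nl lam \<epsilon> (- s) = - f_nl lam \<epsilon> s"
  by (simp add: f_nl_def)

lemma hexp_mono: "0 \<le> \<epsilon> \<Longrightarrow> 0 \<le> s \<Longrightarrow> s \<le> t \<Longrightarrow> hexp \<epsilon> s \<le> hexp \<epsilon> t"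
  unfolding hexp_def by (intro add_mono power_mono powr_mono2) auto

lemma hexp_nonneg: "0 \<le> hexp \<epsilon> s"
  unfolding hexp_def by simp

lemma f_nl_pos: "0 < lam \<Longrightarrow> 0 < s \<Longrightarrow> 0 < f_nl lam \<epsilon> s"
  by (simp add: f_nl_def)

lemma f_nl_nonneg: "0 < lam \<Longrightarrow> 0 \<le> s \<Longrightarrow> 0 \<le> f_nl lam \<epsilon> s"
  by (simp add: f_nl_def)

lemma f_nl_mono: "0 < lam \<Longrightarrow> 0 \<le> \<epsilon> \<Longrightarrow> 0 \<le> s \<Longrightarrow> s \<le> t \<Longrightarrow> f_nl lam \<epsilon> s \<le> f_nl lam \<epsilon> t"
  by (simp add: f_nl_eq, intro mult_mono) (auto simp: hexp_mono)

lemma f_nl_ge_linear: "0 < lam \<Longrightarrow> 0 \<le> s \<Longrightarrow> lam * s \<le> f_nl lam \<epsilon> s"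
  using mult_left_mono[of 1 "exp (hexp \<epsilon> s)" "lam * s"] by (simp add: f_nl_eq hexp_nonneg)

lemma hexp_deriv:
  assumes "0 < s"
  shows "(hexp \<epsilon> has_real_derivative 2 * s + (1 + \<epsilon>) * s powr \<epsilon>) (at s)"
  unfolding hexp_def using assms
  by (auto intro!: derivative_eq_intros simp: field_simps)

lemma f_nl_deriv:
  assumes "0 < s"
  shows "(f_nl lam \<epsilon> has_real_derivative f_nl lam \<epsilon> s * log_deriv \<epsilon> s) (at s)"
proof -
  have "((\<lambda>s. lam * s * exp (hexp \<epsilon> s)) has_real_derivative
      lam * exp (hexp \<epsilon> s) + lam * s * (exp (hexp \<epsilon> s) * (2 * s + (1 + \<epsilon>) * s powr \<epsilon>))) (at s)"
    using assms by (auto intro!: derivative_eq_intros hexp_deriv)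
  moreover have "lam * exp (hexp \<epsilon> s) + lam * s * (exp (hexp \<epsilon> s) * (2 * s + (1 + \<epsilon>) * s powr \<epsilon>))
      = f_nl lam \<epsilon> s * log_deriv \<epsilon> s"
    using assms by (simp add: f_nl_eq log_deriv_def field_simps)
  ultimately have "((\<lambda>s. lam * s * exp (hexp \<epsilon> s)) has_real_derivative
      f_nl lam \<epsilon> s * log_deriv \<epsilon> s) (at s)" by simp
  then show ?thesis
    by (rule has_field_derivative_transform_within_open[where S = "{0<..}"]) (use assms f_nl_eq in auto)
qed

lemma powr_eps_le:
  assumes "0 \<le> \<epsilon>" "\<epsilon> \<le> 1" "1 \<le> (S::real)"
  shows "S powr \<epsilon> \<le> S"
  using powr_mono[of \<epsilon> 1 S] assms by simp

lemma hexp_lipschitz: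
  assumes "0 \<le> \<epsilon>" "\<epsilon> \<le> 1" "1 \<le> S" "0 < w" "w \<le> S"
  shows "hexp \<epsilon> S - hexp \<epsilon> w \<le> 4 * S * (S - w)"
proof -
  have "4 * S * w - hexp \<epsilon> w \<le> 4 * S * S - hexp \<epsilon> S"
  proof (rule nondecreasing_by_deriv[where \<phi> = "\<lambda>x. 4 * S * x - hexp \<epsilon> x"])
    show "continuous_on {w..S} (\<lambda>x. 4 * S * x - hexp \<epsilon> x)"
      unfolding hexp_def using assms by (intro continuous_intros) auto
    fix x assume x: "w < x" "x < S"
    show "((\<lambda>x. 4 * S * x - hexp \<epsilon> x) has_real_derivative
        4 * S - (2 * x + (1 + \<epsilon>) * x powr \<epsilon>)) (at x)"
      using x assms by (auto intro!: derivative_eq_intros hexp_deriv)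
    have "x powr \<epsilon> \<le> S powr \<epsilon>" using x assms by (intro powr_mono2) auto
    also have "\<dots> \<le> S" using assms by (intro powr_eps_le) auto
    finally have "(1 + \<epsilon>) * x powr \<epsilon> \<le> 2 * S"
      using assms by (intro mult_mono) auto
    then show "0 \<le> 4 * S - (2 * x + (1 + \<epsilon>) * x powr \<epsilon>)" using x by simp
  qed (use assms in auto)
  then show ?thesis by (simp add: algebra_simps)
qed

lemma exp_neg_half_ge: "4 / 7 \<le> exp (- (1/2) :: real)"
proof -
  have "exp (1/2) ^ 2 = exp (1::real)" by (simp add: exp_double[symmetric])
  also have "\<dots> \<le> (7/4)^2" using exp_le by (simp add: power2_eq_square)
  finally have "exp (1/2) \<le> (7/4::real)" using power2_le_imp_le[of "exp (1/2::real)" "7/4"] by simp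
  then have "inverse (7/4) \<le> inverse (exp (1/2::real))" by (intro le_imp_inverse_le) auto
  then show ?thesis by (simp add: exp_minus)
qed

text \<open>The exponent has slope of order \<open>S\<close> near \<open>S\<close>, so on a window of width of order \<open>1 / S\<close> below \<open>S\<close> the
  nonlinearity keeps a fixed fraction of its top value.\<close>
lemma f_nl_near_top:
  assumes "0 < lam" "0 \<le> \<epsilon>" "\<epsilon> \<le> 1" "1 \<le> S" "S - 1 / (8 * S) \<le> w" "w \<le> S"
  shows "f_nl lam \<epsilon> S / 2 \<le> f_nl lam \<epsilon> w"
proof -
  have w: "7 / 8 * S \<le> w"
  proof -
    have "1 / (8 * S) \<le> S / 8" using assms by (simp add: field_simps) (metis mult_mono' one_le_numeral mult_1 zero_le_one)
    then show ?thesis using assms by simp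
  qed
  then have w0: "0 < w" using assms by simp
  have "hexp \<epsilon> S - hexp \<epsilon> w \<le> 4 * S * (S - w)" using hexp_lipschitz assms w0 by simp
  also have "\<dots> \<le> 4 * S * (1 / (8 * S))" using assms by (intro mult_left_mono) auto
  also have "\<dots> = 1/2" using assms by simp
  finally have "hexp \<epsilon> S + (- (1/2)) \<le> hexp \<epsilon> w" by simp
  then have "exp (hexp \<epsilon> S + (- (1/2))) \<le> exp (hexp \<epsilon> w)" by simp
  then have "exp (hexp \<epsilon> S) * exp (- (1/2)) \<le> exp (hexp \<epsilon> w)" by (simp only: exp_add)
  moreover have "exp (hexp \<epsilon> S) * (4/7) \<le> exp (hexp \<epsilon> S) * exp (- (1/2))"
    by (intro mult_left_mono exp_neg_half_ge) auto
  ultimately have e: "exp (hexp \<epsilon> S) * (4/7) \<le> exp (hexp \<epsilon> w)" by (rule order_trans[rotated])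
  have "(7 / 8 * S) * (exp (hexp \<epsilon> S) * (4/7)) \<le> w * exp (hexp \<epsilon> w)"
    using w e w0 by (intro mult_mono) auto
  then have "lam * ((7 / 8 * S) * (exp (hexp \<epsilon> S) * (4/7))) \<le> lam * (w * exp (hexp \<epsilon> w))"
    using assms by simp
  then show ?thesis using w0 assms by (simp add: f_nl_eq field_simps)
qed

text \<open>This is the convexity of \<open>ln f_nl\<close> above level one; closer to zero the term \<open>1 / s\<close> destroys it.\<close>
lemma log_deriv_mono:
  assumes "0 \<le> \<epsilon>" "1 \<le> w" "w \<le> S"
  shows "log_deriv \<epsilon> w \<le> log_deriv \<epsilon> S"
proof -
  have "1 / w + 2 * w \<le> 1 / S + 2 * S"
  proof -
    have "1 / w - 1 / S = (S - w) / (w * S)" using assms by (simp add: field_simps)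
    also have "\<dots> \<le> (S - w) / 1"
      using assms mult_mono[of 1 w 1 S] by (intro divide_left_mono) auto
    finally show ?thesis using assms by simp
  qed
  moreover have "(1 + \<epsilon>) * w powr \<epsilon> \<le> (1 + \<epsilon>) * S powr \<epsilon>"
    using assms by (intro mult_left_mono powr_mono2) auto
  ultimately show ?thesis by (simp add: log_deriv_def)
qed

lemma log_deriv_bounds:
  assumes "0 \<le> \<epsilon>" "\<epsilon> \<le> 1" "1 \<le> S"
  shows "2 * S \<le> log_deriv \<epsilon> S" "log_deriv \<epsilon> S \<le> 5 * S"
proof -
  have "(1 + \<epsilon>) * S powr \<epsilon> \<le> 2 * S"
    using assms powr_eps_le[of \<epsilon> S] by (intro mult_mono) auto
  moreover have "1 / S \<le> S" using assms mult_mono[of 1 S 1 S] by (simp add: field_simps)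
  ultimately show "log_deriv \<epsilon> S \<le> 5 * S" by (simp add: log_deriv_def)
  show "2 * S \<le> log_deriv \<epsilon> S" using assms by (simp add: log_deriv_def)
qed

section \<open>The descending part of a nodal interval\<close>

text \<open>The absolute value \<open>w\<close> of the solution between its maximum point \<open>M\<close> and the next zero \<open>R\<close>, with
  \<open>p\<close> standing for \<open>- r w'(r)\<close>.  The number \<open>d\<close> is the scale on which the maximum looks like a Liouville
  bubble.  The case \<open>M = 0\<close> is included, which is why the derivatives are required only in the open
  interval.\<close>
locale bump =
  fixes lam \<epsilon> M R S d :: real and w p :: "real \<Rightarrow> real"
  assumes lam_pos: "0 < lam" and eps: "0 \<le> \<epsilon>" "\<epsilon> \<le> 1/2"
    and M_nonneg: "0 \<le> M" and MR: "M < R"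
    and w_cont: "continuous_on {M..R} w" and p_cont: "continuous_on {M..R} p"
    and w_deriv: "\<And>r. M < r \<Longrightarrow> r < R \<Longrightarrow> (w has_real_derivative - p r / r) (at r)"
    and p_deriv: "\<And>r. M < r \<Longrightarrow> r < R \<Longrightarrow>
      (p has_real_derivative r * f_nl lam \<epsilon> (w r)) (at r)"
    and w_M: "w M = S" and p_M: "p M = 0"
    and w_pos: "\<And>r. M \<le> r \<Longrightarrow> r < R \<Longrightarrow> 0 < w r" and w_R: "w R = 0"
    and d_pos: "0 < d" and d_eq: "2 * S * f_nl lam \<epsilon> S * d\<^sup>2 = 1"
begin

lemma R_pos: "0 < R" using M_nonneg MR by simp

lemma w_nonneg: "M \<le> r \<Longrightarrow> r \<le> R \<Longrightarrow> 0 \<le> w r"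
  using w_pos[of r] w_R by (cases "r = R") auto

lemma cont_sub:
  assumes "M \<le> a" "b \<le> R"
  shows "continuous_on {a..b} w" "continuous_on {a..b} p"
  using w_cont p_cont assms by (auto elim: continuous_on_subset)

lemma f_top: "f_nl lam \<epsilon> S = 1 / (2 * S * d\<^sup>2)" and S_pos: "0 < S"
proof -
  show "0 < S" using w_pos[of M] w_M MR by simp
  then show "f_nl lam \<epsilon> S = 1 / (2 * S * d\<^sup>2)" using d_eq d_pos by (simp add: field_simps)
qed

lemma p_less: "M \<le> r \<Longrightarrow> r < s \<Longrightarrow> s \<le> R \<Longrightarrow> p r < p s"
proof -
  assume rs: "M \<le> r" "r < s" "s \<le> R"
  show "p r < p s"
  proof (rule DERIV_pos_imp_increasing_open[OF rs(2)])
    fix x assume "r < x" "x < s"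
    then show "\<exists>y. (p has_real_derivative y) (at x) \<and> 0 < y"
      using p_deriv[of x] f_nl_pos[OF lam_pos w_pos[of x]] rs M_nonneg
      by (intro exI[of _ "x * f_nl lam \<epsilon> (w x)"]) auto
  qed (use cont_sub rs in auto)
qed

lemma p_le: "M \<le> r \<Longrightarrow> r \<le> s \<Longrightarrow> s \<le> R \<Longrightarrow> p r \<le> p s"
  using p_less[of r s] by (cases "r = s") auto

lemma p_pos: "M < r \<Longrightarrow> r \<le> R \<Longrightarrow> 0 < p r"
  using p_less[of M r] p_M by simp

lemma w_less: "M \<le> r \<Longrightarrow> r < s \<Longrightarrow> s \<le> R \<Longrightarrow> w s < w r"
proof -
  assume rs: "M \<le> r" "r < s" "s \<le> R"
  show "w s < w r"
  proof (rule DERIV_neg_imp_decreasing_open[OF rs(2)])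
    fix x assume "r < x" "x < s"
    then show "\<exists>y. (w has_real_derivative y) (at x) \<and> y < 0"
      using w_deriv[of x] p_pos[of x] rs M_nonneg
      by (intro exI[of _ "- p x / x"]) auto
  qed (use cont_sub rs in auto)
qed

lemma w_antimono: "M \<le> r \<Longrightarrow> r \<le> s \<Longrightarrow> s \<le> R \<Longrightarrow> w s \<le> w r"
  using w_less[of r s] by (cases "r = s") auto

lemma w_le_S: "M \<le> r \<Longrightarrow> r \<le> R \<Longrightarrow> w r \<le> S"
  using w_antimono[of M r] w_M by simp

text \<open>Near the maximum the right-hand side of \<open>p' = r f(w)\<close> is at most its value for \<open>w = S\<close>; the next
  lemmas integrate this once and twice.\<close>
lemma p_upper_core:
  assumes "M \<le> r" "r \<le> R"
  shows "p r \<le> f_nl lam \<epsilon> S * (r\<^sup>2 - M\<^sup>2) / 2"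
proof -
  have "p r - f_nl lam \<epsilon> S * (r\<^sup>2 - M\<^sup>2) / 2 \<le> p M - f_nl lam \<epsilon> S * (M\<^sup>2 - M\<^sup>2) / 2"
  proof (rule nonincreasing_by_deriv[where \<phi> = "\<lambda>r. p r - f_nl lam \<epsilon> S * (r\<^sup>2 - M\<^sup>2) / 2"])
    show "continuous_on {M..r} (\<lambda>r. p r - f_nl lam \<epsilon> S * (r\<^sup>2 - M\<^sup>2) / 2)"
      using cont_sub assms by (intro continuous_intros) auto
    fix x assume x: "M < x" "x < r"
    show "((\<lambda>r. p r - f_nl lam \<epsilon> S * (r\<^sup>2 - M\<^sup>2) / 2) has_real_derivative
        x * f_nl lam \<epsilon> (w x) - f_nl lam \<epsilon> S * x) (at x)"
      using x assms p_deriv[of x] by (auto intro!: derivative_eq_intros)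
    show "x * f_nl lam \<epsilon> (w x) - f_nl lam \<epsilon> S * x \<le> 0"
      using x assms M_nonneg f_nl_mono[OF lam_pos eps(1) w_nonneg[of x] w_le_S[of x]]
      by (simp add: mult.commute mult_right_mono)
  qed (use assms in auto)
  then show ?thesis using p_M by simp
qed

lemma p_lower_core:
  assumes "M \<le> r" "r \<le> R" "0 \<le> c" "c \<le> w r"
  shows "f_nl lam \<epsilon> c * (r\<^sup>2 - M\<^sup>2) / 2 \<le> p r"
proof -
  have "p M - f_nl lam \<epsilon> c * (M\<^sup>2 - M\<^sup>2) / 2 \<le> p r - f_nl lam \<epsilon> c * (r\<^sup>2 - M\<^sup>2) / 2"
  proof (rule nondecreasing_by_deriv[where \<phi> = "\<lambda>r. p r - f_nl lam \<epsilon> c * (r\<^sup>2 - M\<^sup>2) / 2"])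
    show "continuous_on {M..r} (\<lambda>r. p r - f_nl lam \<epsilon> c * (r\<^sup>2 - M\<^sup>2) / 2)"
      using cont_sub assms by (intro continuous_intros) auto
    fix x assume x: "M < x" "x < r"
    show "((\<lambda>r. p r - f_nl lam \<epsilon> c * (r\<^sup>2 - M\<^sup>2) / 2) has_real_derivative
        x * f_nl lam \<epsilon> (w x) - f_nl lam \<epsilon> c * x) (at x)"
      using x assms p_deriv[of x] by (auto intro!: derivative_eq_intros)
    have "c \<le> w x" using w_antimono[of x r] x assms by simp
    then show "0 \<le> x * f_nl lam \<epsilon> (w x) - f_nl lam \<epsilon> c * x"
      using x assms M_nonneg f_nl_mono[OF lam_pos eps(1) assms(3), of "w x"]
      by (simp add: mult.commute mult_right_mono)
  qed (use assms in auto)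
  then show ?thesis using p_M by simp
qed

lemma w_lower_core:
  assumes "M \<le> r" "r \<le> R"
  shows "S - r\<^sup>2 / (8 * S * d\<^sup>2) \<le> w r"
proof -
  let ?A = "f_nl lam \<epsilon> S"
  have A: "0 < ?A" using f_nl_pos[OF lam_pos S_pos] .
  have "w M + ?A * M\<^sup>2 / 4 \<le> w r + ?A * r\<^sup>2 / 4"
  proof (rule nondecreasing_by_deriv[where \<phi> = "\<lambda>r. w r + ?A * r\<^sup>2 / 4"])
    show "continuous_on {M..r} (\<lambda>r. w r + ?A * r\<^sup>2 / 4)"
      using cont_sub assms by (intro continuous_intros) auto
    fix x assume x: "M < x" "x < r"
    show "((\<lambda>r. w r + ?A * r\<^sup>2 / 4) has_real_derivative - p x / x + ?A * x / 2) (at x)"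
      using x assms w_deriv[of x] by (auto intro!: derivative_eq_intros)
    have "p x \<le> ?A * (x\<^sup>2 - M\<^sup>2) / 2" using p_upper_core x assms by simp
    also have "\<dots> \<le> ?A * x\<^sup>2 / 2" using A by (simp add: mult_left_mono)
    finally show "0 \<le> - p x / x + ?A * x / 2"
      using x M_nonneg by (simp add: field_simps power2_eq_square)
  qed (use assms in auto)
  moreover have "0 \<le> ?A * M\<^sup>2 / 4" using A by simp
  ultimately have "S - ?A * r\<^sup>2 / 4 \<le> w r" using w_M by linarith
  then show ?thesis unfolding f_top by (simp add: field_simps)
qed

text \<open>Read backwards, the quadratic lower bound on \<open>w\<close> says that a drop by \<open>S - w(r)\<close> takes a radius of at
  least order \<open>d\<close>; in particular the zero \<open>R\<close> is far outside the core.\<close>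
lemma value_imp_radius:
  assumes "M \<le> r" "r \<le> R"
  shows "8 * S * (S - w r) * d\<^sup>2 \<le> r\<^sup>2"
proof -
  have "S - w r \<le> r\<^sup>2 / (8 * S * d\<^sup>2)" using w_lower_core[OF assms] by simp
  then show ?thesis using S_pos d_pos by (simp add: field_simps)
qed

lemma d_less_R: assumes "1 \<le> S" shows "d < R"
proof -
  have "8 * S * S * d\<^sup>2 \<le> R\<^sup>2" using value_imp_radius[of R] w_R MR by simp
  moreover have "1 * d\<^sup>2 < 8 * S * S * d\<^sup>2"
    using assms d_pos mult_mono[of 1 S 1 S] by (intro mult_strict_right_mono) auto
  ultimately show ?thesis using R_pos power2_less_imp_less[of d R] by simp
qed

lemma w_d_lower: assumes "1 \<le> S" "M \<le> d" shows "S - 1 / (8 * S) \<le> w d"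
  using w_lower_core[of d] assms d_less_R d_pos by (simp add: field_simps)

text \<open>The starting value for the logistic comparison: at the radius \<open>d\<close> the flux already has its
  final order of magnitude \<open>1 / S\<close>.\<close>
lemma p_d_lower:
  assumes "1 \<le> S" "M \<le> d / 2"
  shows "3 / (32 * S) \<le> p d"
proof -
  have Md: "M \<le> d" using assms d_pos by simp
  have wd: "S - 1 / (8 * S) \<le> w d" using w_d_lower assms Md by simp
  have f2: "f_nl lam \<epsilon> S / 2 \<le> f_nl lam \<epsilon> (w d)"
    using wd w_le_S[of d] Md d_less_R lam_pos eps assms by (intro f_nl_near_top) auto
  have M2: "M\<^sup>2 \<le> d\<^sup>2 / 4" using power_mono[OF assms(2) M_nonneg, of 2] by (simp add: power2_eq_square)
  have "3 / (32 * S) = (f_nl lam \<epsilon> S / 2) * (3/4 * d\<^sup>2) / 2"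
    unfolding f_top using S_pos d_pos by (simp add: field_simps)
  also have "\<dots> \<le> f_nl lam \<epsilon> (w d) * (d\<^sup>2 - M\<^sup>2) / 2"
    using f2 M2 f_nl_pos[OF lam_pos S_pos, of \<epsilon>] by (intro divide_right_mono mult_mono) auto
  also have "\<dots> \<le> p d"
    using p_lower_core[of d "w d"] Md d_less_R[OF assms(1)] w_nonneg[of d] by simp
  finally show ?thesis .
qed

text \<open>In the variable \<open>t = ln r\<close> the equation is \<open>w'' = - exp (2 t + ln f(w))\<close>.  If \<open>ln f\<close> is replaced by an
  affine function of slope \<open>c\<close>, this is an autonomous equation for the exponent \<open>2 t + ln f(w)\<close>, and \<open>Q\<close>
  is its first integral, up to normalisation.\<close>
definition Q :: "real \<Rightarrow> real \<Rightarrow> real" where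
  "Q c r = c * (p r)\<^sup>2 / 2 - 2 * p r + r\<^sup>2 * f_nl lam \<epsilon> (w r)"

lemma f_w_cont: "M \<le> a \<Longrightarrow> b \<le> R \<Longrightarrow> continuous_on {a..b} (\<lambda>r. f_nl lam \<epsilon> (w r))"
  unfolding f_nl_def using cont_sub[of a b] eps
  by (intro continuous_intros continuous_on_powr') auto

lemma Q_cont: "M \<le> a \<Longrightarrow> b \<le> R \<Longrightarrow> continuous_on {a..b} (Q c)"
  unfolding Q_def[abs_def] using cont_sub[of a b] f_w_cont[of a b]
  by (intro continuous_intros) auto

lemma Q_deriv:
  assumes "M < r" "r < R"
  shows "(Q c has_real_derivative
    r * f_nl lam \<epsilon> (w r) * p r * (c - log_deriv \<epsilon> (w r))) (at r)"
proof -
  have r: "0 < r" using assms M_nonneg by simp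
  have f': "((\<lambda>r. f_nl lam \<epsilon> (w r)) has_real_derivative
      f_nl lam \<epsilon> (w r) * log_deriv \<epsilon> (w r) * (- p r / r)) (at r)"
    using assms w_pos[of r] by (intro DERIV_chain2[OF f_nl_deriv w_deriv]) auto
  let ?f = "f_nl lam \<epsilon> (w r)"
  have "(Q c has_real_derivative
      c * (2 * p r * (r * ?f)) / 2 - 2 * (r * ?f)
        + (2 * r * ?f + r\<^sup>2 * (?f * log_deriv \<epsilon> (w r) * (- p r / r)))) (at r)"
    unfolding Q_def[abs_def]
    using p_deriv[OF assms] f' by (auto intro!: derivative_eq_intros)
  then show ?thesis
    using r by (simp add: field_simps power2_eq_square)
qed

section \<open>Logistic comparison and the position of the zero\<close>

abbreviation G :: real where "G \<equiv> log_deriv \<epsilon> S"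

text \<open>With \<open>c\<close> the slope of \<open>ln f\<close> at the top, convexity makes \<open>Q\<close> nondecreasing as long as \<open>w \<ge> 1\<close>, and
  \<open>Q\<close> is nonnegative at the maximum.  Since \<open>r p' = r\<^sup>2 f(w)\<close>, this is a logistic differential inequality
  for \<open>p\<close> in the variable \<open>ln r\<close>.\<close>
lemma logistic_lower:
  assumes "M \<le> r" "r \<le> R" "1 \<le> w r"
  shows "2 * p r - G * (p r)\<^sup>2 / 2 \<le> r\<^sup>2 * f_nl lam \<epsilon> (w r)"
proof -
  have "Q G M \<le> Q G r"
  proof (rule nondecreasing_by_deriv[where \<phi> = "Q G"])
    fix x assume x: "M < x" "x < r"
    show "(Q G has_real_derivative x * f_nl lam \<epsilon> (w x) * p x * (G - log_deriv \<epsilon> (w x))) (at x)"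
      using Q_deriv x assms by simp
    have "1 \<le> w x" using w_antimono[of x r] x assms by simp
    then show "0 \<le> x * f_nl lam \<epsilon> (w x) * p x * (G - log_deriv \<epsilon> (w x))"
      using log_deriv_mono[OF eps(1), of "w x" S] w_le_S[of x] x assms p_pos[of x] M_nonneg
        f_nl_nonneg[OF lam_pos w_nonneg[of x], of \<epsilon>]
      by (intro mult_nonneg_nonneg) auto
  qed (use assms Q_cont in auto)
  moreover have "0 \<le> Q G M"
    unfolding Q_def using p_M w_M f_nl_nonneg[OF lam_pos, of S \<epsilon>] S_pos by simp
  ultimately show ?thesis unfolding Q_def by simp
qed

text \<open>Solutions of the logistic equation keep \<open>(4 / (G p) - 1) r\<^sup>2\<close> constant; for a supersolution this
  quantity decreases.  The number 22 bounds its value at \<open>d\<close> divided by \<open>d\<^sup>2\<close>.\<close>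
lemma p_lower:
  assumes S1: "1 \<le> S" and Md: "M \<le> d / 2" and r: "d \<le> r" "r \<le> R" "1 \<le> w r"
  shows "4 / G * r\<^sup>2 / (r\<^sup>2 + 22 * d\<^sup>2) \<le> p r"
proof -
  have M0: "M < d" using Md d_pos by simp
  have e1: "\<epsilon> \<le> 1" using eps by simp
  have Gb: "2 * S \<le> G" "0 < G" using log_deriv_bounds(1)[OF eps(1) e1 S1] S1 by auto
  define X where "X = (\<lambda>r. (4 / (G * p r) - 1) * r\<^sup>2)"
  have "X r \<le> X d"
  proof (rule nonincreasing_by_deriv[where \<phi> = X])
    show "continuous_on {d..r} X" unfolding X_def
    proof (intro continuous_intros)
      show "continuous_on {d..r} p" using cont_sub[of d r] M0 r by auto
      show "\<forall>s\<in>{d..r}. G * p s \<noteq> 0"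
      proof
        fix s assume "s \<in> {d..r}"
        then have "0 < p s" using p_pos[of s] M0 r by auto
        then show "G * p s \<noteq> 0" using Gb by simp
      qed
    qed
    fix x assume x: "d < x" "x < r"
    let ?f = "f_nl lam \<epsilon> (w x)"
    have px: "0 < p x" and x0: "0 < x" using p_pos[of x] x r M0 d_pos by auto
    have "(X has_real_derivative
        (- (4 * (G * (x * ?f))) / (G * p x)\<^sup>2) * x\<^sup>2 + (4 / (G * p x) - 1) * (2 * x)) (at x)"
      unfolding X_def using p_deriv[of x] x r M0 px Gb
      by (auto intro!: derivative_eq_intros simp: power2_eq_square)
    then show "(X has_real_derivative
        (4 * x / (G * (p x)\<^sup>2)) * (2 * p x - G * (p x)\<^sup>2 / 2 - x\<^sup>2 * ?f)) (at x)"
      apply (rule DERIV_cong) using px Gb by (simp add: field_simps power2_eq_square)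
    have "1 \<le> w x" using w_antimono[of x r] x r M0 by simp
    then have "2 * p x - G * (p x)\<^sup>2 / 2 - x\<^sup>2 * ?f \<le> 0"
      using logistic_lower[of x] x r M0 by simp
    then show "(4 * x / (G * (p x)\<^sup>2)) * (2 * p x - G * (p x)\<^sup>2 / 2 - x\<^sup>2 * ?f) \<le> 0"
      using x0 Gb by (intro mult_nonneg_nonpos) auto
  qed (use r in auto)
  also have "X d \<le> 22 * d\<^sup>2"
  proof -
    have "6 / 32 \<le> G * p d"
    proof -
      have "(2 * S) * (3 / (32 * S)) \<le> G * p d"
        using Gb p_d_lower[OF S1 Md] S1 by (intro mult_mono) auto
      then show ?thesis using S1 by simp
    qed
    then have "4 / (G * p d) \<le> 4 / (6 / 32)" by (intro divide_left_mono) auto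
    then have "4 / (G * p d) - 1 \<le> 22" by simp
    then show ?thesis unfolding X_def by (intro mult_right_mono) auto
  qed
  finally have *: "(4 / (G * p r) - 1) * r\<^sup>2 \<le> 22 * d\<^sup>2" unfolding X_def .
  have pr: "0 < p r" using p_pos[of r] r M0 by simp
  have r2: "0 < r\<^sup>2" using r d_pos by simp
  have "4 * r\<^sup>2 \<le> (r\<^sup>2 + 22 * d\<^sup>2) * (G * p r)"
    using * pr Gb by (simp add: field_simps)
  then show ?thesis using Gb r2 by (simp add: field_simps add_pos_nonneg)
qed

text \<open>The lower bound on \<open>p\<close> is the flux of a Liouville profile, so integrating it puts \<open>w\<close> below that
  profile.\<close>
lemma ln_radius_upper:
  assumes S1: "1 \<le> S" and Md: "M \<le> d / 2" and r: "d \<le> r" "r \<le> R" "1 \<le> w r"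
  shows "ln (r / d) \<le> G / 4 * (S - w r) + 3"
proof -
  have M0: "M < d" using Md d_pos by simp
  have e1: "\<epsilon> \<le> 1" using eps by simp
  have Gb: "2 * S \<le> G" "0 < G" using log_deriv_bounds(1)[OF eps(1) e1 S1] S1 by auto
  define \<phi> where "\<phi> = (\<lambda>r. w r + 2 / G * ln (r\<^sup>2 + 22 * d\<^sup>2))"
  have pos: "0 < x\<^sup>2 + 22 * d\<^sup>2" for x using d_pos by (simp add: add_nonneg_pos)
  have "\<phi> r \<le> \<phi> d"
  proof (rule nonincreasing_by_deriv[where \<phi> = \<phi>])
    show "continuous_on {d..r} \<phi>" unfolding \<phi>_def
      using cont_sub[of d r] M0 r pos by (intro continuous_intros) (auto simp: less_imp_neq[symmetric])
    fix x assume x: "d < x" "x < r"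
    have x0: "0 < x" using x d_pos by simp
    show "(\<phi> has_real_derivative - p x / x + 2 / G * (2 * x / (x\<^sup>2 + 22 * d\<^sup>2))) (at x)"
    proof -
      have "((\<lambda>r. ln (r\<^sup>2 + 22 * d\<^sup>2)) has_real_derivative 2 * x / (x\<^sup>2 + 22 * d\<^sup>2)) (at x)"
        using pos[of x] by (auto intro!: derivative_eq_intros simp: divide_inverse)
      from DERIV_add[OF w_deriv[of x] DERIV_cmult[OF this, of "2 / G"]]
      show ?thesis unfolding \<phi>_def using x r M0 by simp
    qed
    have "1 \<le> w x" using w_antimono[of x r] x r M0 by simp
    then have "4 / G * x\<^sup>2 / (x\<^sup>2 + 22 * d\<^sup>2) \<le> p x" using p_lower[OF S1 Md, of x] x r by simp
    then have "4 / G * x\<^sup>2 / (x\<^sup>2 + 22 * d\<^sup>2) / x \<le> p x / x"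
      using x0 by (intro divide_right_mono) auto
    moreover have "4 / G * x\<^sup>2 / (x\<^sup>2 + 22 * d\<^sup>2) / x = 2 / G * (2 * x / (x\<^sup>2 + 22 * d\<^sup>2))"
      using x0 by (simp add: power2_eq_square)
    ultimately show "- p x / x + 2 / G * (2 * x / (x\<^sup>2 + 22 * d\<^sup>2)) \<le> 0" by simp
  qed (use r in auto)
  moreover have "w d \<le> S" using w_le_S[of d] M0 d_less_R[OF S1] by simp
  ultimately have "2 / G * (ln (r\<^sup>2 + 22 * d\<^sup>2) - ln (d\<^sup>2 + 22 * d\<^sup>2)) \<le> S - w r"
    unfolding \<phi>_def by (simp add: algebra_simps)
  then have *: "ln (r\<^sup>2 + 22 * d\<^sup>2) - ln (d\<^sup>2 + 22 * d\<^sup>2) \<le> G / 2 * (S - w r)"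
    using Gb by (simp add: field_simps)
  have "ln (23 :: real) \<le> 6"
  proof -
    have "(23::real) \<le> 2 ^ 6" by simp
    also have "\<dots> \<le> exp 1 ^ 6" using exp_ge_add_one_self[of 1] by (intro power_mono) auto
    also have "\<dots> = exp 6" by (simp add: exp_of_nat_mult[symmetric])
    finally have "ln (23::real) \<le> ln (exp 6)" by (subst ln_le_cancel_iff) auto
    then show ?thesis by simp
  qed
  moreover have "ln (d\<^sup>2 + 22 * d\<^sup>2) = ln 23 + 2 * ln d"
    using d_pos ln_mult[of 23 "d\<^sup>2"] by (simp add: ln_realpow)
  moreover have "2 * ln r \<le> ln (r\<^sup>2 + 22 * d\<^sup>2)"
  proof -
    have "0 < r\<^sup>2" using r d_pos by simp
    then have "ln (r\<^sup>2) \<le> ln (r\<^sup>2 + 22 * d\<^sup>2)"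
      using pos[of r] by (subst ln_le_cancel_iff) auto
    then show ?thesis using r d_pos by (simp add: ln_realpow)
  qed
  moreover have "ln (r / d) = ln r - ln d" using r d_pos by (simp add: ln_div)
  moreover have "G / 4 * (S - w r) = G / 2 * (S - w r) / 2" by simp
  moreover have "d\<^sup>2 + 22 * d\<^sup>2 = 23 * d\<^sup>2" by simp
  ultimately show ?thesis using * by linarith
qed

text \<open>The comparison above stops at level one.  The radius where this level is reached is so large against
  \<open>d\<close> that the flux is then practically equal to its limit \<open>4 / G\<close>.\<close>
lemma unit_level:
  assumes "2 \<le> S" "M \<le> d"
  obtains r1 where "d < r1" "r1 < R" "w r1 = 1" "4 * S\<^sup>2 * d\<^sup>2 \<le> r1\<^sup>2"
proof -
  have dR: "d < R" using d_less_R assms by simp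
  have "1 / (8 * S) \<le> 1/16" using assms by (simp add: field_simps)
  then have wd: "1 < w d" using w_d_lower assms by linarith
  have "\<exists>x. d \<le> x \<and> x \<le> R \<and> w x = 1"
    using wd w_R dR cont_sub[of d R] assms by (intro IVT2') auto
  then obtain r1 where r1: "d \<le> r1" "r1 \<le> R" "w r1 = 1" by blast
  have "r1 \<noteq> d" "r1 \<noteq> R" using r1 wd w_R by auto
  then have "d < r1" "r1 < R" using r1 by auto
  moreover have "4 * S\<^sup>2 * d\<^sup>2 \<le> r1\<^sup>2"
  proof -
    have "4 * S\<^sup>2 \<le> 8 * S * (S - 1)" using assms by (simp add: power2_eq_square algebra_simps)
    then have "4 * S\<^sup>2 * d\<^sup>2 \<le> 8 * S * (S - 1) * d\<^sup>2" by (intro mult_right_mono) auto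
    then show ?thesis using value_imp_radius[of r1] r1 assms by simp
  qed
  ultimately show thesis using r1 that by blast
qed

text \<open>Below level one it suffices that \<open>p\<close> increases: from there on \<open>w\<close> decreases in \<open>ln r\<close> at least with the
  speed attained at level one.\<close>
lemma ln_R_upper:
  assumes S2: "2 \<le> S" and Md: "M \<le> d / 2"
  shows "ln (R / d) \<le> G * S / 4 + 7"
proof -
  have M0: "M < d" using Md d_pos by simp
  have e1: "\<epsilon> \<le> 1" using eps by simp
  have S1: "1 \<le> S" using S2 by simp
  have Gb: "2 * S \<le> G" "G \<le> 5 * S" "0 < G" using log_deriv_bounds[OF eps(1) e1 S1] S1 by auto
  obtain r1 where r1: "d < r1" "r1 < R" "w r1 = 1" "4 * S\<^sup>2 * d\<^sup>2 \<le> r1\<^sup>2"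
    using unit_level[of thesis] S2 M0 by auto
  have r10: "0 < r1" using r1 d_pos by simp
  have pr: "0 < p r1" using p_pos[of r1] r1 M0 by simp
  have "0 + p r1 * ln R \<le> w r1 + p r1 * ln r1"
  proof -
    have "w R + p r1 * ln R \<le> w r1 + p r1 * ln r1"
    proof (rule nonincreasing_by_deriv[where \<phi> = "\<lambda>x. w x + p r1 * ln x"])
      show "continuous_on {r1..R} (\<lambda>x. w x + p r1 * ln x)"
        using cont_sub[of r1 R] r1 M0 r10 by (intro continuous_intros) auto
      fix x assume x: "r1 < x" "x < R"
      show "((\<lambda>x. w x + p r1 * ln x) has_real_derivative - p x / x + p r1 * (1 / x)) (at x)"
        using x r1 M0 w_deriv[of x] r10 by (auto intro!: derivative_eq_intros)
      show "- p x / x + p r1 * (1 / x) \<le> 0"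
        using p_le[of r1 x] x r1 M0 r10 by (simp add: field_simps)
    qed (use r1 in auto)
    then show ?thesis using w_R by simp
  qed
  then have "p r1 * (ln R - ln r1) \<le> 1" using r1 by (simp add: algebra_simps)
  then have A: "ln R - ln r1 \<le> 1 / p r1" using pr by (simp add: field_simps)
  have "4 / G * r1\<^sup>2 / (r1\<^sup>2 + 22 * d\<^sup>2) \<le> p r1"
    using p_lower[OF S1 Md, of r1] r1 by simp
  then have "1 / p r1 \<le> 1 / (4 / G * r1\<^sup>2 / (r1\<^sup>2 + 22 * d\<^sup>2))"
    using pr Gb r10 by (intro divide_left_mono) (auto intro!: mult_pos_pos divide_pos_pos add_pos_nonneg)
  also have "\<dots> = G / 4 + G / 4 * (22 * d\<^sup>2 / r1\<^sup>2)"
    using Gb r10 by (simp add: field_simps)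
  also have "\<dots> \<le> G / 4 + 4"
  proof -
    have "22 * d\<^sup>2 / r1\<^sup>2 \<le> 22 / (4 * S\<^sup>2)"
      using r1 r10 S2 by (simp add: field_simps)
    then have "G / 4 * (22 * d\<^sup>2 / r1\<^sup>2) \<le> (5 * S / 4) * (22 / (4 * S\<^sup>2))"
      using Gb S2 by (intro mult_mono) auto
    also have "\<dots> = 110 / (16 * S)" using S2 by (simp add: power2_eq_square)
    also have "\<dots> \<le> 4" using S2 by (simp add: field_simps)
    finally show ?thesis by simp
  qed
  finally have B: "1 / p r1 \<le> G / 4 + 4" .
  have C: "ln (r1 / d) \<le> G / 4 * (S - 1) + 3"
    using ln_radius_upper[OF S1 Md, of r1] r1 by simp
  have "ln (R / d) = ln R - ln r1 + ln (r1 / d)"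
    using r10 d_pos R_pos by (simp add: ln_div)
  moreover have "G / 4 * (S - 1) = G * S / 4 - G / 4" by (simp add: field_simps)
  ultimately show ?thesis using A B C by linarith
qed

lemma ln_d: "ln d = - (ln (2 * lam) + 2 * ln S + hexp \<epsilon> S) / 2"
proof -
  have "2 * lam * S\<^sup>2 * exp (hexp \<epsilon> S) * d\<^sup>2 = 1"
    using d_eq f_nl_eq[of S] S_pos by (simp add: power2_eq_square algebra_simps)
  then have "ln (2 * lam * S\<^sup>2 * exp (hexp \<epsilon> S) * d\<^sup>2) = 0" by simp
  moreover have "ln (2 * lam * S\<^sup>2 * exp (hexp \<epsilon> S) * d\<^sup>2)
      = ln (2 * lam) + 2 * ln S + hexp \<epsilon> S + 2 * ln d"
    using lam_pos S_pos d_pos by (simp add: ln_mult_pos ln_realpow)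
  ultimately show ?thesis by simp
qed

lemma powr_Suc: "S powr (1 + \<epsilon>) = S * S powr \<epsilon>"
  using S_pos by (simp add: powr_add)

lemma powr_ge_1: "1 \<le> S \<Longrightarrow> 1 \<le> S powr \<epsilon>"
  using ge_one_powr_ge_zero eps by simp

text \<open>The quadratic parts of \<open>G S / 4\<close> and \<open>- ln d\<close> cancel; what remains is a negative multiple of
  \<open>S powr (1 + \<epsilon>)\<close>, of which only the bound by a multiple of \<open>S\<close> is kept.\<close>
lemma ln_R_upper2:
  assumes S2: "2 \<le> S" and Md: "M \<le> d / 2"
  shows "ln R \<le> 8 - ln (2 * lam) / 2 - S / 8"
proof -
  have "ln R = ln (R / d) + ln d" using R_pos d_pos by (simp add: ln_div)
  also have "\<dots> \<le> G * S / 4 + 7 - (ln (2 * lam) + 2 * ln S + hexp \<epsilon> S) / 2"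
    using ln_R_upper[OF assms] ln_d by linarith
  also have "G * S / 4 = 1 / 4 + S\<^sup>2 / 2 + (1 + \<epsilon>) * (S * S powr \<epsilon>) / 4"
    using S_pos by (simp add: log_deriv_def field_simps power2_eq_square)
  also have "(1 + \<epsilon>) * (S * S powr \<epsilon>) \<le> 3/2 * (S * S powr \<epsilon>)"
    using eps S_pos by (intro mult_right_mono) auto
  finally have "ln R \<le> 1/4 + S\<^sup>2 / 2 + 3/2 * (S * S powr \<epsilon>) / 4 + 7
      - (ln (2 * lam) + 2 * ln S + hexp \<epsilon> S) / 2" by simp
  moreover have "S * 1 \<le> S * S powr \<epsilon>" using powr_ge_1 S2 by (intro mult_left_mono) auto
  moreover have "0 \<le> ln S" using S2 by simp
  ultimately show ?thesis unfolding hexp_def powr_Suc by argo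
qed

section \<open>The flux at the zero\<close>

text \<open>The mirror image of \<open>logistic_lower\<close>: while \<open>w \<ge> c\<close> the slope of \<open>ln f\<close> is at least \<open>2 c\<close>, so the
  corresponding first integral does not increase.  Half of its initial value is the last term of the bound.\<close>
lemma p_upper:
  assumes r: "M < r" "r \<le> R" and c: "0 < c" "c \<le> w r"
  shows "p r \<le> 2 / c + M\<^sup>2 / (4 * S * d\<^sup>2)"
proof -
  have "Q (2 * c) r \<le> Q (2 * c) M"
  proof (rule nonincreasing_by_deriv[where \<phi> = "Q (2 * c)"])
    fix x assume x: "M < x" "x < r"
    show "(Q (2 * c) has_real_derivative x * f_nl lam \<epsilon> (w x) * p x * (2 * c - log_deriv \<epsilon> (w x))) (at x)"
      using Q_deriv x assms by simp
    have "c \<le> w x" using w_antimono[of x r] x assms by simp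
    moreover have "2 * w x \<le> log_deriv \<epsilon> (w x)"
      unfolding log_deriv_def using eps w_nonneg[of x] x r by simp
    ultimately have "2 * c - log_deriv \<epsilon> (w x) \<le> 0" by simp
    then show "x * f_nl lam \<epsilon> (w x) * p x * (2 * c - log_deriv \<epsilon> (w x)) \<le> 0"
      using x r p_pos[of x] M_nonneg f_nl_nonneg[OF lam_pos w_nonneg[of x], of \<epsilon>]
      by (intro mult_nonneg_nonpos mult_nonneg_nonneg) auto
  qed (use r Q_cont in auto)
  moreover have "Q (2 * c) M = M\<^sup>2 / (2 * S * d\<^sup>2)" (is "_ = ?q")
    unfolding Q_def using p_M w_M f_top by simp
  moreover have "0 \<le> r\<^sup>2 * f_nl lam \<epsilon> (w r)" using f_nl_nonneg[OF lam_pos w_nonneg[of r]] r by simp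
  ultimately have "c * (p r)\<^sup>2 - 2 * p r \<le> ?q" unfolding Q_def by simp
  then have *: "p r * (c * p r - 2) \<le> ?q" by (simp add: algebra_simps power2_eq_square)
  have q0: "0 \<le> ?q" using S_pos by simp
  show ?thesis
  proof (rule ccontr)
    assume "\<not> ?thesis"
    then have l: "2 / c + ?q / 2 < p r" by (simp add: field_simps)
    then have "2 / c < p r" using q0 by simp
    then have "2 < c * p r" using c by (simp add: field_simps)
    have "c * ?q / 2 < c * p r - 2" using l c by (simp add: field_simps)
    then have "p r * (c * ?q / 2) < p r * (c * p r - 2)"
      using p_pos[of r] r by (intro mult_strict_left_mono) auto
    moreover have "2 * ?q / 2 \<le> c * p r * ?q / 2"
      using \<open>2 < c * p r\<close> q0 by (intro divide_right_mono mult_right_mono) auto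
    ultimately show False using * by (simp add: algebra_simps)
  qed
qed

text \<open>Below the level \<open>\<theta> S\<close> the equation has practically no mass left.  Inserting the upper bound on
  \<open>ln r\<close> at a given level \<open>W \<ge> 1\<close>, one finds that \<open>2 ln r + hexp \<epsilon> W\<close> is at most \<open>- W (S - W)\<close> minus a
  fixed fraction of \<open>S powr \<epsilon> (S - W)\<close>, up to a constant; below level one the bound on \<open>R\<close> is enough.\<close>
lemma tail_exponent:
  assumes S2: "2 \<le> S" and Md: "M \<le> d / 2" and th: "0 < \<theta>" "\<theta> < 1"
    and r: "d \<le> r" "r \<le> R" "w r \<le> \<theta> * S"
  shows "2 * ln r + hexp \<epsilon> (w r) \<le> 18 - ln (2 * lam) - (1 - \<theta>) * S / 4"
proof (cases "1 \<le> w r")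
  case True
  have S1: "1 \<le> S" using S2 by simp
  have M0: "M < d" using Md d_pos by simp
  define W where "W = w r"
  define E where "E = S powr \<epsilon>"
  have W: "1 \<le> W" "W \<le> S" "W \<le> \<theta> * S" using True w_le_S[of r] r M0 by (auto simp: W_def)
  have E: "1 \<le> E" using powr_ge_1[OF S1] by (simp add: E_def)
  have "ln (r / d) \<le> G / 4 * (S - W) + 3"
    using ln_radius_upper[OF S1 Md, of r] r True by (simp add: W_def)
  then have "2 * ln r \<le> G / 2 * (S - W) + 6 + 2 * ln d"
    using r d_pos by (simp add: ln_div)
  then have *: "2 * ln r + hexp \<epsilon> W \<le> G / 2 * (S - W) + 6 - ln (2 * lam) - 2 * ln S - hexp \<epsilon> S + hexp \<epsilon> W"
    unfolding ln_d by argo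
  \<comment> \<open>The terms are compared according to their degree in \<open>S\<close>: (a) bounded, (b) quadratic,
      (c, e) of the order of the perturbation, which supplies the negative contribution.\<close>
  have G2: "G / 2 * (S - W) = (S - W) / (2 * S) + S * (S - W) + (1 + \<epsilon>) / 2 * (E * (S - W))"
    using S_pos by (simp add: log_deriv_def E_def field_simps)
  have a: "(S - W) / (2 * S) \<le> 1" using W S_pos by (simp add: field_simps)
  have b: "S * (S - W) - S\<^sup>2 + W\<^sup>2 \<le> 0"
  proof -
    have "S * (S - W) - S\<^sup>2 + W\<^sup>2 = - (W * (S - W))" by (simp add: power2_eq_square algebra_simps)
    also have "\<dots> \<le> 0" using W by simp
    finally show ?thesis .
  qed
  have c: "(1 + \<epsilon>) / 2 * (E * (S - W)) \<le> 3 / 4 * (E * (S - W))"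
    using eps E W by (intro mult_right_mono) auto
  have "W powr (1 + \<epsilon>) = W * W powr \<epsilon>" using W by (simp add: powr_add)
  also have "\<dots> \<le> W * E" unfolding E_def using W eps by (intro mult_left_mono powr_mono2) auto
  finally have e: "W powr (1 + \<epsilon>) \<le> W * E" .
  have g: "(1 - \<theta>) * S \<le> E * (S - W)"
  proof -
    have "1 * (S - W) \<le> E * (S - W)" using E W by (intro mult_right_mono) auto
    then show ?thesis using W by (simp add: algebra_simps)
  qed
  have ls: "0 \<le> ln S" using S1 by simp
  have "E * (S - W) = S * E - W * E" by (simp add: algebra_simps)
  then have "2 * ln r + hexp \<epsilon> W \<le> 7 - ln (2 * lam) - E * (S - W) / 4"
    using * G2 a b c e ls unfolding hexp_def powr_Suc E_def[symmetric] by linarith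
  then show ?thesis using g unfolding W_def by linarith
next
  case False
  have M0: "M < d" using Md d_pos by simp
  have w: "0 \<le> w r" "w r \<le> 1" using False w_nonneg[of r] r M0 by auto
  have "hexp \<epsilon> (w r) \<le> hexp \<epsilon> 1" using hexp_mono eps w by simp
  then have h: "hexp \<epsilon> (w r) \<le> 2" by (simp add: hexp_def)
  have "ln r \<le> ln R" using r d_pos by simp
  moreover have "0 \<le> \<theta> * S" using th S2 by simp
  moreover have "(1 - \<theta>) * S / 4 = S / 4 - \<theta> * S / 4" by (simp add: field_simps)
  ultimately show ?thesis using ln_R_upper2[OF S2 Md] h by linarith
qed

text \<open>Up to the level \<open>\<theta> S\<close> the flux is controlled by \<open>p_upper\<close>, and the mass beyond that level is
  exponentially small against the logarithmic length of the interval.\<close>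
lemma exit_slope:
  assumes S2: "2 \<le> S" and Md: "M \<le> d / 2" and th: "0 < \<theta>" "\<theta> < 1" and thS: "1 / (8 * S) \<le> (1 - \<theta>) * S"
  shows "p R \<le> 2 / (\<theta> * S) + M\<^sup>2 / (4 * S * d\<^sup>2)
    + lam * S * exp (18 - ln (2 * lam) - (1 - \<theta>) * S / 4) * (2 * S\<^sup>2 + 7)"
proof -
  have S1: "1 \<le> S" using S2 by simp
  have M0: "M < d" using Md d_pos by simp
  have dR: "d < R" using d_less_R S1 by simp
  have wd: "\<theta> * S \<le> w d" using w_d_lower[OF S1] M0 thS by (simp add: algebra_simps)
  have "\<exists>x. d \<le> x \<and> x \<le> R \<and> w x = \<theta> * S"
    using wd w_R dR cont_sub[of d R] M0 th S2 by (intro IVT2') auto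
  then obtain s where s: "d \<le> s" "s \<le> R" "w s = \<theta> * S" by blast
  let ?K = "lam * S * exp (18 - ln (2 * lam) - (1 - \<theta>) * S / 4)"
  have K0: "0 \<le> ?K" using lam_pos S2 by simp
  have s0: "0 < s" using s d_pos by simp
  have "p R - ?K * ln R \<le> p s - ?K * ln s"
  proof (rule nonincreasing_by_deriv[where \<phi> = "\<lambda>x. p x - ?K * ln x"])
    show "continuous_on {s..R} (\<lambda>x. p x - ?K * ln x)"
      using cont_sub[of s R] s M0 s0 by (intro continuous_intros) auto
    fix x assume x: "s < x" "x < R"
    have x0: "0 < x" using x s0 by simp
    show "((\<lambda>x. p x - ?K * ln x) has_real_derivative x * f_nl lam \<epsilon> (w x) - ?K * (1 / x)) (at x)"
      using p_deriv[of x] x s M0 x0 by (auto intro!: derivative_eq_intros)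
    have w: "w x \<le> \<theta> * S" using w_antimono[of s x] s x M0 by simp
    have "2 * ln x + hexp \<epsilon> (w x) \<le> 18 - ln (2 * lam) - (1 - \<theta>) * S / 4"
      using tail_exponent[OF S2 Md th, of x] w x s by simp
    then have "exp (2 * ln x + hexp \<epsilon> (w x)) \<le> exp (18 - ln (2 * lam) - (1 - \<theta>) * S / 4)" by simp
    moreover have "exp (2 * ln x) = x\<^sup>2" using x0 by (simp add: exp_double)
    ultimately have a: "x\<^sup>2 * exp (hexp \<epsilon> (w x)) \<le> exp (18 - ln (2 * lam) - (1 - \<theta>) * S / 4)"
      by (simp add: exp_add)
    have w0: "0 \<le> w x" using w_nonneg[of x] x s M0 by simp
    have "x * (x * f_nl lam \<epsilon> (w x)) = (lam * w x) * (x\<^sup>2 * exp (hexp \<epsilon> (w x)))"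
      using w0 by (simp add: f_nl_eq power2_eq_square)
    also have "\<dots> \<le> (lam * S) * exp (18 - ln (2 * lam) - (1 - \<theta>) * S / 4)"
      using a w_le_S[of x] x s M0 lam_pos w0 by (intro mult_mono) auto
    finally have "x * (x * f_nl lam \<epsilon> (w x)) \<le> ?K" .
    then show "x * f_nl lam \<epsilon> (w x) - ?K * (1 / x) \<le> 0" using x0 by (simp add: field_simps)
  qed (use s in auto)
  then have "p R \<le> p s + ?K * ln (R / s)" using s0 R_pos by (simp add: ln_div algebra_simps)
  moreover have "p s \<le> 2 / (\<theta> * S) + M\<^sup>2 / (4 * S * d\<^sup>2)"
    using p_upper[of s "\<theta> * S"] s M0 th S2 by simp
  moreover have "?K * ln (R / s) \<le> ?K * (2 * S\<^sup>2 + 7)"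
  proof (rule mult_left_mono[OF _ K0])
    have "ln (R / s) \<le> ln (R / d)" using s s0 R_pos d_pos by (simp add: ln_div)
    also have "\<dots> \<le> G * S / 4 + 7" using ln_R_upper[OF S2 Md] .
    also have "G * S \<le> 5 * S * S"
      using log_deriv_bounds(2)[OF eps(1) _ S1] eps S2 by (intro mult_right_mono) auto
    finally have "ln (R / s) \<le> 5 / 4 * S\<^sup>2 + 7" by (simp add: power2_eq_square)
    then show "ln (R / s) \<le> 2 * S\<^sup>2 + 7" using zero_le_power2[of S] by linarith
  qed
  ultimately show ?thesis by linarith
qed

lemma R_lower:
  assumes S1: "1 \<le> S" and Md: "M \<le> d"
  shows "S - 1 / (8 * S) \<le> p R * ln (R / d)"
proof -
  have dR: "d < R" using d_less_R S1 by simp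
  have "w d + p R * ln d \<le> w R + p R * ln R"
  proof (rule nondecreasing_by_deriv[where \<phi> = "\<lambda>x. w x + p R * ln x"])
    show "continuous_on {d..R} (\<lambda>x. w x + p R * ln x)"
      using cont_sub[of d R] Md d_pos by (intro continuous_intros) auto
    fix x assume x: "d < x" "x < R"
    have x0: "0 < x" using x d_pos by simp
    show "((\<lambda>x. w x + p R * ln x) has_real_derivative - p x / x + p R * (1 / x)) (at x)"
      using w_deriv[of x] x Md x0 by (auto intro!: derivative_eq_intros)
    show "0 \<le> - p x / x + p R * (1 / x)" using p_le[of x R] x Md x0 by (simp add: field_simps)
  qed (use dR in auto)
  then have "w d \<le> p R * ln (R / d)"
    using w_R R_pos d_pos by (simp add: ln_div algebra_simps)
  then show ?thesis using w_d_lower[OF S1 Md] by simp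
qed

end

section \<open>The ascending part of a nodal interval\<close>

text \<open>On \<open>[a, M]\<close> the function \<open>w\<close> rises from zero to its maximum and is concave in \<open>ln r\<close>.  The first claim is
  that it stays below its tangent at \<open>a\<close>.  For the second, concavity makes the slope at \<open>M / e\<close> at most
  \<open>w(M) / (ln (M / a) - 1)\<close>; therefore \<open>w\<close> is close to \<open>w(M)\<close> on \<open>[M / e, M]\<close>, and the loss of flux
  over that interval, which cannot exceed the slope at its left end, bounds \<open>M\<^sup>2 f(w)\<close>.\<close>
lemma entry_estimates:
  fixes w p :: "real \<Rightarrow> real"
  assumes lam: "0 < lam" and eps: "0 \<le> \<epsilon>" and aM: "0 < a" "a < M"
    and cont: "continuous_on {a..M} w" "continuous_on {a..M} p"
    and w': "\<And>r. a < r \<Longrightarrow> r < M \<Longrightarrow> (w has_real_derivative - p r / r) (at r)"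
    and p': "\<And>r. a < r \<Longrightarrow> r < M \<Longrightarrow> (p has_real_derivative r * f_nl lam \<epsilon> (w r)) (at r)"
    and w0: "w a = 0" "\<And>r. a < r \<Longrightarrow> r \<le> M \<Longrightarrow> 0 < w r" and pM: "p M = 0"
  shows "w M \<le> - p a * ln (M / a)"
    and "2 < ln (M / a) \<Longrightarrow>
      M\<^sup>2 * f_nl lam \<epsilon> (w M - w M / (ln (M / a) - 1)) \<le> 4 * w M / (ln (M / a) - 1)"
proof -
  have sub: "continuous_on {b..c} w" "continuous_on {b..c} p" if "a \<le> b" "c \<le> M" for b c
    using cont that by (auto elim: continuous_on_subset)
  have p_mono: "p r \<le> p s" if "a \<le> r" "r \<le> s" "s \<le> M" for r s
  proof (rule nondecreasing_by_deriv[where \<phi> = p])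
    fix x assume "r < x" "x < s"
    then show "(p has_real_derivative x * f_nl lam \<epsilon> (w x)) (at x)" "0 \<le> x * f_nl lam \<epsilon> (w x)"
      using p'[of x] that aM f_nl_pos[OF lam w0(2)[of x], of \<epsilon>] by auto
  qed (use that sub in auto)
  have p_nonpos: "p r \<le> 0" if "a \<le> r" "r \<le> M" for r
    using p_mono[of r M] that pM by simp
  have lnline: "((\<lambda>r. w r - c * ln r) has_real_derivative (- p x - c) / x) (at x)"
    if "a < x" "x < M" for c x
    using w'[OF that] that aM by (auto intro!: derivative_eq_intros simp: field_simps)
  have lncont: "continuous_on {b..e} (\<lambda>r. w r - c * ln r)" if "a \<le> b" "e \<le> M" for b c e
    using sub[OF that] that aM by (intro continuous_intros) auto
  have "w M - (- p a) * ln M \<le> w a - (- p a) * ln a"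
  proof (rule nonincreasing_by_deriv[where \<phi> = "\<lambda>r. w r - (- p a) * ln r"])
    show "continuous_on {a..M} (\<lambda>r. w r - (- p a) * ln r)" by (rule lncont) auto
    fix x assume x: "a < x" "x < M"
    show "((\<lambda>r. w r - (- p a) * ln r) has_real_derivative (- p x - (- p a)) / x) (at x)"
      by (rule lnline[OF x])
    show "(- p x - (- p a)) / x \<le> 0" using p_mono[of a x] x aM by (simp add: divide_nonpos_pos)
  qed (use aM in auto)
  then show "w M \<le> - p a * ln (M / a)" using w0(1) aM by (simp add: ln_div algebra_simps)
  assume L: "2 < ln (M / a)"
  define L where "L = ln (M / a)"
  have L2: "2 < L" and lnM: "ln M = ln a + L" using L aM by (auto simp: L_def ln_div)
  define r0 where "r0 = M * exp (-1)"
  have r0pos: "0 < r0" using aM by (simp add: r0_def)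
  have lnr0: "ln r0 = ln M - 1" using aM by (simp add: r0_def ln_mult_pos)
  have "ln a < ln r0" using L2 lnM lnr0 by linarith
  then have ar0: "a < r0" using aM r0pos by simp
  have r0M: "r0 < M" unfolding r0_def using aM by simp
  define s0 where "s0 = - p r0"
  have s00: "0 \<le> s0" using p_nonpos[of r0] ar0 r0M by (simp add: s0_def)
  have wr0: "w r0 \<le> w M"
  proof (rule nondecreasing_by_deriv[where \<phi> = w])
    fix x assume x: "r0 < x" "x < M"
    show "(w has_real_derivative - p x / x) (at x)" using w'[of x] x ar0 by simp
    show "0 \<le> - p x / x" using p_nonpos[of x] x ar0 aM by (simp add: divide_nonpos_pos)
  qed (use r0M ar0 sub in auto)
  have "w a - s0 * ln a \<le> w r0 - s0 * ln r0"
  proof (rule nondecreasing_by_deriv[where \<phi> = "\<lambda>r. w r - s0 * ln r"])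
    fix x assume x: "a < x" "x < r0"
    show "((\<lambda>r. w r - s0 * ln r) has_real_derivative (- p x - s0) / x) (at x)"
      using lnline x r0M by simp
    show "0 \<le> (- p x - s0) / x" using p_mono[of x r0] x aM r0M by (simp add: s0_def)
  qed (use ar0 r0M lncont in auto)
  then have "s0 * (ln r0 - ln a) \<le> w M" using w0(1) wr0 by (simp add: algebra_simps)
  then have s0_le: "s0 \<le> w M / (L - 1)" using lnM lnr0 L2 by (simp add: field_simps)
  define c where "c = w M - w M / (L - 1)"
  have wM: "0 < w M" using w0(2)[of M] aM by simp
  have c0: "0 \<le> c" using wM L2 by (simp add: c_def field_simps)
  have wc: "c \<le> w r" if r: "r0 \<le> r" "r \<le> M" for r
  proof -
    have "w M - s0 * ln M \<le> w r - s0 * ln r"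
    proof (rule nonincreasing_by_deriv[where \<phi> = "\<lambda>r. w r - s0 * ln r"])
      fix x assume x: "r < x" "x < M"
      show "((\<lambda>r. w r - s0 * ln r) has_real_derivative (- p x - s0) / x) (at x)"
        using lnline x r ar0 by simp
      show "(- p x - s0) / x \<le> 0" using p_mono[of r0 x] x aM ar0 r by (simp add: s0_def divide_nonpos_pos)
    qed (use r ar0 lncont in auto)
    moreover have "ln r0 \<le> ln r" using r r0pos by simp
    then have "s0 * (ln M - ln r) \<le> s0 * 1" using s00 lnr0 by (intro mult_left_mono) auto
    ultimately show ?thesis using s0_le by (simp add: c_def algebra_simps)
  qed
  have "p r0 - f_nl lam \<epsilon> c * r0\<^sup>2 / 2 \<le> p M - f_nl lam \<epsilon> c * M\<^sup>2 / 2"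
  proof (rule nondecreasing_by_deriv[where \<phi> = "\<lambda>r. p r - f_nl lam \<epsilon> c * r\<^sup>2 / 2"])
    show "continuous_on {r0..M} (\<lambda>r. p r - f_nl lam \<epsilon> c * r\<^sup>2 / 2)"
      using sub[of r0 M] ar0 by (intro continuous_intros) auto
    fix x assume x: "r0 < x" "x < M"
    show "((\<lambda>r. p r - f_nl lam \<epsilon> c * r\<^sup>2 / 2) has_real_derivative
        x * f_nl lam \<epsilon> (w x) - f_nl lam \<epsilon> c * x) (at x)"
      using p'[of x] x ar0 by (auto intro!: derivative_eq_intros)
    show "0 \<le> x * f_nl lam \<epsilon> (w x) - f_nl lam \<epsilon> c * x"
      using f_nl_mono[OF lam eps c0 wc[of x]] x r0pos by (simp add: mult.commute mult_right_mono)
  qed (use r0M in auto)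
  then have "f_nl lam \<epsilon> c * (M\<^sup>2 - r0\<^sup>2) / 2 \<le> s0" using pM by (simp add: s0_def algebra_simps)
  moreover have "M\<^sup>2 / 2 \<le> M\<^sup>2 - r0\<^sup>2"
  proof -
    have "2 \<le> exp (1::real)" using exp_ge_add_one_self[of 1] by simp
    then have "exp (-1) \<le> (1/2 :: real)" by (simp add: exp_minus field_simps)
    then have "(exp (-1))\<^sup>2 \<le> (1/2 :: real)\<^sup>2" by (intro power_mono) auto
    then have "M\<^sup>2 * (exp (-1))\<^sup>2 \<le> M\<^sup>2 * (1/2)" by (intro mult_left_mono) (auto simp: power2_eq_square)
    then show ?thesis by (simp add: r0_def power_mult_distrib)
  qed
  then have "f_nl lam \<epsilon> c * (M\<^sup>2 / 2) / 2 \<le> f_nl lam \<epsilon> c * (M\<^sup>2 - r0\<^sup>2) / 2"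
    using f_nl_nonneg[OF lam c0, of \<epsilon>] by (intro divide_right_mono mult_left_mono) auto
  ultimately have "f_nl lam \<epsilon> c * M\<^sup>2 / 4 \<le> w M / (L - 1)" using s0_le by linarith
  then show "M\<^sup>2 * f_nl lam \<epsilon> (w M - w M / (ln (M / a) - 1)) \<le> 4 * w M / (ln (M / a) - 1)"
    by (simp add: c_def L_def mult.commute)
qed

text \<open>Since \<open>f(s) \<ge> lam s\<close>, the height drops out of the previous estimate.\<close>
lemma entry_max_point_small:
  fixes w p :: "real \<Rightarrow> real"
  assumes lam: "0 < lam" and eps: "0 \<le> \<epsilon>" and aM: "0 < a" "a < M"
    and cont: "continuous_on {a..M} w" "continuous_on {a..M} p"
    and w': "\<And>r. a < r \<Longrightarrow> r < M \<Longrightarrow> (w has_real_derivative - p r / r) (at r)"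
    and p': "\<And>r. a < r \<Longrightarrow> r < M \<Longrightarrow> (p has_real_derivative r * f_nl lam \<epsilon> (w r)) (at r)"
    and w0: "w a = 0" "\<And>r. a < r \<Longrightarrow> r \<le> M \<Longrightarrow> 0 < w r" and pM: "p M = 0"
    and L: "3 \<le> ln (M / a)"
  shows "M\<^sup>2 \<le> 8 / (lam * (ln (M / a) - 1))"
proof -
  define L where "L = ln (M / a)"
  have L3: "3 \<le> L" using L by (simp add: L_def)
  have wM: "0 < w M" using w0(2)[of M] aM by simp
  have c: "w M / 2 \<le> w M - w M / (L - 1)" using wM L3 by (simp add: field_simps)
  have "lam * (w M / 2) \<le> f_nl lam \<epsilon> (w M - w M / (L - 1))"
  proof -
    have "lam * (w M / 2) \<le> lam * (w M - w M / (L - 1))" using c lam by simp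
    also have "\<dots> \<le> f_nl lam \<epsilon> (w M - w M / (L - 1))"
      by (rule f_nl_ge_linear[OF lam]) (use c wM in linarith)
    finally show ?thesis .
  qed
  then have "M\<^sup>2 * (lam * (w M / 2)) \<le> M\<^sup>2 * f_nl lam \<epsilon> (w M - w M / (L - 1))"
    by (intro mult_left_mono) auto
  also have "\<dots> \<le> 4 * w M / (L - 1)"
    using entry_estimates(2)[OF lam eps aM cont w' p' w0 pM] L3 unfolding L_def by simp
  finally have "w M * (M\<^sup>2 * lam) \<le> w M * (8 / (L - 1))" by (simp add: field_simps)
  then have "M\<^sup>2 * lam \<le> 8 / (L - 1)" using wM by (simp only: mult_le_cancel_left_pos)
  then show ?thesis using lam L3 unfolding L_def[symmetric] by (simp add: field_simps)
qed

text \<open>With incoming flux \<open>b = - p(a)\<close>, the first estimate gives \<open>S\<^sup>2 \<le> \<kappa> ln (M / a)\<close>.  So the ascent is long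
  compared with \<open>S\<^sup>2\<close>, the variation of \<open>w\<close> on \<open>[M / e, M]\<close> is below \<open>1 / (8 S)\<close>, and there the
  nonlinearity is comparable with \<open>f(S) = 1 / (2 S d\<^sup>2)\<close>.\<close>
lemma entry_max_point_vs_scale:
  fixes w p :: "real \<Rightarrow> real"
  assumes lam: "0 < lam" and eps: "0 \<le> \<epsilon>" "\<epsilon> \<le> 1" and aM: "0 < a" "a < M" "M \<le> 1"
    and cont: "continuous_on {a..M} w" "continuous_on {a..M} p"
    and w': "\<And>r. a < r \<Longrightarrow> r < M \<Longrightarrow> (w has_real_derivative - p r / r) (at r)"
    and p': "\<And>r. a < r \<Longrightarrow> r < M \<Longrightarrow> (p has_real_derivative r * f_nl lam \<epsilon> (w r)) (at r)"
    and w0: "w a = 0" "\<And>r. a < r \<Longrightarrow> r \<le> M \<Longrightarrow> 0 < w r" and pM: "p M = 0"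
    and S1: "1 \<le> w M" and k: "(p a)\<^sup>2 * ln (1 / a) \<le> \<kappa>" "\<kappa> \<le> 1/32"
    and d: "2 * w M * f_nl lam \<epsilon> (w M) * d\<^sup>2 = 1"
  shows "M\<^sup>2 \<le> 32 * \<kappa> * d\<^sup>2"
proof -
  define L where "L = ln (M / a)"
  define S where "S = w M"
  define b where "b = - p a"
  have SbL: "S \<le> b * L" using entry_estimates(1)[OF lam eps(1) aM(1,2) cont w' p' w0 pM]
    by (simp add: S_def b_def L_def)
  have S1': "1 \<le> S" using S1 by (simp add: S_def)
  have L0: "0 < L" using aM by (simp add: L_def)
  have LT: "L \<le> ln (1 / a)" using aM by (simp add: L_def ln_div)
  have b0: "0 < b" using SbL S1' L0 by (smt (verit) mult_nonpos_nonneg)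
  have "S * b \<le> b * L * b" using SbL b0 by (intro mult_right_mono) auto
  also have "\<dots> \<le> b\<^sup>2 * ln (1 / a)" using LT b0 by (simp add: power2_eq_square)
  also have "\<dots> \<le> \<kappa>" using k by (simp add: b_def)
  finally have Sb: "S * b \<le> \<kappa>" .
  have k0: "0 < \<kappa>" using Sb S1' b0 by (smt (verit) mult_pos_pos)
  have "S * S \<le> S * b * L" using SbL S1' mult_left_mono[OF SbL, of S] by (simp add: mult.assoc)
  also have "\<dots> \<le> \<kappa> * L" using Sb L0 by (intro mult_right_mono) auto
  finally have SL: "S * S \<le> \<kappa> * L" .
  have SS: "1 \<le> S * S" using S1' mult_mono[of 1 S 1 S] by simp
  have L1: "S * S / (2 * \<kappa>) \<le> L - 1"
  proof -
    have "1 \<le> S * S / (2 * \<kappa>)" using SS k k0 by (simp add: field_simps)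
    moreover have "S * S / (2 * \<kappa>) + S * S / (2 * \<kappa>) \<le> L" using SL k0 by (simp add: field_simps)
    ultimately show ?thesis by simp
  qed
  have "16 * (S * S) \<le> S * S / (2 * \<kappa>)"
  proof -
    have "16 * (S * S) * (2 * \<kappa>) \<le> 16 * (S * S) * (2 * (1/32))"
      using k SS by (intro mult_left_mono) auto
    then show ?thesis using k0 by (simp add: field_simps)
  qed
  then have L16: "16 * (S * S) \<le> L - 1" using L1 by simp
  then have L2: "2 < L" using SS by simp
  have near: "S - 1 / (8 * S) \<le> S - S / (L - 1)"
  proof -
    have "S / (L - 1) \<le> S / (16 * (S * S))" using L16 S1' L2 by (intro divide_left_mono) auto
    also have "\<dots> \<le> 1 / (8 * S)" using S1' by (simp add: field_simps)
    finally show ?thesis by simp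
  qed
  have "f_nl lam \<epsilon> S / 2 \<le> f_nl lam \<epsilon> (S - S / (L - 1))"
    using near S1' L2 by (intro f_nl_near_top lam eps) auto
  then have "M\<^sup>2 * (f_nl lam \<epsilon> S / 2) \<le> M\<^sup>2 * f_nl lam \<epsilon> (S - S / (L - 1))"
    by (intro mult_left_mono) auto
  also have "\<dots> \<le> 4 * S / (L - 1)"
    using entry_estimates(2)[OF lam eps(1) aM(1,2) cont w' p' w0 pM] L2 unfolding L_def S_def by simp
  also have "\<dots> \<le> 4 * S / (S * S / (2 * \<kappa>))"
    using L1 S1' L2 k0 SS by (intro divide_left_mono) auto
  also have "\<dots> = 8 * \<kappa> / S" using S1' k0 by (simp add: field_simps)
  finally have "M\<^sup>2 * f_nl lam \<epsilon> S \<le> 16 * \<kappa> / S" by simp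
  then have "M\<^sup>2 * f_nl lam \<epsilon> S * (2 * S * d\<^sup>2) \<le> 16 * \<kappa> / S * (2 * S * d\<^sup>2)"
    using S1' by (intro mult_right_mono) auto
  moreover have "M\<^sup>2 * f_nl lam \<epsilon> S * (2 * S * d\<^sup>2) = M\<^sup>2 * (2 * S * f_nl lam \<epsilon> S * d\<^sup>2)" by simp
  moreover have "M\<^sup>2 * (2 * S * f_nl lam \<epsilon> S * d\<^sup>2) = M\<^sup>2" using d by (simp add: S_def)
  moreover have "16 * \<kappa> / S * (2 * S * d\<^sup>2) = 32 * \<kappa> * d\<^sup>2" using S1' by simp
  ultimately show ?thesis by linarith
qed

section \<open>Exit from a high bump\<close>

text \<open>Both conclusions are what the next nodal interval needs: its left end is small, and its incoming flux
  is small against the inverse square root of the logarithmic distance to the boundary.\<close>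
lemma bump_exit:
  assumes lam: "0 < lam" and \<eta>: "0 < \<eta>"
  obtains S0 \<mu> where "0 < \<mu>"
    "\<And>\<epsilon> M R S d w p. bump lam \<epsilon> M R S d w p \<Longrightarrow> S0 \<le> S \<Longrightarrow> M\<^sup>2 \<le> \<mu> * d\<^sup>2 \<Longrightarrow>
      R \<le> \<eta> \<and> (p R)\<^sup>2 * ln (1 / R) \<le> \<eta>"
proof -
  \<comment> \<open>The bound will be \<open>p(R) \<le> (2 + \<kappa>) / S\<close>; a defect \<open>\<kappa>\<close> contributes at most \<open>9 \<kappa> / 4\<close> to the limit of
    the second quantity.  The level \<open>\<theta> S\<close> is chosen such that \<open>2 / \<theta>\<close> uses up half of \<open>\<kappa>\<close>.\<close>
  define \<kappa> where "\<kappa> = min 1 (\<eta> / 9)"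
  have \<kappa>: "0 < \<kappa>" "\<kappa> \<le> 1" "9 * \<kappa> \<le> \<eta>" using \<eta> by (auto simp: \<kappa>_def)
  define \<theta> where "\<theta> = 1 / (1 + \<kappa> / 4)"
  have \<theta>: "0 < \<theta>" "\<theta> < 1" "2 / \<theta> = 2 + \<kappa> / 2" using \<kappa> by (auto simp: \<theta>_def field_simps)
  define c where "c = (1 - \<theta>) / 4"
  have c: "0 < c" using \<theta> by (simp add: c_def)
  define l where "l = ln (2 * lam)"
  define E where "E = (\<lambda>S::real. lam * S\<^sup>2 * exp (18 - l - c * S) * (2 * S\<^sup>2 + 7))"
  \<comment> \<open>An upper bound for \<open>p(R)\<^sup>2 ln (1 / R)\<close>: the bracket combines the formula for \<open>ln d\<close> with the time
    that \<open>w\<close> needs to fall to zero at speed at most \<open>(2 + \<kappa>) / S\<close>.\<close>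
  define U where "U = (\<lambda>S::real. 9 / S\<^sup>2 * ((l + 2 * ln S + S\<^sup>2 + S powr (3/2)) / 2
      - (S - 1 / (8 * S)) * S / (2 + \<kappa>)))"
  have "((\<lambda>S::real. S\<^sup>2 * exp (- (c * S)) * (2 * S\<^sup>2 + 7)) \<longlongrightarrow> 0) at_top" using c by real_asymp
  then have "((\<lambda>S::real. lam * exp (18 - l) * (S\<^sup>2 * exp (- (c * S)) * (2 * S\<^sup>2 + 7))) \<longlongrightarrow>
      lam * exp (18 - l) * 0) at_top" by (intro tendsto_intros)
  moreover have "exp (18 - l - c * S) = exp (18 - l) * exp (- (c * S))" for S
    by (simp flip: exp_add)
  ultimately have "(E \<longlongrightarrow> 0) at_top" unfolding E_def by (simp add: ac_simps)
  then have E: "eventually (\<lambda>S. E S < \<kappa> / 4) at_top" using \<kappa> by (intro order_tendstoD) auto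
  have "((\<lambda>S::real. 9 / S\<^sup>2 * ((l + 2 * ln S + S\<^sup>2 + S powr (3/2)) / 2)) \<longlongrightarrow> 9 / 2) at_top"
    by real_asymp
  moreover have "((\<lambda>S::real. 9 / S\<^sup>2 * ((S - 1 / (8 * S)) * S)) \<longlongrightarrow> 9) at_top"
    by real_asymp
  ultimately have "((\<lambda>S::real. 9 / S\<^sup>2 * ((l + 2 * ln S + S\<^sup>2 + S powr (3/2)) / 2)
      - 9 / S\<^sup>2 * ((S - 1 / (8 * S)) * S) * (1 / (2 + \<kappa>))) \<longlongrightarrow> 9 / 2 - 9 * (1 / (2 + \<kappa>))) at_top"
    by (intro tendsto_intros)
  then have "(U \<longlongrightarrow> 9 * (1/2 - 1 / (2 + \<kappa>))) at_top"
    unfolding U_def by (simp add: right_diff_distrib)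
  moreover have "9 * (1/2 - 1 / (2 + \<kappa>)) < \<eta>"
  proof -
    have "9 * (1/2 - 1 / (2 + \<kappa>)) = 9 * \<kappa> / (2 * (2 + \<kappa>))" using \<kappa> by (simp add: field_simps)
    also have "\<dots> \<le> 9 * \<kappa> / 4" using \<kappa> by (intro divide_left_mono) auto
    finally show ?thesis using \<kappa> \<eta> by simp
  qed
  ultimately have U: "eventually (\<lambda>S. U S < \<eta>) at_top" by (rule order_tendstoD(2))
  have T: "eventually (\<lambda>S::real. 1 / (8 * S) \<le> (1 - \<theta>) * S) at_top"
    using eventually_ge_at_top[of "1 / (8 * (1 - \<theta>))"] eventually_ge_at_top[of 1]
  proof eventually_elim
    case (elim S)
    have "1 / (8 * S) \<le> 1 / 8" using elim by simp
    also have "\<dots> \<le> (1 - \<theta>) * S" using elim \<theta> by (simp add: field_simps)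
    finally show ?case .
  qed
  have V: "eventually (\<lambda>S::real. 8 - l / 2 - S / 8 \<le> ln \<eta>) at_top"
    using eventually_ge_at_top[of "8 * (8 - l / 2 - ln \<eta>)"] by eventually_elim (simp add: field_simps)
  obtain S0 where S0: "\<And>S. S0 \<le> S \<Longrightarrow> E S < \<kappa> / 4 \<and> U S < \<eta> \<and> 1 / (8 * S) \<le> (1 - \<theta>) * S
      \<and> 8 - l / 2 - S / 8 \<le> ln \<eta> \<and> 2 \<le> S"
    using eventually_conj[OF E eventually_conj[OF U eventually_conj[OF T
      eventually_conj[OF V eventually_ge_at_top[of 2]]]]] unfolding eventually_at_top_linorder by auto
  have main: "R \<le> \<eta> \<and> (p R)\<^sup>2 * ln (1 / R) \<le> \<eta>"
    if b: "bump lam \<epsilon> M R S d w p" and S: "S0 \<le> S" and M: "M\<^sup>2 \<le> \<kappa> / 4 * d\<^sup>2"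
    for \<epsilon> M R S d w p
  proof -
    interpret bump lam \<epsilon> M R S d w p by (rule b)
    have S2: "2 \<le> S" and S1: "1 \<le> S" using S0[OF S] by auto
    have "\<kappa> / 4 * d\<^sup>2 \<le> 1 / 4 * d\<^sup>2" by (rule mult_right_mono) (use \<kappa> in auto)
    then have "M\<^sup>2 \<le> 1 / 4 * d\<^sup>2" using M by linarith
    then have "M\<^sup>2 \<le> (d / 2)\<^sup>2" by (simp add: power2_eq_square)
    then have Md: "M \<le> d / 2" by (rule power2_le_imp_le) (use d_pos in simp)
    then have Md1: "M \<le> d" using d_pos by simp
    have "ln R \<le> 8 - l / 2 - S / 8" using ln_R_upper2[OF S2 Md] unfolding l_def .
    also have "\<dots> \<le> ln \<eta>" using S0[OF S] by blast
    finally have "ln R \<le> ln \<eta>" .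
    then have R: "R \<le> \<eta>" using R_pos \<eta> by simp
    have dR: "d < R" using d_less_R S1 by simp
    have pR0: "0 < p R" using p_pos[of R] MR by simp
    have "p R \<le> 2 / (\<theta> * S) + M\<^sup>2 / (4 * S * d\<^sup>2) + E S / S"
    proof -
      have "E S / S = lam * S * exp (18 - l - (1 - \<theta>) * S / 4) * (2 * S\<^sup>2 + 7)"
        using S2 by (simp add: E_def c_def power2_eq_square)
      then show ?thesis using exit_slope[OF S2 Md \<theta>(1,2)] S0[OF S] by (simp add: l_def)
    qed
    moreover have "2 / (\<theta> * S) = (2 + \<kappa> / 2) / S" using \<theta>(3) by (simp add: divide_divide_eq_left[symmetric])
    moreover have "M\<^sup>2 / (4 * S * d\<^sup>2) \<le> (\<kappa> / 4) / S"
    proof -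
      have "M\<^sup>2 / (4 * S * d\<^sup>2) \<le> (\<kappa> / 4 * d\<^sup>2) / (4 * S * d\<^sup>2)" using M S2 by (intro divide_right_mono) auto
      also have "\<dots> = \<kappa> / 16 / S" using d_pos by simp
      also have "\<dots> \<le> \<kappa> / 4 / S" using \<kappa> S2 by (intro divide_right_mono) auto
      finally show ?thesis .
    qed
    moreover have "E S / S \<le> (\<kappa> / 4) / S" using S0[OF S] S2 by (intro divide_right_mono) auto
    moreover have "(2 + \<kappa> / 2) / S + (\<kappa> / 4) / S + (\<kappa> / 4) / S = (2 + \<kappa>) / S"
      unfolding add_divide_distrib[symmetric] by simp
    ultimately have pR: "p R \<le> (2 + \<kappa>) / S" by argo
    have lnRd: "(S - 1 / (8 * S)) * S / (2 + \<kappa>) \<le> ln (R / d)"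
    proof -
      have "0 \<le> ln (R / d)" using dR d_pos by simp
      then have "p R * ln (R / d) \<le> (2 + \<kappa>) / S * ln (R / d)" using pR by (intro mult_right_mono)
      then have "S - 1 / (8 * S) \<le> (2 + \<kappa>) / S * ln (R / d)" using R_lower[OF S1 Md1] by simp
      then have "(S - 1 / (8 * S)) * S \<le> (2 + \<kappa>) / S * ln (R / d) * S"
        using S2 by (intro mult_right_mono) auto
      also have "\<dots> = ln (R / d) * (2 + \<kappa>)" using S2 by simp
      finally show ?thesis using \<kappa> by (subst pos_divide_le_eq) auto
    qed
    let ?I = "(l + 2 * ln S + S\<^sup>2 + S powr (3/2)) / 2 - (S - 1 / (8 * S)) * S / (2 + \<kappa>)"
    have "S powr (1 + \<epsilon>) \<le> S powr (3/2)" using eps S2 by (intro powr_mono) auto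
    then have lnR: "ln (1 / R) \<le> ?I"
    proof -
      have "ln (1 / R) = - ln (R / d) - ln d" using R_pos d_pos by (simp add: ln_div)
      also have "\<dots> = - ln (R / d) + (l + 2 * ln S + S\<^sup>2 + S powr (1 + \<epsilon>)) / 2"
        unfolding ln_d l_def hexp_def by (simp add: field_simps)
      finally show ?thesis using lnRd \<open>S powr (1 + \<epsilon>) \<le> S powr (3/2)\<close> by argo
    qed
    have pR2: "(p R)\<^sup>2 \<le> 9 / S\<^sup>2"
    proof -
      have "(p R)\<^sup>2 \<le> ((2 + \<kappa>) / S)\<^sup>2" using pR pR0 by (intro power_mono) auto
      also have "\<dots> \<le> (3 / S)\<^sup>2" using \<kappa> S2 by (intro power_mono divide_right_mono) auto
      also have "\<dots> = 9 / S\<^sup>2" by (simp add: power_divide)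
      finally show ?thesis .
    qed
    have "(p R)\<^sup>2 * ln (1 / R) \<le> \<eta>"
    proof (cases "0 \<le> ln (1 / R)")
      case True
      have "(p R)\<^sup>2 * ln (1 / R) \<le> 9 / S\<^sup>2 * ?I" using lnR pR2 True by (intro mult_mono) auto
      also have "\<dots> = U S" by (simp add: U_def)
      finally show ?thesis using S0[OF S] by linarith
    next
      case False
      then have l0: "ln (1 / R) \<le> 0" by linarith
      have "(p R)\<^sup>2 * ln (1 / R) \<le> 0" by (rule mult_nonneg_nonpos[OF zero_le_power2 l0])
      then show ?thesis using \<eta> by linarith
    qed
    then show "R \<le> \<eta> \<and> (p R)\<^sup>2 * ln (1 / R) \<le> \<eta>" using R by (intro conjI)
  qed
  have "0 < \<kappa> / 4" using \<kappa> by simp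
  then show thesis using main by (rule that)
qed

section \<open>Convergence to the Liouville bubble\<close>

text \<open>The radial solution of \<open>- \<Delta> v = exp v\<close> with \<open>v(0) = 0\<close>.\<close>
definition bubble :: "real \<Rightarrow> real" where
  "bubble x = ln (1 / (1 + x\<^sup>2 / 8)\<^sup>2)"

definition bubble' :: "real \<Rightarrow> real" where
  "bubble' x = - 4 * x / (8 + x\<^sup>2)"

lemma bubble_eq: "bubble x = - 2 * ln (1 + x\<^sup>2 / 8)"
proof -
  have "0 < 1 + x\<^sup>2 / 8" by (simp add: add_pos_nonneg)
  then show ?thesis by (simp add: bubble_def ln_div ln_realpow)
qed

lemma exp_bubble: "exp (bubble x) = 64 / (8 + x\<^sup>2)\<^sup>2"
proof -
  have "0 < 1 + x\<^sup>2 / 8" by (simp add: add_pos_nonneg)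
  then have "exp (bubble x) = 1 / (1 + x\<^sup>2 / 8)\<^sup>2" by (simp add: bubble_def)
  also have "1 + x\<^sup>2 / 8 = (8 + x\<^sup>2) / 8" by simp
  finally show ?thesis by (simp add: power_divide)
qed

lemma bubble_nonpos: "bubble x \<le> 0"
  unfolding bubble_eq by simp

lemma bubble_lower: "- x\<^sup>2 / 4 \<le> bubble x"
proof -
  have "ln (1 + x\<^sup>2 / 8) \<le> x\<^sup>2 / 8" by (rule ln_add_one_self_le_self) simp
  then show ?thesis unfolding bubble_eq by linarith
qed

lemma bubble_deriv: "(bubble has_real_derivative bubble' x) (at x)"
proof -
  have p: "0 < 1 + x\<^sup>2 / 8" by (simp add: add_pos_nonneg)
  have m: "((\<lambda>x. 1 + x\<^sup>2 / 8) has_real_derivative x / 4) (at x)"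
    by (auto intro!: derivative_eq_intros)
  have eq: "- 2 * (1 / (1 + x\<^sup>2 / 8) * (x / 4)) = bubble' x"
  proof -
    have e: "1 + x\<^sup>2 / 8 = (8 + x\<^sup>2) / 8" by simp
    have "- 2 * (1 / (q / 8) * (x / 4)) = - 4 * x / q" if "0 < q" for q :: real
      using that by simp
    from this[of "8 + x\<^sup>2"] show ?thesis unfolding e bubble'_def by (simp add: add_pos_nonneg)
  qed
  have f: "bubble = (\<lambda>x. - 2 * ln (1 + x\<^sup>2 / 8))" by (rule ext) (rule bubble_eq)
  show ?thesis unfolding f
    using DERIV_cmult[OF DERIV_chain2[OF DERIV_ln_divide[OF p] m], of "- 2"] eq
    by (simp only: )
qed

text \<open>The bubble satisfies the same first order system as \<open>w\<close>: the flux \<open>- x bubble'(x)\<close> has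
  derivative \<open>x exp (bubble x)\<close>.\<close>
lemma flux_deriv: "((\<lambda>x. 4 * x\<^sup>2 / (8 + x\<^sup>2)) has_real_derivative x * exp (bubble x)) (at x)"
proof -
  have "0 < 8 + x\<^sup>2" by (simp add: add_pos_nonneg)
  then have p: "8 + x\<^sup>2 \<noteq> 0" by linarith
  have n: "((\<lambda>x. 4 * x\<^sup>2) has_real_derivative 8 * x) (at x)"
    and m: "((\<lambda>x. 8 + x\<^sup>2) has_real_derivative 2 * x) (at x)"
    by (auto intro!: derivative_eq_intros)
  have "((\<lambda>x. 4 * x\<^sup>2 / (8 + x\<^sup>2)) has_real_derivative
      (8 * x * (8 + x\<^sup>2) - 4 * x\<^sup>2 * (2 * x)) / (8 + x\<^sup>2)\<^sup>2) (at x)"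
    using DERIV_divide[OF n m p] by (simp only: power2_eq_square)
  moreover have "8 * x * (8 + x\<^sup>2) - 4 * x\<^sup>2 * (2 * x) = x * 64" by algebra
  then have "(8 * x * (8 + x\<^sup>2) - 4 * x\<^sup>2 * (2 * x)) / (8 + x\<^sup>2)\<^sup>2 = x * exp (bubble x)"
    unfolding exp_bubble by simp
  ultimately show ?thesis by (rule DERIV_cong)
qed

lemma abs_exp_minus_one_le: "\<bar>exp x - 1\<bar> \<le> exp \<bar>x\<bar> - (1::real)"
proof (cases "0 \<le> x")
  case False
  have "1 - exp x \<le> - x" using exp_ge_add_one_self[of x] by linarith
  also have "\<dots> \<le> exp \<bar>x\<bar> - 1" using exp_ge_add_one_self[of "- x"] False by simp
  finally show ?thesis using False by simp
qed auto

lemma exp_diff_le: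
  assumes "x \<le> 0" "y \<le> (0::real)"
  shows "\<bar>exp x - exp y\<bar> \<le> \<bar>x - y\<bar>"
proof -
  have *: "exp b - exp a \<le> b - a" if "a \<le> b" "b \<le> 0" for a b :: real
  proof -
    have "b - exp b \<ge> a - exp a"
    proof (rule nondecreasing_by_deriv[where \<phi> = "\<lambda>x. x - exp x"])
      show "continuous_on {a..b} (\<lambda>x. x - exp x)" by (intro continuous_intros)
      fix x assume "a < x" "x < b"
      then show "((\<lambda>x. x - exp x) has_real_derivative 1 - exp x) (at x)" "0 \<le> 1 - exp x"
        using that by (auto intro!: derivative_eq_intros)
    qed (use that in auto)
    then show ?thesis by simp
  qed
  show ?thesis
  proof (cases "x \<le> y")
    case True then show ?thesis using *[of x y] assms by simp
  next
    case False then show ?thesis using *[of y x] assms by simp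
  qed
qed

context bump
begin

text \<open>Uniform error, for rescaled radii up to \<open>X\<close>, in replacing the nonlinearity \<open>f(w) / f(S)\<close> by the
  exponential of \<open>2 S (w - S)\<close>.\<close>
definition defect :: "real \<Rightarrow> real" where
  "defect X = exp (X ^ 4 / S + X\<^sup>2 / sqrt S) - 1 + X\<^sup>2 / S"

text \<open>The linear part of the exponent at \<open>S\<close> contributes \<open>2 S (w0 - S)\<close>.  The quadratic remainder is
  of order \<open>1 / S\<^sup>2\<close>, and the perturbation \<open>s powr (1 + \<epsilon>)\<close>, whose slope is at most \<open>2 sqrt S\<close>, changes
  by a term of order \<open>1 / sqrt S\<close>.\<close>
lemma nonlinearity_near_top:
  assumes S1: "1 \<le> S" and w: "0 < w0" "w0 \<le> S" and close: "8 * S * (S - w0) \<le> X\<^sup>2"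
  shows "\<bar>f_nl lam \<epsilon> w0 / f_nl lam \<epsilon> S - exp (2 * S * (w0 - S))\<bar> \<le> defect X"
proof -
  define v where "v = 2 * S * (w0 - S)"
  define A where "A = hexp \<epsilon> w0 - hexp \<epsilon> S - v"
  have v0: "v \<le> 0" using w S1 by (simp add: v_def mult_nonneg_nonpos)
  have t: "0 \<le> S - w0" "S - w0 \<le> X\<^sup>2 / (8 * S)" using w close S1 by (auto simp: field_simps)
  have quot: "f_nl lam \<epsilon> w0 / f_nl lam \<epsilon> S = w0 / S * exp (v + A)"
    using w S1 lam_pos by (simp add: f_nl_eq A_def exp_diff)
  have "A = (S - w0)\<^sup>2 - (S powr (1 + \<epsilon>) - w0 powr (1 + \<epsilon>))"
    by (simp add: A_def hexp_def v_def power2_eq_square algebra_simps)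
  moreover have "(S - w0)\<^sup>2 \<le> X ^ 4 / S"
  proof -
    have "(S - w0)\<^sup>2 \<le> (X\<^sup>2 / (8 * S))\<^sup>2" using t by (intro power_mono) auto
    also have "\<dots> = X ^ 4 / (64 * S * S)" by (simp add: power_divide power2_eq_square power4_eq_xxxx)
    also have "\<dots> \<le> X ^ 4 / S" using S1 mult_mono[of 1 "64 * S" S S] by (intro divide_left_mono) auto
    finally show ?thesis .
  qed
  moreover have "0 \<le> S powr (1 + \<epsilon>) - w0 powr (1 + \<epsilon>)"
    using w eps by (simp add: powr_mono2)
  moreover have "S powr (1 + \<epsilon>) - w0 powr (1 + \<epsilon>) \<le> X\<^sup>2 / sqrt S"
  proof -
    have "2 * sqrt S * w0 - w0 powr (1 + \<epsilon>) \<le> 2 * sqrt S * S - S powr (1 + \<epsilon>)"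
    proof (rule nondecreasing_by_deriv[where \<phi> = "\<lambda>x. 2 * sqrt S * x - x powr (1 + \<epsilon>)"])
      show "continuous_on {w0..S} (\<lambda>x. 2 * sqrt S * x - x powr (1 + \<epsilon>))"
        using w by (intro continuous_intros) auto
      fix x assume x: "w0 < x" "x < S"
      show "((\<lambda>x. 2 * sqrt S * x - x powr (1 + \<epsilon>)) has_real_derivative
          2 * sqrt S - (1 + \<epsilon>) * x powr \<epsilon>) (at x)"
        using x w by (auto intro!: derivative_eq_intros)
      have "x powr \<epsilon> \<le> S powr \<epsilon>" using x w eps by (intro powr_mono2) auto
      also have "\<dots> \<le> S powr (1/2)" using S1 eps by (intro powr_mono) auto
      also have "\<dots> = sqrt S" using S1 by (simp add: powr_half_sqrt)
      finally have "(1 + \<epsilon>) * x powr \<epsilon> \<le> 2 * sqrt S" using eps by (intro mult_mono) auto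
      then show "0 \<le> 2 * sqrt S - (1 + \<epsilon>) * x powr \<epsilon>" by simp
    qed (use w in auto)
    then have "S powr (1 + \<epsilon>) - w0 powr (1 + \<epsilon>) \<le> 2 * sqrt S * (S - w0)" by (simp add: algebra_simps)
    also have "\<dots> \<le> 2 * sqrt S * (X\<^sup>2 / (8 * S))" using t S1 by (intro mult_left_mono) auto
    also have "\<dots> = X\<^sup>2 / (4 * sqrt S)"
    proof -
      have "2 * s * (X\<^sup>2 / (8 * (s * s))) = X\<^sup>2 / (4 * s)" if "0 < s" for s :: real
        using that by (simp add: field_simps)
      from this[of "sqrt S"] S1 show ?thesis by simp
    qed
    also have "\<dots> \<le> X\<^sup>2 / sqrt S" using S1 by (intro divide_left_mono) auto
    finally show ?thesis .
  qed
  moreover have "0 \<le> (S - w0)\<^sup>2" by simp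
  moreover have "0 \<le> X ^ 4 / S" "0 \<le> X\<^sup>2 / sqrt S" using S1 by (auto simp: zero_le_power_eq)
  ultimately have absA: "\<bar>A\<bar> \<le> X ^ 4 / S + X\<^sup>2 / sqrt S" by linarith
  have "\<bar>w0 / S * exp A - 1\<bar> \<le> exp (X ^ 4 / S + X\<^sup>2 / sqrt S) - 1 + X\<^sup>2 / S"
  proof -
    have "w0 / S * exp A - 1 = w0 / S * (exp A - 1) - (S - w0) / S"
      using S1 by (simp add: field_simps)
    then have "\<bar>w0 / S * exp A - 1\<bar> \<le> \<bar>w0 / S * (exp A - 1)\<bar> + \<bar>(S - w0) / S\<bar>" by linarith
    moreover have "\<bar>w0 / S * (exp A - 1)\<bar> \<le> 1 * \<bar>exp A - 1\<bar>"
      unfolding abs_mult using w S1 by (intro mult_right_mono) auto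
    moreover have "\<bar>exp A - 1\<bar> \<le> exp \<bar>A\<bar> - 1" by (rule abs_exp_minus_one_le)
    moreover have "exp \<bar>A\<bar> \<le> exp (X ^ 4 / S + X\<^sup>2 / sqrt S)" using absA by simp
    moreover have "\<bar>(S - w0) / S\<bar> \<le> X\<^sup>2 / S"
    proof -
      have "S - w0 \<le> X\<^sup>2"
      proof -
        have "X\<^sup>2 / (8 * S) \<le> X\<^sup>2 / 1" using S1 by (intro divide_left_mono) auto
        then show ?thesis using t by simp
      qed
      then show ?thesis using t S1 by (simp add: divide_right_mono)
    qed
    ultimately show ?thesis by linarith
  qed
  then have "exp v * \<bar>w0 / S * exp A - 1\<bar> \<le> 1 * defect X"
    using v0 unfolding defect_def by (intro mult_mono) auto
  moreover have "exp v * \<bar>w0 / S * exp A - 1\<bar> = \<bar>w0 / S * exp (v + A) - exp v\<bar>"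
  proof -
    have "w0 / S * exp (v + A) - exp v = exp v * (w0 / S * exp A - 1)"
      by (simp add: exp_add algebra_simps)
    then show ?thesis by (simp add: abs_mult)
  qed
  ultimately show ?thesis unfolding quot v_def[symmetric] by simp
qed

text \<open>A Gronwall estimate for the difference \<open>D\<close> between the rescaled bump and the bubble.  The system
  for \<open>D\<close> and the flux difference \<open>Z\<close> has Lipschitz constant one because both profiles are nonpositive.
  In the norm \<open>sup \<bar>D x\<bar> exp (- 2 x)\<close> two integrations contribute a factor 1/4, which can be absorbed.
  The term \<open>m / 2\<close> in the error is the flux that the bubble has already collected before \<open>m\<close>.\<close>
lemma bubble_convergence_bound:
  assumes S1: "1 \<le> S" and X: "M < X * d" "X\<^sup>2 \<le> 8 * S\<^sup>2 / 2" "0 < X"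
  defines "m \<equiv> M / d"
  defines "err \<equiv> m / 2 + defect X * X / 2"
  defines "N \<equiv> 2 * (m\<^sup>2 / 4 + err * X)"
  assumes x: "m < x" "x \<le> X"
  shows "X * d < R"
    and "\<bar>2 * S * (w (x * d) - S) - bubble x\<bar> \<le> N * exp (2 * X)"
    and "\<bar>2 * S * d * (- p (x * d) / (x * d)) - bubble' x\<bar> \<le> err + N * exp (2 * X) / 2"
proof -
  show XR: "X * d < R"
  proof -
    have "8 * S * S * d\<^sup>2 \<le> R\<^sup>2" using value_imp_radius[of R] w_R MR by simp
    moreover have "(X * d)\<^sup>2 < 8 * S * S * d\<^sup>2"
    proof -
      have "X\<^sup>2 * d\<^sup>2 < 8 * (S * S) * d\<^sup>2"
        using X S1 d_pos mult_mono[of 1 S 1 S] by (intro mult_strict_right_mono) (auto simp: power2_eq_square)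
      then show ?thesis by (simp add: power_mult_distrib mult.assoc)
    qed
    ultimately have "(X * d)\<^sup>2 < R\<^sup>2" by linarith
    then show ?thesis by (rule power2_less_imp_less) (use R_pos in simp)
  qed
  have m0: "0 \<le> m" using M_nonneg d_pos by (simp add: m_def)
  have mX: "m < X" using X d_pos by (simp add: m_def field_simps)
  have md: "m * d = M" using d_pos by (simp add: m_def)
  have rng: "M \<le> x * d" "x * d < R" if "m \<le> x" "x \<le> X" for x
  proof -
    show "M \<le> x * d" using that(1) d_pos md mult_right_mono[of m x d] by simp
    show "x * d < R" using mult_right_mono[OF that(2), of d] d_pos XR by linarith
  qed
  have rng': "M < x * d" if "m < x" for x
    using that d_pos md mult_strict_right_mono[of m x d] by simp
  define D where "D = (\<lambda>x. 2 * S * (w (x * d) - S) - bubble x)"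
  define D' where "D' = (\<lambda>x. 2 * S * d * (- p (x * d) / (x * d)) - bubble' x)"
  define Z where "Z = (\<lambda>x. 2 * S * p (x * d) - 4 * x\<^sup>2 / (8 + x\<^sup>2))"
  have sub: "continuous_on {a..b} (\<lambda>x. w (x * d))" "continuous_on {a..b} (\<lambda>x. p (x * d))"
    if "m \<le> a" "b \<le> X" for a b
  proof -
    have im: "(\<lambda>x. x * d) ` {a..b} \<subseteq> {M..R}"
    proof
      fix y assume "y \<in> (\<lambda>x. x * d) ` {a..b}"
      then obtain x where "y = x * d" "x \<in> {a..b}" by (rule imageE)
      then show "y \<in> {M..R}" using rng[of x] that by auto
    qed
    show "continuous_on {a..b} (\<lambda>x. w (x * d))" "continuous_on {a..b} (\<lambda>x. p (x * d))"
      using im by (auto intro!: continuous_on_compose2[OF w_cont] continuous_on_compose2[OF p_cont] continuous_intros)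
  qed
  have D_cont: "continuous_on {a..b} D" if "m \<le> a" "b \<le> X" for a b
    unfolding D_def using sub[OF that] bubble_deriv
    by (intro continuous_intros DERIV_continuous_on[of _ bubble bubble']) (auto intro: has_field_derivative_at_within)
  have Z_cont: "continuous_on {a..b} Z" if "m \<le> a" "b \<le> X" for a b
    unfolding Z_def using sub[OF that]
  proof (intro continuous_intros)
    show "\<forall>x\<in>{a..b}. 8 + x\<^sup>2 \<noteq> 0"
    proof
      fix x :: real
      have "0 < 8 + x\<^sup>2" by (simp add: add_pos_nonneg)
      then show "8 + x\<^sup>2 \<noteq> 0" by linarith
    qed
  qed
  have scale: "((\<lambda>x. x * d) has_real_derivative d) (at x)" for x
    by (auto intro!: derivative_eq_intros)
  have D_deriv: "(D has_real_derivative D' x) (at x)" if "m < x" "x < X" for x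
  proof -
    have "((\<lambda>x. w (x * d)) has_real_derivative (- p (x * d) / (x * d)) * d) (at x)"
      using DERIV_chain2[OF w_deriv scale] rng'[of x] rng[of x] that by simp
    then show ?thesis unfolding D_def D'_def using bubble_deriv[of x]
      by (auto intro!: derivative_eq_intros simp: algebra_simps)
  qed
  define g where "g = (\<lambda>x. f_nl lam \<epsilon> (w (x * d)) / f_nl lam \<epsilon> S)"
  have Z_deriv: "(Z has_real_derivative x * (g x - exp (bubble x))) (at x)" if "m < x" "x < X" for x
  proof -
    have "((\<lambda>x. p (x * d)) has_real_derivative (x * d * f_nl lam \<epsilon> (w (x * d))) * d) (at x)"
      using DERIV_chain2[OF p_deriv scale] rng'[of x] rng[of x] that by simp
    from DERIV_diff[OF DERIV_cmult[OF this, of "2 * S"] flux_deriv[of x]]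
    have "(Z has_real_derivative 2 * S * (x * d * f_nl lam \<epsilon> (w (x * d)) * d) - x * exp (bubble x)) (at x)"
      unfolding Z_def .
    moreover have "2 * S * (x * d * f_nl lam \<epsilon> (w (x * d)) * d) = x * g x"
      unfolding g_def f_top by (simp add: power2_eq_square)
    ultimately show ?thesis by (simp add: right_diff_distrib)
  qed
  have D'_Z: "D' x = - Z x / x" if "m < x" for x
  proof -
    have "0 < x" using that m0 by simp
    then show ?thesis using d_pos unfolding D'_def Z_def bubble'_def
      by (simp add: diff_divide_distrib power2_eq_square)
  qed
  have def0: "0 \<le> defect X"
    unfolding defect_def using S1 by (auto simp: zero_le_power_eq intro!: add_nonneg_nonneg)
  have err0: "0 \<le> err" unfolding err_def using m0 def0 X by simp
  have gbound: "\<bar>g x - exp (bubble x)\<bar> \<le> defect X + \<bar>D x\<bar>" if "m \<le> x" "x \<le> X" for x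
  proof -
    have w0: "0 < w (x * d)" "w (x * d) \<le> S" using rng[OF that] w_pos w_le_S by auto
    have x2: "x\<^sup>2 \<le> X\<^sup>2" using that m0 by (intro power_mono) auto
    have "8 * S * (S - w (x * d)) * d\<^sup>2 \<le> x\<^sup>2 * d\<^sup>2"
      using value_imp_radius[of "x * d"] rng[OF that] by (simp add: power_mult_distrib)
    then have "8 * S * (S - w (x * d)) \<le> X\<^sup>2" using d_pos x2 by simp
    then have "\<bar>g x - exp (2 * S * (w (x * d) - S))\<bar> \<le> defect X"
      unfolding g_def using nonlinearity_near_top[OF S1 w0] by simp
    moreover have "\<bar>exp (2 * S * (w (x * d) - S)) - exp (bubble x)\<bar> \<le> \<bar>D x\<bar>"
      unfolding D_def using w0 S1 bubble_nonpos by (intro exp_diff_le) (auto simp: mult_nonneg_nonpos)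
    ultimately show ?thesis by linarith
  qed
  \<comment> \<open>\<open>K\<close> is the weighted norm of \<open>D\<close>; it is attained at \<open>xs\<close>.\<close>
  obtain xs where xs: "xs \<in> {m..X}" "\<And>y. y \<in> {m..X} \<Longrightarrow> \<bar>D y\<bar> * exp (- 2 * y) \<le> \<bar>D xs\<bar> * exp (- 2 * xs)"
  proof -
    have "continuous_on {m..X} (\<lambda>y. \<bar>D y\<bar> * exp (- 2 * y))"
      using D_cont[of m X] by (intro continuous_intros) auto
    then show thesis using continuous_attains_sup[of "{m..X}" "\<lambda>y. \<bar>D y\<bar> * exp (- 2 * y)"] mX that by auto
  qed
  define K where "K = \<bar>D xs\<bar> * exp (- 2 * xs)"
  have K0: "0 \<le> K" by (simp add: K_def)
  have DK: "\<bar>D y\<bar> \<le> K * exp (2 * y)" if "m \<le> y" "y \<le> X" for y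
  proof -
    have "\<bar>D y\<bar> * exp (- 2 * y) * exp (2 * y) \<le> K * exp (2 * y)"
      using xs(2)[of y] that by (intro mult_right_mono) (auto simp: K_def)
    then show ?thesis by (simp add: mult.assoc flip: exp_add)
  qed
  have Dm: "\<bar>D m\<bar> \<le> m\<^sup>2 / 4"
    unfolding D_def using bubble_lower[of m] bubble_nonpos[of m] by (simp add: md w_M)
  have Zm: "\<bar>Z m\<bar> \<le> m\<^sup>2 / 2"
  proof -
    have "4 * m\<^sup>2 / (8 + m\<^sup>2) \<le> 4 * m\<^sup>2 / 8" by (intro divide_left_mono) (auto simp: add_pos_nonneg)
    then show ?thesis unfolding Z_def by (simp add: md p_M)
  qed
  have Z_bound: "\<bar>Z y\<bar> \<le> m\<^sup>2 / 2 + defect X * y\<^sup>2 / 2 + K * (y * exp (2 * y)) / 2" if y: "m \<le> y" "y \<le> X" for y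
  proof -
    \<comment> \<open>The sign \<open>s\<close> treats both one-sided bounds at once.\<close>
    have "s * Z y - defect X * y\<^sup>2 / 2 - K * (y * exp (2 * y)) / 2
        \<le> s * Z m - defect X * m\<^sup>2 / 2 - K * (m * exp (2 * m)) / 2" if s: "\<bar>s\<bar> = 1" for s
    proof (rule nonincreasing_by_deriv[where \<phi> = "\<lambda>y. s * Z y - defect X * y\<^sup>2 / 2 - K * (y * exp (2 * y)) / 2"])
      show "continuous_on {m..y} (\<lambda>y. s * Z y - defect X * y\<^sup>2 / 2 - K * (y * exp (2 * y)) / 2)"
        using Z_cont[of m y] y by (intro continuous_intros) auto
      fix x assume x: "m < x" "x < y"
      then have Zx: "(Z has_real_derivative x * (g x - exp (bubble x))) (at x)" using Z_deriv y by simp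
      show "((\<lambda>y. s * Z y - defect X * y\<^sup>2 / 2 - K * (y * exp (2 * y)) / 2) has_real_derivative
          s * (x * (g x - exp (bubble x))) - defect X * x - K * (exp (2 * x) + x * (2 * exp (2 * x))) / 2) (at x)"
        by (auto intro!: derivative_eq_intros Zx simp: algebra_simps)
      have "s * (x * (g x - exp (bubble x))) \<le> \<bar>s * (x * (g x - exp (bubble x)))\<bar>" by simp
      also have "\<dots> = x * \<bar>g x - exp (bubble x)\<bar>" using s x m0 by (simp add: abs_mult)
      also have "\<dots> \<le> x * (defect X + K * exp (2 * x))"
        using gbound[of x] DK[of x] x y m0 by (intro mult_left_mono) auto
      finally have "s * (x * (g x - exp (bubble x))) \<le> x * (defect X + K * exp (2 * x))" .
      then show "s * (x * (g x - exp (bubble x))) - defect X * x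
          - K * (exp (2 * x) + x * (2 * exp (2 * x))) / 2 \<le> 0"
      proof -
        have "0 \<le> K * exp (2 * x) / 2" using K0 by simp
        moreover have "K * (exp (2 * x) + x * (2 * exp (2 * x))) / 2 = K * exp (2 * x) / 2 + x * (K * exp (2 * x))"
          by (simp add: field_simps)
        ultimately show ?thesis using \<open>s * (x * (g x - exp (bubble x))) \<le> x * (defect X + K * exp (2 * x))\<close>
            distrib_left[of x "defect X" "K * exp (2 * x)"] mult.commute[of x "defect X"] by argo
      qed
    qed (use y in auto)
    from this[of 1] this[of "-1"]
    have a: "Z y - defect X * y\<^sup>2 / 2 - K * (y * exp (2 * y)) / 2 \<le> Z m - defect X * m\<^sup>2 / 2 - K * (m * exp (2 * m)) / 2"
      "- Z y - defect X * y\<^sup>2 / 2 - K * (y * exp (2 * y)) / 2 \<le> - Z m - defect X * m\<^sup>2 / 2 - K * (m * exp (2 * m)) / 2"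
      by auto
    have "0 \<le> defect X * m\<^sup>2 / 2" "0 \<le> K * (m * exp (2 * m)) / 2" using def0 K0 m0 by auto
    then show ?thesis using a Zm by linarith
  qed
  have D'_bound: "\<bar>D' y\<bar> \<le> err + K * exp (2 * y) / 2" if y: "m < y" "y \<le> X" for y
  proof -
    have y0: "0 < y" using y m0 by simp
    have "\<bar>D' y\<bar> = \<bar>Z y\<bar> / y" using D'_Z[OF y(1)] y0 by simp
    also have "\<dots> \<le> (m\<^sup>2 / 2 + defect X * y\<^sup>2 / 2 + K * (y * exp (2 * y)) / 2) / y"
      using Z_bound[of y] y y0 by (intro divide_right_mono) auto
    also have "\<dots> = m * m / (2 * y) + defect X * y / 2 + K * exp (2 * y) / 2"
      using y0 by (simp add: add_divide_distrib power2_eq_square)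
    finally have "\<bar>D' y\<bar> \<le> m * m / (2 * y) + defect X * y / 2 + K * exp (2 * y) / 2" .
    moreover have "m * m / (2 * y) \<le> m * y / (2 * y)"
      using y m0 y0 by (intro divide_right_mono mult_left_mono) auto
    moreover have "m * y / (2 * y) = m / 2" using y0 by simp
    moreover have "defect X * y / 2 \<le> defect X * X / 2" using def0 y by (intro divide_right_mono mult_left_mono) auto
    ultimately show ?thesis unfolding err_def by linarith
  qed
  have D_bound: "\<bar>D y\<bar> \<le> m\<^sup>2 / 4 + err * X + K * exp (2 * y) / 4" if y: "m \<le> y" "y \<le> X" for y
  proof -
    have "s * D y - err * y - K * exp (2 * y) / 4 \<le> s * D m - err * m - K * exp (2 * m) / 4" if s: "\<bar>s\<bar> = 1" for s
    proof (rule nonincreasing_by_deriv[where \<phi> = "\<lambda>y. s * D y - err * y - K * exp (2 * y) / 4"])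
      show "continuous_on {m..y} (\<lambda>y. s * D y - err * y - K * exp (2 * y) / 4)"
        using D_cont[of m y] y by (intro continuous_intros) auto
      fix x assume x: "m < x" "x < y"
      then have Dx: "(D has_real_derivative D' x) (at x)" using D_deriv y by simp
      show "((\<lambda>y. s * D y - err * y - K * exp (2 * y) / 4) has_real_derivative
          s * D' x - err - K * exp (2 * x) / 2) (at x)"
        by (auto intro!: derivative_eq_intros Dx)
      have "s * D' x \<le> \<bar>s * D' x\<bar>" by simp
      also have "\<dots> = \<bar>D' x\<bar>" using s by (simp add: abs_mult)
      finally show "s * D' x - err - K * exp (2 * x) / 2 \<le> 0" using D'_bound[of x] x y by simp
    qed (use y in auto)
    from this[of 1] this[of "-1"]
    have a: "D y - err * y - K * exp (2 * y) / 4 \<le> D m - err * m - K * exp (2 * m) / 4"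
      "- D y - err * y - K * exp (2 * y) / 4 \<le> - D m - err * m - K * exp (2 * m) / 4" by auto
    have "0 \<le> err * m" "0 \<le> K * exp (2 * m) / 4" "err * y \<le> err * X"
      using err0 K0 m0 y by (auto intro: mult_left_mono)
    then show ?thesis using a Dm by linarith
  qed
  have b1: "0 \<le> m\<^sup>2 / 4 + err * X" using err0 X by auto
  have "K \<le> (m\<^sup>2 / 4 + err * X) + K / 4"
  proof -
    have e1: "exp (- 2 * xs) \<le> 1" using xs(1) m0 by auto
    have b0: "0 \<le> m\<^sup>2 / 4 + err * X" using err0 X by auto
    have "K \<le> (m\<^sup>2 / 4 + err * X + K * exp (2 * xs) / 4) * exp (- 2 * xs)"
      unfolding K_def using D_bound[of xs, unfolded K_def] xs(1) by (intro mult_right_mono) auto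
    also have "\<dots> = (m\<^sup>2 / 4 + err * X) * exp (- 2 * xs) + K / 4"
      by (simp add: distrib_right mult.assoc flip: exp_add)
    finally have "K \<le> (m\<^sup>2 / 4 + err * X) * exp (- 2 * xs) + K / 4" .
    moreover have "(m\<^sup>2 / 4 + err * X) * exp (- 2 * xs) \<le> (m\<^sup>2 / 4 + err * X) * 1"
      using e1 b0 by (rule mult_left_mono)
    ultimately show ?thesis by simp
  qed
  then have KN: "K \<le> N" proof -
    have "K \<le> 2 * s" if "K \<le> s + K / 4" "0 \<le> s" for s using that by linarith
    with b1 show "K \<le> (m\<^sup>2 / 4 + err * X) + K / 4 \<Longrightarrow> ?thesis" unfolding N_def by blast
  qed
  have eN: "K * exp (2 * x) \<le> N * exp (2 * X)"
    using KN K0 x by (intro mult_mono) auto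
  show "\<bar>2 * S * (w (x * d) - S) - bubble x\<bar> \<le> N * exp (2 * X)"
    using DK[of x] x eN unfolding D_def by simp
  show "\<bar>2 * S * d * (- p (x * d) / (x * d)) - bubble' x\<bar> \<le> err + N * exp (2 * X) / 2"
    using D'_bound[of x] x eN unfolding D'_def by simp
qed

end

lemma bubble'_le_1: "\<bar>bubble' x\<bar> \<le> 1"
proof -
  have "0 \<le> (\<bar>x\<bar> - 2)\<^sup>2 + 4" by simp
  then have "4 * \<bar>x\<bar> \<le> 8 + x\<^sup>2" by (simp add: power2_eq_square algebra_simps)
  moreover have "0 < 8 + x\<^sup>2" by (simp add: add_pos_nonneg)
  moreover have "\<bar>bubble' x\<bar> = 4 * \<bar>x\<bar> / (8 + x\<^sup>2)"
    using \<open>0 < 8 + x\<^sup>2\<close> by (simp add: bubble'_def abs_mult)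
  ultimately show ?thesis by (simp add: divide_le_eq)
qed

lemma bubble_shift:
  assumes "0 \<le> m"
  shows "\<bar>bubble (m + t) - bubble t\<bar> \<le> m"
proof -
  have "norm (bubble (m + t) - bubble t) \<le> 1 * norm (m + t - t)"
  proof (rule field_differentiable_bound[where S = UNIV and f' = bubble'])
    show "(bubble has_field_derivative bubble' z) (at z within UNIV)" for z
      using bubble_deriv by simp
    show "norm (bubble' z) \<le> 1" for z using bubble'_le_1 by simp
  qed auto
  then show ?thesis using assms by simp
qed

lemma bubble'_shift:
  assumes "0 \<le> m"
  shows "\<bar>bubble' (m + t) - bubble' t\<bar> \<le> m"
proof -
  define b2 where "b2 = (\<lambda>x::real. ((- 4) * (8 + x\<^sup>2) - (- 4 * x) * (2 * x)) / ((8 + x\<^sup>2) * (8 + x\<^sup>2)))"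
  have "norm (bubble' (m + t) - bubble' t) \<le> 1 * norm (m + t - t)"
  proof (rule field_differentiable_bound[where S = UNIV and f' = b2])
    fix z :: real
    have q: "0 < 8 + z\<^sup>2" by (simp add: add_pos_nonneg)
    have n: "((\<lambda>x. - 4 * x) has_real_derivative - 4) (at z)"
      and m: "((\<lambda>x. 8 + x\<^sup>2) has_real_derivative 2 * z) (at z)"
      by (auto intro!: derivative_eq_intros)
    show "(bubble' has_field_derivative b2 z) (at z within UNIV)"
      unfolding bubble'_def[abs_def] b2_def using DERIV_divide[OF n m] q by simp
    have "\<bar>(- 4) * (8 + z\<^sup>2) - (- 4 * z) * (2 * z)\<bar> \<le> 1 * ((8 + z\<^sup>2) * (8 + z\<^sup>2))"
    proof -
      have "(- 4) * (8 + z\<^sup>2) - (- 4 * z) * (2 * z) = 4 * z\<^sup>2 - 32"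
        by (simp add: power2_eq_square algebra_simps)
      moreover have "(8 + z\<^sup>2) * (8 + z\<^sup>2) = 64 + 16 * z\<^sup>2 + z\<^sup>2 * z\<^sup>2"
        by (simp add: algebra_simps)
      moreover have "0 \<le> z\<^sup>2 * z\<^sup>2" "0 \<le> z\<^sup>2" by auto
      ultimately show ?thesis by linarith
    qed
    then show "norm (b2 z) \<le> 1" using q by (simp add: b2_def divide_le_eq)
  qed auto
  then show ?thesis using assms by simp
qed

text \<open>The same convergence measured from \<open>M\<close>: the argument is \<open>M + d t\<close> instead of \<open>d x\<close>, and the bubble and
  its derivative move by at most \<open>M / d\<close> under this shift.\<close>
lemma bump_bubble:
  assumes X: "0 < X" and \<eta>: "0 < \<eta>"
  obtains S0 \<mu> where "0 < \<mu>"
    "\<And>lam \<epsilon> M R S d w p t. bump lam \<epsilon> M R S d w p \<Longrightarrow> S0 \<le> S \<Longrightarrow> M\<^sup>2 \<le> \<mu> * d\<^sup>2 \<Longrightarrow> 0 < t \<Longrightarrow> t \<le> X \<Longrightarrow>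
      M + d * t < R \<and> \<bar>2 * S * (w (M + d * t) - S) - bubble t\<bar> \<le> \<eta>
      \<and> \<bar>2 * S * d * (- p (M + d * t) / (M + d * t)) - bubble' t\<bar> \<le> \<eta>"
proof -
  define Y where "Y = X + 1"
  have Y: "1 < Y" using X by (simp add: Y_def)
  define C1 where "C1 = 1/2 + Y / 2"
  define C where "C = C1 + 2 * (1/4 + C1 * Y) * exp (2 * Y) + 1"
  have C1: "0 < C1" using Y by (simp add: C1_def)
  have C: "0 < C" unfolding C_def using C1 Y by (intro add_pos_pos mult_pos_pos) auto
  define \<nu> where "\<nu> = min 1 (\<eta> / C)"
  have \<nu>: "0 < \<nu>" "\<nu> \<le> 1" "C * \<nu> \<le> \<eta>"
    using \<eta> C by (auto simp: \<nu>_def min_def field_simps)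
  have "((\<lambda>S::real. exp (Y ^ 4 / S + Y\<^sup>2 / sqrt S) - 1 + Y\<^sup>2 / S) \<longlongrightarrow> exp (0 + 0) - 1 + 0) at_top"
    by (intro tendsto_intros tendsto_divide_0[OF tendsto_const] filterlim_at_top_imp_at_infinity
        sqrt_at_top filterlim_ident)
  then have "eventually (\<lambda>S::real. exp (Y ^ 4 / S + Y\<^sup>2 / sqrt S) - 1 + Y\<^sup>2 / S < \<nu>) at_top"
    using \<nu> by (intro order_tendstoD(2)) auto
  then obtain S1 where S1: "\<And>S. S1 \<le> S \<Longrightarrow> exp (Y ^ 4 / S + Y\<^sup>2 / sqrt S) - 1 + Y\<^sup>2 / S < \<nu>"
    unfolding eventually_at_top_linorder by blast
  have main: "M + d * t < R \<and> \<bar>2 * S * (w (M + d * t) - S) - bubble t\<bar> \<le> \<eta>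
      \<and> \<bar>2 * S * d * (- p (M + d * t) / (M + d * t)) - bubble' t\<bar> \<le> \<eta>"
    if b: "bump lam \<epsilon> M R S d w p" and S: "max S1 Y \<le> S" and M: "M\<^sup>2 \<le> \<nu>\<^sup>2 * d\<^sup>2"
      and t: "0 < t" "t \<le> X" for lam \<epsilon> M R S d w p t
  proof -
    interpret bump lam \<epsilon> M R S d w p by (rule b)
    define m where "m = M / d"
    have "M\<^sup>2 \<le> (\<nu> * d)\<^sup>2" using M by (simp add: power_mult_distrib)
    then have "M \<le> \<nu> * d" by (rule power2_le_imp_le) (use \<nu> d_pos in simp)
    then have m: "0 \<le> m" "m \<le> \<nu>" using M_nonneg d_pos by (auto simp: m_def divide_le_eq)
    have md: "m * d = M" using d_pos by (simp add: m_def)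
    have SY: "Y \<le> S" "1 \<le> S" using S Y by auto
    have df: "defect Y \<le> \<nu>" unfolding defect_def using S1[of S] S by simp
    have df0: "0 \<le> defect Y"
      unfolding defect_def using SY by (auto simp: zero_le_power_eq intro!: add_nonneg_nonneg)
    define err where "err = m / 2 + defect Y * Y / 2"
    define N where "N = 2 * (m\<^sup>2 / 4 + err * Y)"
    have x: "m < m + t" "m + t \<le> Y" using t m \<nu> by (auto simp: Y_def)
    have MY: "M < Y * d"
    proof -
      have "m < Y" using m \<nu> Y by simp
      then have "m * d < Y * d" using d_pos by (rule mult_strict_right_mono)
      then show ?thesis by (simp add: md)
    qed
    have Y2: "Y\<^sup>2 \<le> 8 * S\<^sup>2 / 2"
    proof -
      have "Y\<^sup>2 \<le> S\<^sup>2" using SY Y by (intro power_mono) auto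
      then show ?thesis using zero_le_power2[of S] by linarith
    qed
    have Y0: "0 < Y" using Y by simp
    note bb = bubble_convergence_bound[OF SY(2) MY Y2 Y0, of "m + t", folded m_def, folded err_def, folded N_def, OF x]
    have arg: "(m + t) * d = M + d * t" by (simp add: distrib_right md)
    have "err \<le> C1 * \<nu>"
    proof -
      have "defect Y * Y \<le> \<nu> * Y" using df Y by (intro mult_right_mono) auto
      then show ?thesis unfolding err_def C1_def using m by (simp add: algebra_simps)
    qed
    have "N \<le> 2 * (1/4 + C1 * Y) * \<nu>"
    proof -
      have "m\<^sup>2 \<le> \<nu>"
      proof -
        have "m * m \<le> \<nu> * 1" using m \<nu> by (intro mult_mono) auto
        then show ?thesis by (simp add: power2_eq_square)
      qed
      moreover have "err * Y \<le> C1 * \<nu> * Y" using \<open>err \<le> C1 * \<nu>\<close> Y by (intro mult_right_mono) auto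
      ultimately show ?thesis unfolding N_def by (simp add: algebra_simps)
    qed
    then have Ne: "N * exp (2 * Y) \<le> 2 * (1/4 + C1 * Y) * \<nu> * exp (2 * Y)"
      by (intro mult_right_mono) auto
    have err0: "0 \<le> err" using df0 m Y by (simp add: err_def)
    then have N0: "0 \<le> N * exp (2 * Y)" using m Y by (simp add: N_def)
    have tot: "err + N * exp (2 * Y) + m \<le> \<eta>"
    proof -
      have "err + N * exp (2 * Y) + m \<le> C1 * \<nu> + 2 * (1/4 + C1 * Y) * \<nu> * exp (2 * Y) + \<nu>"
        using \<open>err \<le> C1 * \<nu>\<close> Ne m by (intro add_mono) auto
      also have "\<dots> = C * \<nu>" by (simp add: C_def algebra_simps)
      finally show ?thesis using \<nu> by simp
    qed
    have "M + d * t < R"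
    proof -
      have "(m + t) * d \<le> Y * d" using x(2) d_pos by (intro mult_right_mono) auto
      then show ?thesis using bb(1) unfolding arg by linarith
    qed
    moreover have "\<bar>2 * S * (w (M + d * t) - S) - bubble t\<bar> \<le> \<eta>"
      using bb(2) bubble_shift[OF m(1), of t] tot err0 unfolding arg by linarith
    moreover have "\<bar>2 * S * d * (- p (M + d * t) / (M + d * t)) - bubble' t\<bar> \<le> \<eta>"
      using bb(3) bubble'_shift[OF m(1), of t] tot N0 unfolding arg by linarith
    ultimately show ?thesis by blast
  qed
  have "0 < \<nu>\<^sup>2" using \<nu> by simp
  then show thesis using main by (rule that)
qed

section \<open>Compactness for the radial equation\<close>

text \<open>The system for a radial solution \<open>w\<close> of \<open>- \<Delta> w = g(w)\<close> in the disc, with flux \<open>p(t) = - t w'(t)\<close>.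
  In this form the equation at the origin is the condition \<open>p 0 = 0\<close>.  The flux is required to be
  continuous only up to the boundary, not at it.\<close>
definition radial_ode :: "(real \<Rightarrow> real) \<Rightarrow> (real \<Rightarrow> real) \<Rightarrow> (real \<Rightarrow> real) \<Rightarrow> bool" where
  "radial_ode g w p \<longleftrightarrow> continuous_on {0..1} w \<and> continuous_on {0..<1} p \<and> p 0 = 0 \<and>
     (\<forall>t\<in>{0<..<1}. (w has_real_derivative - p t / t) (at t) \<and>
       (p has_real_derivative t * g (w t)) (at t))"

text \<open>The solutions start at \<open>m n\<close> with value one and flux zero, and \<open>m n\<close> tends to zero.  Continued by the
  constant one to the left of \<open>m n\<close> they are equi-Lipschitz, because the flux is at most \<open>C x\<close>.  The
  constant continuation is harmless in the limit, so the limit solves the equation on the whole disc.\<close>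
lemma radial_ode_compactness:
  fixes v P :: "nat \<Rightarrow> real \<Rightarrow> real" and m :: "nat \<Rightarrow> real"
    and g :: "nat \<Rightarrow> real \<Rightarrow> real" and G :: "real \<Rightarrow> real"
  assumes m: "\<And>n. 0 \<le> m n" "\<And>n. m n < 1" "m \<longlonglongrightarrow> 0"
    and v_cont: "\<And>n. continuous_on {m n..1} (v n)"
    and P_cont: "\<And>n. continuous_on {m n..<1} (P n)"
    and v': "\<And>n x. m n < x \<Longrightarrow> x < 1 \<Longrightarrow> (v n has_real_derivative - P n x / x) (at x)"
    and P': "\<And>n x. m n < x \<Longrightarrow> x < 1 \<Longrightarrow> (P n has_real_derivative x * g n (v n x)) (at x)"
    and v_m: "\<And>n. v n (m n) = 1" and P_m: "\<And>n. P n (m n) = 0"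
    and v_le: "\<And>n x. m n \<le> x \<Longrightarrow> x \<le> 1 \<Longrightarrow> \<bar>v n x\<bar> \<le> 1"
    and g_le: "\<And>n y. \<bar>y\<bar> \<le> 1 \<Longrightarrow> \<bar>g n y\<bar> \<le> C"
    and g_lim: "uniform_limit {-1..1} g G sequentially"
    and G_cont: "continuous_on {-1..1} G"
  obtains \<phi> V Q where "strict_mono (\<phi> :: nat \<Rightarrow> nat)"
    "uniform_limit {0..1} (\<lambda>n x. v (\<phi> n) (max (m (\<phi> n)) x)) V sequentially"
    "radial_ode G V Q" "V 0 = 1" "\<And>x. x \<in> {0..1} \<Longrightarrow> \<bar>V x\<bar> \<le> 1"
proof -
  have C0: "0 \<le> C" using g_le[of 0 0] by simp
  have P_sub: "continuous_on {m n..b} (P n)" if "b < 1" for n b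
    using P_cont[of n] that by (auto elim!: continuous_on_subset)
  have P_le: "\<bar>P n x\<bar> \<le> C * x" if x: "m n \<le> x" "x < 1" for n x
  proof -
    have "\<bar>P n x - P n (m n)\<bar> \<le> C * (x - m n)"
    proof (rule lipschitz_by_deriv[where \<phi>' = "\<lambda>x. x * g n (v n x)"])
      fix s assume s: "m n < s" "s < x"
      show "(P n has_real_derivative s * g n (v n s)) (at s)" using P' s x by simp
      have "\<bar>s\<bar> * \<bar>g n (v n s)\<bar> \<le> 1 * C"
        using s x m(1)[of n] g_le[OF v_le[of n s]] by (intro mult_mono) auto
      then show "\<bar>s * g n (v n s)\<bar> \<le> C" by (simp add: abs_mult)
    qed (use x P_sub in auto)
    moreover have "C * (x - m n) \<le> C * x" using C0 m(1)[of n] by (intro mult_left_mono) auto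
    ultimately show ?thesis using P_m by simp
  qed
  have v_lip: "\<bar>v n y - v n x\<bar> \<le> C * (y - x)" if x: "m n \<le> x" "x \<le> y" "y \<le> 1" for n x y
  proof (rule lipschitz_by_deriv[where \<phi>' = "\<lambda>x. - P n x / x"])
    show "continuous_on {x..y} (v n)" using v_cont[of n] x by (auto elim!: continuous_on_subset)
    fix s assume s: "x < s" "s < y"
    show "(v n has_real_derivative - P n s / s) (at s)" using v' s x by simp
    have "0 < s" using s x m(1)[of n] by simp
    then show "\<bar>- P n s / s\<bar> \<le> C" using P_le[of n s] s x by (simp add: divide_le_eq)
  qed (use x in auto)
  define F where "F = (\<lambda>n x. v n (max (m n) x))"
  have F_lip1: "\<bar>F n y - F n x\<bar> \<le> C * (y - x)" if xy: "x \<le> y" "y \<le> 1" for n x y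
  proof -
    have "\<bar>F n y - F n x\<bar> \<le> C * (max (m n) y - max (m n) x)"
      unfolding F_def using xy m(2)[of n] by (intro v_lip) auto
    also have "\<dots> \<le> C * (y - x)" using C0 xy by (intro mult_left_mono) auto
    finally show ?thesis .
  qed
  have F_lip: "\<bar>F n x - F n y\<bar> \<le> C * \<bar>x - y\<bar>" if "x \<in> {0..1}" "y \<in> {0..1}" for n x y
    using F_lip1[of x y n] F_lip1[of y x n] that by (cases "x \<le> y") (auto simp: abs_minus_commute)
  have F_le: "\<bar>F n x\<bar> \<le> 1" if "x \<in> {0..1}" for n x
    unfolding F_def using that m(2)[of n] by (intro v_le) auto
  obtain V \<phi> where V_cont: "continuous_on {0..1} V" and \<phi>: "strict_mono (\<phi> :: nat \<Rightarrow> nat)"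
    and FV: "\<And>e. 0 < e \<Longrightarrow> \<exists>N. \<forall>n x. n \<ge> N \<and> x \<in> {0..1} \<longrightarrow> norm (F (\<phi> n) x - V x) < e"
  proof (rule Arzela_Ascoli[of "{0..1::real}" F 1])
    show "\<exists>d>0. \<forall>n y. y \<in> {0..1} \<and> norm (x - y) < d \<longrightarrow> norm (F n x - F n y) < e"
      if "x \<in> {0..1}" "0 < e" for x e
    proof (intro exI[of _ "e / (C + 1)"] conjI allI impI)
      show "0 < e / (C + 1)" using that C0 by simp
      fix n y assume y: "y \<in> {0..1} \<and> norm (x - y) < e / (C + 1)"
      have "\<bar>F n x - F n y\<bar> \<le> C * \<bar>x - y\<bar>" using F_lip that y by simp
      also have "\<dots> \<le> (C + 1) * \<bar>x - y\<bar>" by (intro mult_right_mono) auto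
      also have "\<dots> < e" using y C0 by (simp add: pos_less_divide_eq mult.commute)
      finally show "norm (F n x - F n y) < e" by simp
    qed
  qed (use F_le in auto)
  have lim: "uniform_limit {0..1} (\<lambda>n. F (\<phi> n)) V sequentially"
    unfolding uniform_limit_iff eventually_sequentially dist_norm using FV by blast
  have lim_pt: "(\<lambda>n. F (\<phi> n) x) \<longlonglongrightarrow> V x" if "x \<in> {0..1}" for x
    using tendsto_uniform_limitI[OF lim that] .
  have V_le: "\<bar>V x\<bar> \<le> 1" if "x \<in> {0..1}" for x
  proof -
    have "(\<lambda>n. \<bar>F (\<phi> n) x\<bar>) \<longlonglongrightarrow> \<bar>V x\<bar>" using lim_pt[OF that] by (rule tendsto_rabs)
    then show ?thesis by (rule LIMSEQ_le_const2) (use F_le that in auto)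
  qed
  have V0: "V 0 = 1"
  proof -
    have "F n 0 = 1" for n unfolding F_def using m(1)[of n] v_m by (simp add: max_def)
    then show ?thesis using lim_pt[of 0] LIMSEQ_unique[OF _ tendsto_const] by fastforce
  qed
  have GV_cont: "continuous_on {0..1} (\<lambda>s. s * G (V s))"
    using V_cont V_le by (intro continuous_intros continuous_on_compose2[OF G_cont]) (auto simp: abs_le_iff)
  define Q where "Q = (\<lambda>x. integral {0..x} (\<lambda>s. s * G (V s)))"
  have Q'w: "(Q has_real_derivative x * G (V x)) (at x within {0..1})" if "x \<in> {0..1}" for x
    unfolding Q_def using integral_has_real_derivative[OF GV_cont that] .
  have Q': "(Q has_real_derivative x * G (V x)) (at x)" if "0 < x" "x < 1" for x
    using Q'w[of x] that by (simp add: at_within_Icc_at)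
  have Q_cont: "continuous_on {0..1} Q" using Q'w by (rule DERIV_continuous_on)
  have Q0: "Q 0 = 0" by (simp add: Q_def)
  have m\<phi>: "(\<lambda>n. m (\<phi> n)) \<longlonglongrightarrow> 0"
    using LIMSEQ_subseq_LIMSEQ[OF m(3) \<phi>] by (simp add: o_def)
  have PQ: "\<forall>\<^sub>F n in sequentially. \<forall>x. m (\<phi> n) \<le> x \<and> x < 1 \<longrightarrow> \<bar>P (\<phi> n) x - Q x\<bar> \<le> e"
    if e: "0 < e" for e
  proof -
    have Qm: "(\<lambda>n. Q (m (\<phi> n))) \<longlonglongrightarrow> Q 0"
      using Q_cont m m\<phi> by (intro continuous_on_tendsto_compose[OF Q_cont]) (auto simp: less_imp_le)
    have e1: "\<forall>\<^sub>F n in sequentially. \<bar>Q (m (\<phi> n))\<bar> < e / 2"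
      using tendstoD[OF Qm, of "e/2"] e Q0 by (simp add: dist_norm)
    obtain dl where dl: "0 < dl" "\<And>x y. x \<in> {-1..1} \<Longrightarrow> y \<in> {-1..1} \<Longrightarrow> dist y x < dl \<Longrightarrow> dist (G y) (G x) < e / 4"
      using compact_uniformly_continuous[OF G_cont compact_Icc] e
      unfolding uniformly_continuous_on_def by (metis divide_pos_pos zero_less_numeral)
    have e2: "\<forall>\<^sub>F n in sequentially. \<forall>x\<in>{0..1}. dist (F (\<phi> n) x) (V x) < dl"
      using lim dl(1) unfolding uniform_limit_iff by blast
    have "\<forall>\<^sub>F n in sequentially. \<forall>y\<in>{-1..1}. dist (g n y) (G y) < e / 4"
      using g_lim e unfolding uniform_limit_iff by (meson zero_less_divide_iff zero_less_numeral)
    then have e3: "\<forall>\<^sub>F n in sequentially. \<forall>y\<in>{-1..1}. dist (g (\<phi> n) y) (G y) < e / 4"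
      using \<phi> by (rule eventually_subseq[rotated])
    show ?thesis using e1 e2 e3
    proof eventually_elim
      case (elim n)
      show ?case
      proof (intro allI impI)
        fix x assume x: "m (\<phi> n) \<le> x \<and> x < 1"
        have "\<bar>(P (\<phi> n) x - Q x) - (P (\<phi> n) (m (\<phi> n)) - Q (m (\<phi> n)))\<bar> \<le> e / 2 * (x - m (\<phi> n))"
        proof (rule lipschitz_by_deriv[where \<phi> = "\<lambda>x. P (\<phi> n) x - Q x"
              and \<phi>' = "\<lambda>x. x * g (\<phi> n) (v (\<phi> n) x) - x * G (V x)"])
          show "continuous_on {m (\<phi> n)..x} (\<lambda>x. P (\<phi> n) x - Q x)"
            using P_sub[of x "\<phi> n"] Q_cont x m(1)[of "\<phi> n"]
            by (intro continuous_intros) (auto elim!: continuous_on_subset)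
          fix s assume s: "m (\<phi> n) < s" "s < x"
          have s01: "0 < s" "s < 1" using s x m(1)[of "\<phi> n"] by auto
          show "((\<lambda>x. P (\<phi> n) x - Q x) has_real_derivative
              s * g (\<phi> n) (v (\<phi> n) s) - s * G (V s)) (at s)"
            using P'[of "\<phi> n" s] Q'[OF s01] s s01 by (intro DERIV_diff) auto
          have Fs: "F (\<phi> n) s = v (\<phi> n) s" using s by (simp add: F_def max_def)
          have a: "F (\<phi> n) s \<in> {-1..1}" "V s \<in> {-1..1}"
            using F_le[of s "\<phi> n"] V_le[of s] s01 by (auto simp: abs_le_iff)
          have "\<bar>G (F (\<phi> n) s) - G (V s)\<bar> < e / 4"
            using dl(2)[OF a(2) a(1)] elim(2) s01 by (auto simp: dist_norm)
          moreover have "\<bar>g (\<phi> n) (F (\<phi> n) s) - G (F (\<phi> n) s)\<bar> < e / 4"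
            using elim(3) a(1) by (auto simp: dist_norm)
          ultimately have "\<bar>g (\<phi> n) (v (\<phi> n) s) - G (V s)\<bar> \<le> e / 2" unfolding Fs by linarith
          then have "\<bar>s\<bar> * \<bar>g (\<phi> n) (v (\<phi> n) s) - G (V s)\<bar> \<le> 1 * (e / 2)"
            using s01 by (intro mult_mono) auto
          then show "\<bar>s * g (\<phi> n) (v (\<phi> n) s) - s * G (V s)\<bar> \<le> e / 2"
            by (simp add: abs_mult flip: right_diff_distrib)
        qed (use x in auto)
        also have "\<dots> \<le> e / 2 * 1" using e x m(1)[of "\<phi> n"] by (intro mult_left_mono) auto
        finally show "\<bar>P (\<phi> n) x - Q x\<bar> \<le> e" using elim(1) P_m[of "\<phi> n"] by linarith
      qed
    qed
  qed
  \<comment> \<open>The derivative of \<open>V\<close> is found without interchanging limit and derivative: \<open>V + R\<close> is constant since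
    the corresponding functions for \<open>v n\<close> have derivatives that tend to zero uniformly.\<close>
  obtain R where R: "\<And>x. 0 < x \<Longrightarrow> x < 1 \<Longrightarrow> (R has_real_derivative Q x / x) (at x)"
  proof -
    have "\<exists>R. \<forall>x. ereal 0 < ereal x \<longrightarrow> ereal x < ereal 1 \<longrightarrow> (R has_vector_derivative Q x / x) (at x)"
    proof (rule einterval_antiderivative)
      fix x assume x: "ereal 0 < ereal x" "ereal x < ereal 1"
      have "isCont Q x" using Q'[of x] x by (auto intro: DERIV_isCont)
      then show "isCont (\<lambda>x. Q x / x) x" using x by (intro continuous_intros) auto
    qed auto
    then show thesis using that by (auto simp: has_real_derivative_iff_has_vector_derivative)
  qed
  have VR: "V b + R b = V a + R a" if ab: "0 < a" "a \<le> b" "b < 1" for a b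
  proof -
    have "\<bar>(V b + R b) - (V a + R a)\<bar> \<le> e" if e: "0 < e" for e
    proof (rule tendsto_upperbound)
      show "(\<lambda>n. \<bar>(F (\<phi> n) b + R b) - (F (\<phi> n) a + R a)\<bar>) \<longlonglongrightarrow> \<bar>(V b + R b) - (V a + R a)\<bar>"
        using ab by (intro tendsto_intros lim_pt) auto
      have ea: "0 < e * a" using e ab by simp
      have "\<forall>\<^sub>F n in sequentially. m (\<phi> n) < a" using m\<phi> ab(1) by (rule order_tendstoD(2))
      with PQ[OF ea] show "\<forall>\<^sub>F n in sequentially. \<bar>(F (\<phi> n) b + R b) - (F (\<phi> n) a + R a)\<bar> \<le> e"
      proof eventually_elim
        case (elim n)
        have Fv: "F (\<phi> n) x = v (\<phi> n) x" if "a \<le> x" for x using elim(2) that by (simp add: F_def max_def)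
        have "\<bar>(v (\<phi> n) b + R b) - (v (\<phi> n) a + R a)\<bar> \<le> e * (b - a)"
        proof (rule lipschitz_by_deriv[where \<phi> = "\<lambda>x. v (\<phi> n) x + R x" and \<phi>' = "\<lambda>x. - P (\<phi> n) x / x + Q x / x"])
          have "continuous_on {a..b} R" 
            using ab by (intro DERIV_continuous_on[where D = "\<lambda>x. Q x / x"] has_field_derivative_at_within[OF R]) auto
          moreover have "continuous_on {a..b} (v (\<phi> n))"
            using v_cont[of "\<phi> n"] elim(2) ab by (auto elim!: continuous_on_subset)
          ultimately show "continuous_on {a..b} (\<lambda>x. v (\<phi> n) x + R x)" by (intro continuous_intros)
          fix s assume s: "a < s" "s < b"
          show "((\<lambda>x. v (\<phi> n) x + R x) has_real_derivative - P (\<phi> n) s / s + Q s / s) (at s)"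
            using s ab elim(2) by (intro DERIV_add v' R) auto
          have "\<bar>P (\<phi> n) s - Q s\<bar> \<le> e * a" using elim s ab by auto
          also have "\<dots> \<le> e * s" using s e by (intro mult_left_mono) auto
          finally have "\<bar>P (\<phi> n) s - Q s\<bar> / s \<le> e" using s ab by (simp add: divide_le_eq)
          moreover have "- P (\<phi> n) s / s + Q s / s = - ((P (\<phi> n) s - Q s) / s)" by (simp add: diff_divide_distrib)
          moreover have "\<bar>(P (\<phi> n) s - Q s) / s\<bar> = \<bar>P (\<phi> n) s - Q s\<bar> / s" using s ab by simp
          ultimately show "\<bar>- P (\<phi> n) s / s + Q s / s\<bar> \<le> e" by linarith
        qed (use ab in auto)
        also have "\<dots> \<le> e * 1" using e ab by (intro mult_left_mono) auto
        finally show ?case using Fv ab by simp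
      qed
    qed simp
    then have "\<bar>(V b + R b) - (V a + R a)\<bar> \<le> 0" by (rule field_le_epsilon) simp
    then show ?thesis by simp
  qed
  have V': "(V has_real_derivative - Q x / x) (at x)" if x: "0 < x" "x < 1" for x
  proof -
    have "((\<lambda>y. (V x + R x) - R y) has_real_derivative 0 - Q x / x) (at x)"
      using R[OF x] by (intro DERIV_diff) auto
    then have "((\<lambda>y. (V x + R x) - R y) has_real_derivative - Q x / x) (at x)" by simp
    then show ?thesis
    proof (rule has_field_derivative_transform_within_open[where S = "{0<..<1}"])
      show "(V x + R x) - R y = V y" if "y \<in> {0<..<1}" for y
        using VR[of x y] VR[of y x] that x by (cases "x \<le> y") auto
    qed (use x in auto)
  qed
  have ode: "radial_ode G V Q" unfolding radial_ode_def
    using V_cont Q_cont Q0 V' Q' by (auto elim!: continuous_on_subset)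
  show thesis by (rule that[OF \<phi> lim[unfolded F_def] ode V0 V_le])
qed

section \<open>Radial solutions in the plane and the radial equation\<close>

lemma Ck_2_iff: "Ck_on 2 f S \<longleftrightarrow> (\<forall>x\<in>S. f differentiable (at x)) \<and>
    (\<forall>v. (\<forall>x\<in>S. (\<lambda>x. frechet_derivative f (at x) v) differentiable (at x)) \<and>
      (\<forall>v'. continuous_on S (\<lambda>x. frechet_derivative (\<lambda>x. frechet_derivative f (at x) v) (at x) v')))"
  by (simp add: numeral_2_eq_2)

lemma has_real_derivative_along_line:
  fixes f :: "'a::real_normed_vector \<Rightarrow> real"
  assumes "f differentiable (at (c + s *\<^sub>R e))"
  shows "((\<lambda>s. f (c + s *\<^sub>R e)) has_real_derivative frechet_derivative f (at (c + s *\<^sub>R e)) e) (at s)"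
proof -
  have l: "((\<lambda>s. c + s *\<^sub>R e) has_derivative (\<lambda>h. h *\<^sub>R e)) (at s)"
    by (auto intro!: derivative_eq_intros)
  have D: "(f has_derivative frechet_derivative f (at (c + s *\<^sub>R e))) (at (c + s *\<^sub>R e))"
    using assms by (simp only: frechet_derivative_works)
  have "((\<lambda>s. f (c + s *\<^sub>R e)) has_derivative (\<lambda>h. frechet_derivative f (at (c + s *\<^sub>R e)) (h *\<^sub>R e))) (at s)"
    using has_derivative_compose[OF l D] .
  moreover have "(\<lambda>h. frechet_derivative f (at (c + s *\<^sub>R e)) (h *\<^sub>R e))
      = (*) (frechet_derivative f (at (c + s *\<^sub>R e)) e)"
    using linear_scale[OF linear_frechet_derivative[OF assms]] by (auto simp: mult.commute)
  ultimately show ?thesis by (simp add: has_field_derivative_def)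
qed

abbreviation e1 :: plane where "e1 \<equiv> axis 1 1"
abbreviation e2 :: plane where "e2 \<equiv> axis 2 1"

lemma norm_plane: "norm (a *\<^sub>R e1 + b *\<^sub>R e2) = sqrt (a\<^sup>2 + b\<^sup>2)"
  by (simp add: norm_vec_def L2_set_def sum_2 axis_def)

lemma laplacian_eq:
  "laplacian u x = frechet_derivative (\<lambda>y. frechet_derivative u (at y) e1) (at x) e1
     + frechet_derivative (\<lambda>y. frechet_derivative u (at y) e2) (at x) e2"
  by (simp add: laplacian_def gradient_def sum_2)

text \<open>At the point \<open>t e1\<close> the radial second derivative is \<open>w''(t)\<close>.  The tangential one is \<open>w'(t) / t\<close>: along
  \<open>t e1 + s e2\<close> the second component of the gradient equals \<open>w'(\<rho>) s / \<rho>\<close> with \<open>\<rho> = sqrt (t\<^sup>2 + s\<^sup>2)\<close>,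
  and only the factor \<open>s\<close> contributes to its derivative at \<open>s = 0\<close>.\<close>
lemma radial_solution_imp_ode:
  assumes rad: "radial u" and sol: "dirichlet_solution g u"
  shows "radial_ode g (profile u) (\<lambda>t. - t * deriv (profile u) t)" and "profile u 1 = 0"
proof -
  have C2: "Ck_on 2 u disc" and uc: "continuous_on (cball 0 1) u"
    and eq: "\<And>x. x \<in> disc \<Longrightarrow> - laplacian u x = g (u x)" and bd: "\<And>x. x \<in> sphere 0 1 \<Longrightarrow> u x = 0"
    using sol by (auto simp: dirichlet_solution_def)
  have d1: "u differentiable (at x)" if "x \<in> disc" for x using C2 that by (simp add: Ck_2_iff)
  have d2: "(\<lambda>x. frechet_derivative u (at x) v) differentiable (at x)" if "x \<in> disc" for x v
    using C2 that by (simp add: Ck_2_iff)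
  define w where "w = profile u"
  define w1 where "w1 = (\<lambda>t. frechet_derivative u (at (t *\<^sub>R e1)) e1)"
  have in_disc: "t *\<^sub>R e1 \<in> disc" if "\<bar>t\<bar> < 1" for t using that by simp
  have w': "(w has_real_derivative w1 t) (at t)" if "\<bar>t\<bar> < 1" for t
  proof -
    have "u differentiable (at (0 + t *\<^sub>R e1))" using d1[OF in_disc[OF that]] by simp
    from has_real_derivative_along_line[OF this] show ?thesis
      by (simp only: w_def profile_def[abs_def] w1_def add_0_left)
  qed
  have deriv_w: "deriv w t = w1 t" if "\<bar>t\<bar> < 1" for t using w'[OF that] by (rule DERIV_imp_deriv)
  define w2 where "w2 = (\<lambda>t. frechet_derivative (\<lambda>y. frechet_derivative u (at y) e1) (at (t *\<^sub>R e1)) e1)"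
  have w1': "(w1 has_real_derivative w2 t) (at t)" if "\<bar>t\<bar> < 1" for t
  proof -
    have "(\<lambda>y. frechet_derivative u (at y) e1) differentiable (at (0 + t *\<^sub>R e1))"
      using d2[OF in_disc[OF that]] by simp
    from has_real_derivative_along_line[OF this] show ?thesis by (simp only: w1_def w2_def add_0_left)
  qed
  have u_w: "u x = w (norm x)" if "norm x \<le> 1" for x
    unfolding w_def profile_def
    by (rule rad[unfolded radial_def, rule_format]) (use that in auto)
  have lap2: "frechet_derivative (\<lambda>y. frechet_derivative u (at y) e2) (at (t *\<^sub>R e1)) e2 = w1 t / t"
    if t: "0 < t" "t < 1" for t
  proof -
    define \<rho> where "\<rho> = (\<lambda>s. sqrt (t\<^sup>2 + s\<^sup>2))"
    have pos: "0 < t\<^sup>2 + s\<^sup>2" for s using t by (simp add: add_pos_nonneg)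
    have \<rho>0: "0 < \<rho> s" for s unfolding \<rho>_def by (rule real_sqrt_gt_zero[OF pos])
    have n: "norm (t *\<^sub>R e1 + s *\<^sub>R e2) = \<rho> s" for s by (simp add: norm_plane \<rho>_def)
    have \<rho>': "(\<rho> has_real_derivative s / \<rho> s) (at s)" for s
    proof -
      have i: "((\<lambda>s. t\<^sup>2 + s\<^sup>2) has_real_derivative 2 * s) (at s)"
        by (auto intro!: derivative_eq_intros)
      have "(\<rho> has_real_derivative inverse (sqrt (t\<^sup>2 + s\<^sup>2)) / 2 * (2 * s)) (at s)"
        unfolding \<rho>_def by (rule DERIV_chain2[OF DERIV_real_sqrt[OF pos] i])
      moreover have "inverse (sqrt (t\<^sup>2 + s\<^sup>2)) / 2 * (2 * s) = s / \<rho> s"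
        by (simp add: \<rho>_def field_simps)
      ultimately show ?thesis by (simp only: )
    qed
    define U where "U = {s. \<rho> s < 1}"
    have "continuous_on UNIV \<rho>" unfolding \<rho>_def by (intro continuous_intros)
    then have U: "open U" unfolding U_def by (intro open_Collect_less continuous_intros) auto
    have \<rho>t: "\<rho> 0 = t" using t by (simp add: \<rho>_def)
    have U0: "0 \<in> U" using t by (simp add: U_def \<rho>t)
    have d2u: "frechet_derivative u (at (t *\<^sub>R e1 + s *\<^sub>R e2)) e2 = w1 (\<rho> s) * (s / \<rho> s)" if s: "s \<in> U" for s
    proof (rule DERIV_unique)
      have "t *\<^sub>R e1 + s *\<^sub>R e2 \<in> disc" using s n[of s] by (simp add: U_def)
      then show "((\<lambda>s. u (t *\<^sub>R e1 + s *\<^sub>R e2)) has_real_derivative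
          frechet_derivative u (at (t *\<^sub>R e1 + s *\<^sub>R e2)) e2) (at s)"
        by (intro has_real_derivative_along_line d1)
      have "((\<lambda>s. w (\<rho> s)) has_real_derivative w1 (\<rho> s) * (s / \<rho> s)) (at s)"
        using s \<rho>0[of s] by (intro DERIV_chain2[OF w' \<rho>']) (simp add: U_def)
      then show "((\<lambda>s. u (t *\<^sub>R e1 + s *\<^sub>R e2)) has_real_derivative w1 (\<rho> s) * (s / \<rho> s)) (at s)"
      proof (rule has_field_derivative_transform_within_open[OF _ U s])
        fix s assume "s \<in> U"
        then show "w (\<rho> s) = u (t *\<^sub>R e1 + s *\<^sub>R e2)"
          using u_w[of "t *\<^sub>R e1 + s *\<^sub>R e2"] n[of s] by (simp add: U_def)
      qed
    qed
    show ?thesis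
    proof (rule DERIV_unique)
      show "((\<lambda>s. frechet_derivative u (at (t *\<^sub>R e1 + s *\<^sub>R e2)) e2) has_real_derivative
          frechet_derivative (\<lambda>y. frechet_derivative u (at y) e2) (at (t *\<^sub>R e1)) e2) (at 0)"
        using has_real_derivative_along_line[of "\<lambda>y. frechet_derivative u (at y) e2" "t *\<^sub>R e1" 0 e2]
          d2[of "t *\<^sub>R e1" e2] in_disc[of t] t by simp
      have "((\<lambda>s. w1 (\<rho> s)) has_real_derivative w2 t * (0 / \<rho> 0)) (at 0)"
      proof -
        have "(w1 has_real_derivative w2 t) (at (\<rho> 0))" unfolding \<rho>t using w1'[of t] t by simp
        then show ?thesis using \<rho>'[of 0] by (rule DERIV_chain2)
      qed
      moreover have "((\<lambda>s. s / \<rho> s) has_real_derivative (1 * \<rho> 0 - 0 * (0 / \<rho> 0)) / (\<rho> 0 * \<rho> 0)) (at 0)"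
        using \<rho>0[of 0] by (intro DERIV_divide \<rho>' DERIV_ident) auto
      ultimately have "((\<lambda>s. w1 (\<rho> s) * (s / \<rho> s)) has_real_derivative
          w2 t * (0 / \<rho> 0) * (0 / \<rho> 0) + (1 * \<rho> 0 - 0 * (0 / \<rho> 0)) / (\<rho> 0 * \<rho> 0) * w1 (\<rho> 0)) (at 0)"
        by (rule DERIV_mult)
      then have "((\<lambda>s. w1 (\<rho> s) * (s / \<rho> s)) has_real_derivative w1 t / t) (at 0)"
        using t by (simp add: \<rho>t)
      then show "((\<lambda>s. frechet_derivative u (at (t *\<^sub>R e1 + s *\<^sub>R e2)) e2) has_real_derivative w1 t / t) (at 0)"
        by (rule has_field_derivative_transform_within_open[OF _ U U0]) (use d2u in auto)
    qed
  qed
  have ode: "w2 t = - g (w t) - w1 t / t" if t: "0 < t" "t < 1" for t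
    using eq[OF in_disc, of t] lap2[OF t] t unfolding laplacian_eq w2_def w_def profile_def by simp
  define p where "p = (\<lambda>t. - t * deriv w t)"
  have p_eq: "p t = - t * w1 t" if "\<bar>t\<bar> < 1" for t using deriv_w[OF that] by (simp add: p_def)
  have p': "(p has_real_derivative t * g (w t)) (at t)" if t: "0 < t" "t < 1" for t
  proof -
    have "((\<lambda>t. - t * w1 t) has_real_derivative - 1 * w1 t + w2 t * - t) (at t)"
      using t by (intro DERIV_mult w1' DERIV_minus DERIV_ident) auto
    moreover have "- 1 * w1 t + w2 t * - t = t * g (w t)"
      unfolding ode[OF t] using t by (simp add: algebra_simps)
    ultimately have "((\<lambda>t. - t * w1 t) has_real_derivative t * g (w t)) (at t)" by simp
    then show ?thesis
      by (rule has_field_derivative_transform_within_open[where S = "{0<..<1}"]) (use t p_eq in auto)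
  qed
  have p_cont: "continuous_on {0..<1} p"
  proof -
    have "continuous_on {0..<1} w1"
      by (rule DERIV_continuous_on[where D = w2], rule has_field_derivative_at_within, rule w1') auto
    then have "continuous_on {0..<1} (\<lambda>t. - t * w1 t)" by (intro continuous_intros)
    then show ?thesis by (rule continuous_on_eq) (use p_eq in auto)
  qed
  have w_cont: "continuous_on {0..1} w"
    unfolding w_def profile_def[abs_def]
    by (rule continuous_on_compose2[OF uc]) (auto intro!: continuous_intros)
  have "radial_ode g w p"
    unfolding radial_ode_def
  proof (intro conjI ballI)
    show "p 0 = 0" by (simp add: p_def)
    fix t :: real assume t: "t \<in> {0<..<1}"
    show "(w has_real_derivative - p t / t) (at t)" 
    proof -
      have "p t = - t * w1 t" using p_eq[of t] t by simp
      then have "- p t / t = w1 t" using t by simp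
      then show ?thesis using w'[of t] t by simp
    qed
    show "(p has_real_derivative t * g (w t)) (at t)" using p' t by simp
  qed (use w_cont p_cont in auto)
  then show "radial_ode g (profile u) (\<lambda>t. - t * deriv (profile u) t)" by (simp add: w_def p_def[abs_def])
  show "profile u 1 = 0" using bd[of e1] by (simp add: profile_def)
qed

lemma radial_ode_scale:
  assumes ode: "radial_ode g w p" and c: "0 < c" "c \<le> 1"
  shows "radial_ode (\<lambda>s. c\<^sup>2 * g s) (\<lambda>t. w (c * t)) (\<lambda>t. p (c * t))"
  unfolding radial_ode_def
proof (intro conjI ballI)
  have ct: "c * t \<le> 1" if "t \<le> 1" "0 \<le> t" for t using that c mult_mono[of c 1 t 1] by simp
  have ct1: "c * t < 1" if "t < 1" "0 \<le> t" for t
    using that c mult_right_mono[of c 1 t] by simp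
  have wc: "continuous_on {0..1} w" and pc: "continuous_on {0..<1} p" using ode by (auto simp: radial_ode_def)
  show "continuous_on {0..1} (\<lambda>t. w (c * t))"
    using c ct by (intro continuous_on_compose2[OF wc] continuous_intros) auto
  show "continuous_on {0..<1} (\<lambda>t. p (c * t))"
    using c ct1 by (intro continuous_on_compose2[OF pc] continuous_intros) auto
  show "p (c * 0) = 0" using ode by (simp add: radial_ode_def)
  fix t :: real assume t: "t \<in> {0<..<1}"
  have cd: "((\<lambda>t. c * t) has_real_derivative c) (at t)" by (auto intro!: derivative_eq_intros)
  have D: "(w has_real_derivative - p (c * t) / (c * t)) (at (c * t))"
    "(p has_real_derivative c * t * g (w (c * t))) (at (c * t))"
    using ode c t ct1[of t] by (auto simp: radial_ode_def)
  show "((\<lambda>t. w (c * t)) has_real_derivative - p (c * t) / t) (at t)"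
    using DERIV_chain2[OF D(1) cd] c by simp
  show "((\<lambda>t. p (c * t)) has_real_derivative t * (c\<^sup>2 * g (w (c * t)))) (at t)"
    using DERIV_chain2[OF D(2) cd] by (simp add: power2_eq_square mult_ac)
qed

text \<open>Stated for the maximum of \<open>\<bar>f\<bar>\<close>, so that positive maxima and negative minima need no
  separate treatment.\<close>
lemma second_derivative_at_abs_max:
  fixes f f1 :: "real \<Rightarrow> real"
  assumes f: "\<And>s. \<bar>s\<bar> < d \<Longrightarrow> (f has_real_derivative f1 s) (at s)" and d: "0 < d"
    and f1: "(f1 has_real_derivative c) (at 0)"
    and mx: "\<And>s. \<bar>s\<bar> < d \<Longrightarrow> \<bar>f s\<bar> \<le> \<bar>f 0\<bar>"
  shows "f 0 * c \<le> 0"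
proof (rule ccontr)
  assume "\<not> f 0 * c \<le> 0"
  then have neq: "f 0 \<noteq> 0" and pos: "0 < f 0 * c" by auto
  define \<sigma> where "\<sigma> = sgn (f 0)"
  have \<sigma>: "\<sigma> * f 0 = \<bar>f 0\<bar>" "\<bar>\<sigma>\<bar> = 1" using neq by (auto simp: \<sigma>_def sgn_if)
  have sc: "0 < \<sigma> * c"
  proof (cases "0 < f 0")
    case True
    then show ?thesis using zero_less_mult_pos[OF pos True] by (simp add: \<sigma>_def)
  next
    case False
    then have "f 0 < 0" using neq by simp
    then show ?thesis using pos by (simp add: \<sigma>_def zero_less_mult_iff)
  qed
  have mx': "\<sigma> * f s \<le> \<sigma> * f 0" if "\<bar>s\<bar> < d" for s
  proof -
    have "\<sigma> * f s \<le> \<bar>\<sigma> * f s\<bar>" by simp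
    also have "\<dots> \<le> \<bar>f 0\<bar>" using mx[OF that] \<sigma> by (simp add: abs_mult)
    finally show ?thesis using \<sigma> by simp
  qed
  have D: "((\<lambda>s. \<sigma> * f s) has_real_derivative \<sigma> * f1 s) (at s)" if "\<bar>s\<bar> < d" for s
    using f[OF that] by (rule DERIV_cmult)
  have D0: "((\<lambda>s. \<sigma> * f s) has_real_derivative \<sigma> * f1 0) (at 0)" using D[of 0] d by simp
  have "\<forall>y. \<bar>0 - y\<bar> < d \<longrightarrow> \<sigma> * f y \<le> \<sigma> * f 0" using mx' by simp
  then have "\<sigma> * f1 0 = 0" by (rule DERIV_local_max[OF D0 d])
  moreover have "((\<lambda>s. \<sigma> * f1 s) has_real_derivative \<sigma> * c) (at 0)" using f1 by (rule DERIV_cmult)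
  then obtain d' where d': "0 < d'" "\<And>h. 0 < h \<Longrightarrow> h < d' \<Longrightarrow> \<sigma> * f1 0 < \<sigma> * f1 (0 + h)"
    using DERIV_pos_inc_right[of "\<lambda>s. \<sigma> * f1 s" "\<sigma> * c" 0] sc by auto
  define b where "b = min d d' / 2"
  have b: "0 < b" "b < d" "b < d'" using d d' by (auto simp: b_def)
  have "\<sigma> * f 0 < \<sigma> * f b"
  proof (rule DERIV_pos_imp_increasing_open[OF b(1)])
    fix x assume x: "0 < x" "x < b"
    show "\<exists>y. ((\<lambda>s. \<sigma> * f s) has_real_derivative y) (at x) \<and> 0 < y"
      using D[of x] d'(2)[of x] x b \<open>\<sigma> * f1 0 = 0\<close> by (intro exI[of _ "\<sigma> * f1 x"]) auto
  next
    show "continuous_on {0..b} (\<lambda>s. \<sigma> * f s)"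
      by (rule DERIV_continuous_on[where D = "\<lambda>s. \<sigma> * f1 s"], rule has_field_derivative_at_within, rule D)
        (use b in auto)
  qed
  then show False using mx'[of b] b by simp
qed

text \<open>At an interior maximum of \<open>\<bar>u\<bar>\<close> the product \<open>u \<Delta>u\<close> is nonpositive.  The bound makes the set of
  eigenvalues bounded below, so that its infimum \<open>lambda1\<close> is at most every eigenvalue.\<close>
lemma dirichlet_eigenvalue_nonneg:
  assumes "dirichlet_eigenvalue \<mu>"
  shows "0 \<le> \<mu>"
proof -
  obtain u x1 where sol: "dirichlet_solution (\<lambda>s. \<mu> * s) u" and x1: "x1 \<in> disc" "u x1 \<noteq> 0"
    using assms by (auto simp: dirichlet_eigenvalue_def)
  have C2: "Ck_on 2 u disc" and uc: "continuous_on (cball 0 1) u"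
    and eq: "\<And>x. x \<in> disc \<Longrightarrow> - laplacian u x = \<mu> * u x" and bd: "\<And>x. x \<in> sphere 0 1 \<Longrightarrow> u x = 0"
    using sol by (auto simp: dirichlet_solution_def)
  have "\<exists>x\<in>cball 0 1. \<forall>y\<in>cball 0 1. \<bar>u y\<bar> \<le> \<bar>u x\<bar>"
    using uc by (intro continuous_attains_sup) (auto intro!: continuous_intros)
  then obtain x0 where x0: "x0 \<in> cball 0 1" "\<And>y. y \<in> cball 0 1 \<Longrightarrow> \<bar>u y\<bar> \<le> \<bar>u x0\<bar>" by blast
  have ne: "u x0 \<noteq> 0" using x0(2)[of x1] x1 by auto
  have x0d: "x0 \<in> disc" using bd[of x0] ne x0(1) by (auto simp: order_less_le)
  then have n0: "norm x0 < 1" by simp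
  have "u x0 * frechet_derivative (\<lambda>y. frechet_derivative u (at y) e) (at x0) e \<le> 0"
    if e: "norm e = 1" for e :: plane
  proof -
    have ins: "x0 + s *\<^sub>R e \<in> disc" if "\<bar>s\<bar> < 1 - norm x0" for s
      using norm_triangle_ineq[of x0 "s *\<^sub>R e"] that e by simp
    have "u (x0 + 0 *\<^sub>R e) * frechet_derivative (\<lambda>y. frechet_derivative u (at y) e) (at x0) e \<le> 0"
    proof (rule second_derivative_at_abs_max[where f = "\<lambda>s. u (x0 + s *\<^sub>R e)" and d = "1 - norm x0"])
      show "((\<lambda>s. u (x0 + s *\<^sub>R e)) has_real_derivative frechet_derivative u (at (x0 + s *\<^sub>R e)) e) (at s)"
        if "\<bar>s\<bar> < 1 - norm x0" for s
        using C2 ins[OF that] by (intro has_real_derivative_along_line) (simp add: Ck_2_iff)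
      show "((\<lambda>s. frechet_derivative u (at (x0 + s *\<^sub>R e)) e) has_real_derivative
          frechet_derivative (\<lambda>y. frechet_derivative u (at y) e) (at x0) e) (at 0)"
        using has_real_derivative_along_line[of "\<lambda>y. frechet_derivative u (at y) e" x0 0 e] C2 x0d
        by (simp add: Ck_2_iff)
      show "\<bar>u (x0 + s *\<^sub>R e)\<bar> \<le> \<bar>u (x0 + 0 *\<^sub>R e)\<bar>" if "\<bar>s\<bar> < 1 - norm x0" for s
        using x0(2)[of "x0 + s *\<^sub>R e"] ins[OF that] by simp
    qed (use n0 in auto)
    then show ?thesis by simp
  qed
  from this[of e1] this[of e2] have "u x0 * laplacian u x0 \<le> 0"
    unfolding laplacian_eq by (simp add: distrib_left)
  moreover have "laplacian u x0 = - (\<mu> * u x0)" using eq[OF x0d] by linarith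
  ultimately have "0 \<le> \<mu> * (u x0 * u x0)" by (simp add: mult.left_commute)
  moreover have "0 < u x0 * u x0" using ne not_real_square_gt_zero[of "u x0"] by blast
  ultimately show ?thesis by (simp add: zero_le_mult_iff)
qed

lemma lambda1_le: "dirichlet_eigenvalue \<mu> \<Longrightarrow> lambda1 \<le> \<mu>"
  unfolding lambda1_def
  by (rule cInf_lower) (auto intro!: bdd_belowI[of _ 0] dirichlet_eigenvalue_nonneg)

text \<open>With \<open>a(r) = Q(r) / r\<^sup>2\<close> the gradient of \<open>V(\<bar>x\<bar>)\<close> is \<open>- a(\<bar>x\<bar>) x\<close> and the second derivative is \<open>B\<close> below.
  Regularity at the origin comes from \<open>a(r)\<close> tending to \<open>G(V 0) / 2\<close>: the singular part of \<open>B\<close> carries the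
  factor \<open>G(V) - 2 a\<close>, which vanishes there.\<close>
lemma ode_imp_radial_solution:
  assumes ode: "radial_ode G V Q" and G: "continuous_on UNIV G" and V1: "V 1 = 0"
  shows "dirichlet_solution G (\<lambda>x. V (norm x))"
proof -
  have V_cont: "continuous_on {0..1} V" and Q_cont: "continuous_on {0..<1} Q" and Q0: "Q 0 = 0"
    and V': "\<And>t. 0 < t \<Longrightarrow> t < 1 \<Longrightarrow> (V has_real_derivative - Q t / t) (at t)"
    and Q': "\<And>t. 0 < t \<Longrightarrow> t < 1 \<Longrightarrow> (Q has_real_derivative t * G (V t)) (at t)"
    using ode by (auto simp: radial_ode_def)
  have GV_cont: "continuous_on {0..1} (\<lambda>s. G (V s))"
    using G V_cont by (rule continuous_on_compose2) auto
  define G0 where "G0 = G (V 0)"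
  have Q_near: "\<exists>\<delta>>0. \<delta> \<le> 1 \<and> (\<forall>r. 0 \<le> r \<longrightarrow> r < \<delta> \<longrightarrow> \<bar>Q r - G0 / 2 * r\<^sup>2\<bar> \<le> \<eta> * r\<^sup>2)" if \<eta>: "0 < \<eta>" for \<eta>
  proof -
    obtain \<delta>0 where \<delta>0: "0 < \<delta>0" "\<And>s. s \<in> {0..1} \<Longrightarrow> dist s 0 < \<delta>0 \<Longrightarrow> dist (G (V s)) (G (V 0)) < \<eta>"
    proof -
      have "0 \<in> {0..1::real}" by simp
      then show thesis using GV_cont \<eta> that unfolding continuous_on_iff by blast
    qed
    define \<delta> where "\<delta> = min 1 \<delta>0"
    have "\<bar>Q r - G0 / 2 * r\<^sup>2\<bar> \<le> \<eta> * r\<^sup>2" if r: "0 \<le> r" "r < \<delta>" for r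
    proof -
      have r1: "r < 1" "r < \<delta>0" using r by (auto simp: \<delta>_def)
      have "\<bar>(Q r - G0 / 2 * r\<^sup>2) - (Q 0 - G0 / 2 * 0\<^sup>2)\<bar> \<le> \<eta> * r * (r - 0)"
      proof (rule lipschitz_by_deriv[where \<phi> = "\<lambda>r. Q r - G0 / 2 * r\<^sup>2" and \<phi>' = "\<lambda>s. s * G (V s) - G0 * s"])
        have "continuous_on {0..r} Q" by (rule continuous_on_subset[OF Q_cont]) (use r1 in auto)
        then show "continuous_on {0..r} (\<lambda>r. Q r - G0 / 2 * r\<^sup>2)" by (intro continuous_intros)
        fix s assume s: "0 < s" "s < r"
        show "((\<lambda>r. Q r - G0 / 2 * r\<^sup>2) has_real_derivative s * G (V s) - G0 * s) (at s)"
          using Q'[of s] s r1 by (auto intro!: derivative_eq_intros)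
        have "\<bar>G (V s) - G0\<bar> \<le> \<eta>" using \<delta>0(2)[of s] s r1 by (simp add: dist_norm G0_def)
        then have "\<bar>s\<bar> * \<bar>G (V s) - G0\<bar> \<le> r * \<eta>" using s by (intro mult_mono) auto
        moreover have "s * G (V s) - G0 * s = s * (G (V s) - G0)" by (simp add: algebra_simps)
        ultimately show "\<bar>s * G (V s) - G0 * s\<bar> \<le> \<eta> * r" by (simp add: abs_mult mult.commute)
      qed (use r in auto)
      then show ?thesis by (simp add: Q0 power2_eq_square)
    qed
    then show ?thesis using \<delta>0(1) by (intro exI[of _ \<delta>]) (auto simp: \<delta>_def)
  qed
  \<comment> \<open>The value at zero is the limit of \<open>Q(r) / r\<^sup>2\<close>.\<close>
  define a where "a = (\<lambda>r. if r = 0 then G0 / 2 else Q r / r\<^sup>2)"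
  have a_eq: "a r = Q r / r\<^sup>2" if "0 < r" for r using that by (simp add: a_def)
  have a_cont: "continuous_on {0..<1} a"
    unfolding continuous_on_eq_continuous_within
  proof
    fix r :: real assume r: "r \<in> {0..<1}"
    show "continuous (at r within {0..<1}) a"
    proof (cases "r = 0")
      case True
      show ?thesis unfolding True continuous_within_eps_delta
      proof (intro allI impI)
        fix e :: real assume e: "0 < e"
        obtain \<delta> where \<delta>: "0 < \<delta>" "\<forall>r. 0 \<le> r \<longrightarrow> r < \<delta> \<longrightarrow> \<bar>Q r - G0 / 2 * r\<^sup>2\<bar> \<le> e / 2 * r\<^sup>2"
          using Q_near[of "e / 2"] e by auto
        have "dist (a x) (a 0) < e" if x: "x \<in> {0..<1}" "dist x 0 < \<delta>" for x
        proof (cases "x = 0")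
          case False
          then have x0: "0 < x" using x by simp
          have "a x - a 0 = (Q x - G0 / 2 * x\<^sup>2) / x\<^sup>2"
            using x0 by (simp add: a_def field_simps)
          then have "\<bar>a x - a 0\<bar> = \<bar>Q x - G0 / 2 * x\<^sup>2\<bar> / x\<^sup>2" by simp
          also have "\<dots> \<le> (e / 2 * x\<^sup>2) / x\<^sup>2" using \<delta>(2) x by (intro divide_right_mono) auto
          also have "\<dots> = e / 2" using x0 by simp
          finally show ?thesis using e by (simp add: dist_norm)
        qed (use e in simp)
        then show "\<exists>d>0. \<forall>x'\<in>{0..<1}. dist x' 0 < d \<longrightarrow> dist (a x') (a 0) < e" using \<delta>(1) by blast
      qed
    next
      case False
      then have r0: "0 < r" "r < 1" using r by auto
      have "isCont Q r" using Q'[OF r0] by (rule DERIV_isCont)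
      then have "isCont (\<lambda>r. Q r / r\<^sup>2) r" using r0 by (intro continuous_intros) auto
      moreover have ev: "\<forall>\<^sub>F s in nhds r. a s = Q s / s\<^sup>2"
        using eventually_nhds_in_open[of "{0<..}" r] r0 by (auto elim!: eventually_mono simp: a_eq)
      ultimately have "isCont a r" using isCont_cong[OF ev] by blast
      then show ?thesis by (rule continuous_at_imp_continuous_at_within)
    qed
  qed
  define A where "A = (\<lambda>x::plane. a (norm x))"
  define u where "u = (\<lambda>x::plane. V (norm x))"
  have A_cont: "continuous_on disc A" unfolding A_def
    by (rule continuous_on_compose2[OF a_cont]) (auto intro!: continuous_intros)
  have u_cont: "continuous_on (cball 0 1) u" unfolding u_def
    by (rule continuous_on_compose2[OF V_cont]) (auto intro!: continuous_intros)
  have norm': "(norm has_derivative (\<lambda>h. h \<bullet> x / norm x)) (at x)" if "x \<noteq> 0" for x :: plane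
    using has_derivative_norm[OF that] by (simp add: sgn_div_norm inner_commute divide_inverse mult.commute)
  have u': "(u has_derivative (\<lambda>h. - (A x * (x \<bullet> h)))) (at x)" if x: "x \<in> disc" for x
  proof (cases "x = 0")
    case False
    then have r: "0 < norm x" "norm x < 1" using x by auto
    have "(V has_derivative (\<lambda>k. - Q (norm x) / norm x * k)) (at (norm x))"
      using V'[OF r] by (simp only: has_field_derivative_def)
    from has_derivative_compose[OF norm'[OF False] this]
    have "(u has_derivative (\<lambda>h. - Q (norm x) / norm x * (h \<bullet> x / norm x))) (at x)" unfolding u_def .
    moreover have "(\<lambda>h. - Q (norm x) / norm x * (h \<bullet> x / norm x)) = (\<lambda>h. - (A x * (x \<bullet> h)))"
      using r by (auto simp: A_def a_eq power2_eq_square inner_commute)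
    ultimately show ?thesis by simp
  next
    case True
    obtain \<delta> where \<delta>: "0 < \<delta>" "\<delta> \<le> 1" "\<forall>r. 0 \<le> r \<longrightarrow> r < \<delta> \<longrightarrow> \<bar>Q r - G0 / 2 * r\<^sup>2\<bar> \<le> 1 * r\<^sup>2"
      using Q_near[of 1] by auto
    define K where "K = \<bar>G0\<bar> / 2 + 1"
    have QK: "\<bar>Q r\<bar> \<le> K * r\<^sup>2" if "0 \<le> r" "r < \<delta>" for r
    proof -
      have "\<bar>Q r - G0 / 2 * r\<^sup>2\<bar> \<le> 1 * r\<^sup>2" using \<delta>(3) that by blast
      moreover have "\<bar>G0 / 2 * r\<^sup>2\<bar> = \<bar>G0\<bar> / 2 * r\<^sup>2" by (simp add: abs_mult)
      ultimately show ?thesis unfolding K_def distrib_right by linarith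
    qed
    have VK: "\<bar>V r - V 0\<bar> \<le> K * r * r" if r: "0 \<le> r" "r < \<delta>" for r
    proof -
      have "\<bar>V r - V 0\<bar> \<le> K * r * (r - 0)"
      proof (rule lipschitz_by_deriv[where \<phi>' = "\<lambda>s. - Q s / s"])
        show "continuous_on {0..r} V" by (rule continuous_on_subset[OF V_cont]) (use r \<delta> in auto)
        fix s assume s: "0 < s" "s < r"
        show "(V has_real_derivative - Q s / s) (at s)" using V'[of s] s r \<delta> by simp
        have "\<bar>- Q s / s\<bar> = \<bar>Q s\<bar> / s" using s by simp
        also have "\<dots> \<le> K * s\<^sup>2 / s" using QK[of s] s r by (intro divide_right_mono) auto
        also have "\<dots> = K * s" using s by (simp add: power2_eq_square)
        also have "\<dots> \<le> K * r" using s by (intro mult_left_mono) (auto simp: K_def)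
        finally show "\<bar>- Q s / s\<bar> \<le> K * r" .
      qed (use r in auto)
      then show ?thesis by simp
    qed
    have "(u has_derivative (\<lambda>h. 0)) (at 0)"
    proof (rule has_derivativeI_sandwich[OF \<delta>(1), where H = "\<lambda>y. K * norm y"])
      show "norm (u y - u 0 - 0) / norm (y - 0) \<le> K * norm y" if "y \<noteq> 0" "dist y 0 < \<delta>" for y
        using VK[of "norm y"] that by (simp add: u_def divide_le_eq)
      have "((\<lambda>y::plane. K * norm y) \<longlongrightarrow> K * norm (0::plane)) (at 0)" by (intro tendsto_intros)
      then show "((\<lambda>y::plane. K * norm y) \<longlongrightarrow> 0) (at 0)" by simp
    qed auto
    then show ?thesis using True by simp
  qed
  define E where "E = (\<lambda>x. G (u x) - 2 * A x)"
  \<comment> \<open>At \<open>x = 0\<close> the second summand is zero, so the formula is valid at the origin too.\<close>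
  define B where "B = (\<lambda>x v h. - (A x * (h \<bullet> v)) - E x * (x \<bullet> v) * (x \<bullet> h) / (norm x)\<^sup>2)"
  have u'': "((\<lambda>x. - (A x * (x \<bullet> v))) has_derivative B x v) (at x)" if x: "x \<in> disc" for x v
  proof (cases "x = 0")
    case False
    define r where "r = norm x"
    have r: "0 < r" "r < 1" using x False by (auto simp: r_def)
    have "((\<lambda>r. Q r / r\<^sup>2) has_real_derivative (r * G (V r) * r\<^sup>2 - Q r * (2 * r)) / (r\<^sup>2 * r\<^sup>2)) (at r)"
      using r Q'[OF r] by (auto intro!: derivative_eq_intros)
    moreover have "(r * G (V r) * r\<^sup>2 - Q r * (2 * r)) / (r\<^sup>2 * r\<^sup>2) = E x / r"
    proof -
      have "E x = G (V r) - 2 * (Q r / r\<^sup>2)" using r by (simp add: E_def A_def u_def a_eq r_def[symmetric])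
      then show ?thesis using r by (simp only: ) (simp add: field_simps power2_eq_square)
    qed
    ultimately have "((\<lambda>r. Q r / r\<^sup>2) has_real_derivative E x / r) (at r)" by simp
    then have "(a has_real_derivative E x / r) (at r)"
      by (rule has_field_derivative_transform_within_open[where S = "{0<..}"]) (use r a_eq in auto)
    then have "(a has_derivative (\<lambda>k. E x / r * k)) (at (norm x))"
      unfolding r_def by (simp only: has_field_derivative_def)
    from has_derivative_compose[OF norm'[OF False] this]
    have A': "(A has_derivative (\<lambda>h. E x / r * (h \<bullet> x / norm x))) (at x)" unfolding A_def .
    have I: "((\<lambda>x. x \<bullet> v) has_derivative (\<lambda>h. h \<bullet> v)) (at x)"
      by (rule has_derivative_inner_left) (rule has_derivative_ident)
    have "((\<lambda>x. - (A x * (x \<bullet> v))) has_derivative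
        (\<lambda>h. - (A x * (h \<bullet> v) + E x / r * (h \<bullet> x / norm x) * (x \<bullet> v)))) (at x)"
      by (intro has_derivative_minus has_derivative_mult A' I)
    moreover have "(\<lambda>h. - (A x * (h \<bullet> v) + E x / r * (h \<bullet> x / norm x) * (x \<bullet> v))) = B x v"
      using r by (auto simp: B_def r_def power2_eq_square inner_commute mult_ac)
    ultimately show ?thesis by simp
  next
    case True
    have "((\<lambda>x. - (A x * (x \<bullet> v))) has_derivative (\<lambda>h. - (A 0 * (h \<bullet> v)))) (at 0)"
    proof (rule has_derivativeI_sandwich[OF zero_less_one, where H = "\<lambda>y. \<bar>A y - A 0\<bar> * norm v"])
      show "bounded_linear (\<lambda>h. - (A 0 * (h \<bullet> v)))"
        by (intro bounded_linear_minus bounded_linear_const_mult bounded_linear_inner_left)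
      show "norm (- (A y * (y \<bullet> v)) - - (A 0 * (0 \<bullet> v)) - - (A 0 * ((y - 0) \<bullet> v))) / norm (y - 0)
          \<le> \<bar>A y - A 0\<bar> * norm v" if "y \<noteq> 0" for y
      proof -
        have "- (A y * (y \<bullet> v)) - - (A 0 * (0 \<bullet> v)) - - (A 0 * ((y - 0) \<bullet> v)) = - ((A y - A 0) * (y \<bullet> v))"
          by (simp add: algebra_simps)
        moreover have "\<bar>A y - A 0\<bar> * \<bar>y \<bullet> v\<bar> \<le> \<bar>A y - A 0\<bar> * (norm y * norm v)"
          by (intro mult_left_mono Cauchy_Schwarz_ineq2) auto
        ultimately show ?thesis using that by (simp add: divide_le_eq abs_mult mult_ac)
      qed
      have "isCont A 0" using A_cont continuous_on_eq_continuous_at[of disc A] by auto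
      then have "((\<lambda>y. \<bar>A y - A 0\<bar> * norm v) \<longlongrightarrow> \<bar>A 0 - A 0\<bar> * norm v) (at 0)"
        unfolding isCont_def by (intro tendsto_intros)
      then show "((\<lambda>y. \<bar>A y - A 0\<bar> * norm v) \<longlongrightarrow> 0) (at 0)" by simp
    qed
    then show ?thesis using True by (simp add: B_def)
  qed
  have fu: "frechet_derivative u (at x) v = - (A x * (x \<bullet> v))" if "x \<in> disc" for x v
    using frechet_derivative_at[OF u'[OF that]] by metis
  have d2: "((\<lambda>y. frechet_derivative u (at y) v) has_derivative B x v) (at x)" if "x \<in> disc" for x v
    by (rule has_derivative_transform_within_open[OF u''[OF that] open_ball that]) (simp add: fu)
  have fuu: "frechet_derivative (\<lambda>y. frechet_derivative u (at y) v) (at x) h = B x v h" if "x \<in> disc" for x v h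
    using frechet_derivative_at[OF d2[OF that]] by metis
  have E_cont: "continuous_on disc E"
  proof -
    have "continuous_on disc u" by (rule continuous_on_subset[OF u_cont]) auto
    then have "continuous_on disc (\<lambda>x. G (u x))" by (intro continuous_on_compose2[OF G]) auto
    then show ?thesis unfolding E_def using A_cont by (intro continuous_intros)
  qed
  have E0: "E 0 = 0" by (simp add: E_def A_def a_def u_def G0_def)
  have T_cont: "continuous_on disc (\<lambda>x. E x * (x \<bullet> v) * (x \<bullet> h) / (norm x)\<^sup>2)" for v h
    unfolding continuous_on_eq_continuous_at[OF open_ball]
  proof
    fix x :: plane assume x: "x \<in> disc"
    let ?T = "\<lambda>x. E x * (x \<bullet> v) * (x \<bullet> h) / (norm x)\<^sup>2"
    have Ex: "isCont E x" using E_cont x continuous_on_eq_continuous_at[of disc E] by auto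
    show "isCont ?T x"
    proof (cases "x = 0")
      case False
      then show ?thesis using Ex by (intro continuous_intros) auto
    next
      case True
      have "(?T \<longlongrightarrow> 0) (at 0)"
      proof (rule Lim_null_comparison)
        have "((\<lambda>x. \<bar>E x\<bar> * (norm v * norm h)) \<longlongrightarrow> \<bar>E 0\<bar> * (norm v * norm h)) (at 0)"
          using Ex unfolding isCont_def True by (intro tendsto_intros)
        then show "((\<lambda>x. \<bar>E x\<bar> * (norm v * norm h)) \<longlongrightarrow> 0) (at 0)" by (simp add: E0)
        have "norm (?T y) \<le> \<bar>E y\<bar> * (norm v * norm h)" for y
        proof (cases "y = 0")
          case False
          have "\<bar>y \<bullet> v\<bar> * \<bar>y \<bullet> h\<bar> \<le> (norm y * norm v) * (norm y * norm h)"
            by (intro mult_mono Cauchy_Schwarz_ineq2) auto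
          then have "\<bar>E y\<bar> * (\<bar>y \<bullet> v\<bar> * \<bar>y \<bullet> h\<bar>) \<le> \<bar>E y\<bar> * ((norm y * norm v) * (norm y * norm h))"
            by (intro mult_left_mono) auto
          then show ?thesis using False by (simp add: abs_mult divide_le_eq power2_eq_square mult_ac)
        qed simp
        then show "\<forall>\<^sub>F y in at 0. norm (?T y) \<le> \<bar>E y\<bar> * (norm v * norm h)" by simp
      qed
      then show ?thesis unfolding isCont_def True by simp
    qed
  qed
  have B_cont: "continuous_on disc (\<lambda>x. B x v h)" for v h
    unfolding B_def by (rule continuous_on_diff[OF _ T_cont]) (intro continuous_intros A_cont)
  have "Ck_on 2 u disc" unfolding Ck_2_iff
  proof (intro conjI ballI allI)
    show "u differentiable (at x)" if "x \<in> disc" for x using u'[OF that] by (rule differentiableI)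
    show "(\<lambda>x. frechet_derivative u (at x) v) differentiable (at x)" if "x \<in> disc" for x v
      using d2[OF that] by (rule differentiableI)
    show "continuous_on disc (\<lambda>x. frechet_derivative (\<lambda>x. frechet_derivative u (at x) v) (at x) v')" for v v'
      by (rule continuous_on_eq[OF B_cont[of v v']]) (simp add: fuu)
  qed
  moreover have "- laplacian u x = G (u x)" if x: "x \<in> disc" for x
  proof -
    have xi: "x \<bullet> e1 = x $ 1" "x \<bullet> e2 = x $ 2" by (simp_all add: inner_axis)
    have ee: "e1 \<bullet> e1 = 1" "e2 \<bullet> e2 = 1" by (simp_all add: inner_axis)
    have "laplacian u x = B x e1 e1 + B x e2 e2" unfolding laplacian_eq fuu[OF x] ..
    also have "\<dots> = - (2 * A x) - E x * ((x $ 1)\<^sup>2 + (x $ 2)\<^sup>2) / (norm x)\<^sup>2"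
      unfolding B_def xi ee by (simp add: power2_eq_square add_divide_distrib distrib_left)
    also have "(x $ 1)\<^sup>2 + (x $ 2)\<^sup>2 = (norm x)\<^sup>2"
      by (simp add: norm_vec_def L2_set_def sum_2)
    also have "- (2 * A x) - E x * (norm x)\<^sup>2 / (norm x)\<^sup>2 = - G (u x)"
    proof (cases "x = 0")
      case True
      then show ?thesis using E0 unfolding E_def by simp
    next
      case False
      then show ?thesis unfolding E_def by simp
    qed
    finally show ?thesis by simp
  qed
  moreover have "u x = 0" if "x \<in> sphere 0 1" for x using that V1 by (simp add: u_def)
  ultimately have "dirichlet_solution G u" unfolding dirichlet_solution_def using u_cont by blast
  then show ?thesis unfolding u_def .
qed

section \<open>Energy and Pohozaev estimates\<close>

lemma odd_antiderivative:
  fixes g :: "real \<Rightarrow> real"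
  assumes "continuous_on UNIV g" "\<And>y. g (- y) = - g y"
  obtains F where "\<And>y. (F has_real_derivative g y) (at y)" "F 0 = 0" "\<And>y. F (- y) = F y"
proof -
  have "\<exists>F. \<forall>x::real. -\<infinity> < ereal x \<longrightarrow> ereal x < \<infinity> \<longrightarrow> (F has_vector_derivative g x) (at x)"
    using assms(1) by (intro einterval_antiderivative) (auto simp: continuous_on_eq_continuous_at)
  then obtain F0 where F0: "\<And>x. (F0 has_real_derivative g x) (at x)"
    by (auto simp: has_real_derivative_iff_has_vector_derivative)
  define F where "F = (\<lambda>y. F0 y - F0 0)"
  have F: "(F has_real_derivative g y) (at y)" for y
    unfolding F_def using F0[of y] by (auto intro!: derivative_eq_intros)
  have "((\<lambda>y. F (- y) - F y) has_real_derivative 0) (at y)" for y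
  proof -
    have m: "((\<lambda>y::real. - y) has_real_derivative - 1) (at y)" by (auto intro!: derivative_eq_intros)
    from DERIV_diff[OF DERIV_chain2[OF F m] F[of y]] show ?thesis by (simp add: assms(2))
  qed
  then have "F (- y) - F y = F (- 0) - F 0" for y
    using DERIV_isconst_all[of "\<lambda>y. F (- y) - F y"] by blast
  then show thesis using that[of F] F by (simp add: F_def)
qed

lemma antiderivative_bounds:
  fixes g F :: "real \<Rightarrow> real"
  assumes F: "\<And>y. (F has_real_derivative g y) (at y)" and F0: "F 0 = 0" and s: "0 \<le> s"
  shows "(\<And>y. 0 \<le> y \<Longrightarrow> y \<le> s \<Longrightarrow> a * y \<le> g y) \<Longrightarrow> a * s\<^sup>2 / 2 \<le> F s"
    and "(\<And>y. 0 \<le> y \<Longrightarrow> y \<le> s \<Longrightarrow> g y \<le> a * y) \<Longrightarrow> F s \<le> a * s\<^sup>2 / 2"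
proof -
  have D: "((\<lambda>y. F y - a * y\<^sup>2 / 2) has_real_derivative g y - a * y) (at y)" for y
    using F[of y] by (auto intro!: derivative_eq_intros)
  have C: "continuous_on {0..s} (\<lambda>y. F y - a * y\<^sup>2 / 2)"
    by (rule DERIV_continuous_on, rule has_field_derivative_at_within, rule D)
  show "a * s\<^sup>2 / 2 \<le> F s" if "\<And>y. 0 \<le> y \<Longrightarrow> y \<le> s \<Longrightarrow> a * y \<le> g y"
    using nondecreasing_by_deriv[OF s C D] that F0 by simp
  show "F s \<le> a * s\<^sup>2 / 2" if "\<And>y. 0 \<le> y \<Longrightarrow> y \<le> s \<Longrightarrow> g y \<le> a * y"
    using nonincreasing_by_deriv[OF s C D] that F0 by simp
qed

lemma radial_ode_cont_sub:
  assumes "radial_ode g w p" "0 \<le> a" "b < 1"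
  shows "continuous_on {a..b} w" "continuous_on {a..b} p"
  using assms unfolding radial_ode_def by (auto elim!: continuous_on_subset)

text \<open>The energy \<open>p\<^sup>2 / (2 t\<^sup>2) + F(w)\<close> decreases along the solution, and at \<open>M\<close> it equals \<open>F(w M)\<close>.  As
  \<open>M = 0\<close> is allowed, where the quotient is not defined, the energy at \<open>M\<close> is taken as a limit from the
  right; the bound \<open>p(r) \<le> K r (r - M)\<close> controls the quotient.\<close>
lemma radial_ode_max_bound:
  assumes ode: "radial_ode g w p" and g: "continuous_on UNIV g" "\<And>y. g (- y) = - g y" "\<And>y. 0 < y \<Longrightarrow> 0 < g y"
    and M: "0 \<le> M" "M < R" "R \<le> 1" "p M = 0" "\<And>r. M \<le> r \<Longrightarrow> r < R \<Longrightarrow> 0 < w r"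
    and x: "M \<le> x" "x < 1"
  shows "\<bar>w x\<bar> \<le> w M"
proof (cases "x = M")
  case True then show ?thesis using less_imp_le[OF M(5)[of M]] M(2) by simp
next
  case False
  then have Mx: "M < x" using x by simp
  have w': "(w has_real_derivative - p t / t) (at t)" and p': "(p has_real_derivative t * g (w t)) (at t)"
    if "0 < t" "t < 1" for t using ode that by (auto simp: radial_ode_def)
  note sub = radial_ode_cont_sub[OF ode]
  obtain F where F: "\<And>y. (F has_real_derivative g y) (at y)" "F 0 = 0" "\<And>y. F (- y) = F y"
    using odd_antiderivative[OF g(1,2)] by metis
  define b where "b = (min R x + M) / 2"
  have b: "M < b" "b < R" "b < x" using M Mx by (auto simp: b_def min_def)
  have p_nonneg: "0 \<le> p r" if r: "M \<le> r" "r \<le> b" for r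
  proof -
    have "p M \<le> p r"
    proof (rule nondecreasing_by_deriv[where \<phi> = p and \<phi>' = "\<lambda>t. t * g (w t)"])
      fix t assume t: "M < t" "t < r"
      show "(p has_real_derivative t * g (w t)) (at t)" using p' t r b x M by simp
      show "0 \<le> t * g (w t)" using g(3)[OF M(5)[of t]] t r b M by simp
    qed (use r b x M sub in auto)
    then show ?thesis using M by simp
  qed
  have w_le: "w r \<le> w M" if r: "M \<le> r" "r \<le> b" for r
  proof (rule nonincreasing_by_deriv[where \<phi> = w and \<phi>' = "\<lambda>t. - p t / t"])
    fix t assume t: "M < t" "t < r"
    show "(w has_real_derivative - p t / t) (at t)" using w' t r b x M by simp
    show "- p t / t \<le> 0" using p_nonneg[of t] t r b M by simp
  qed (use r b x M sub in auto)
  have "continuous_on {M..b} (\<lambda>s. g (w s))"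
    using sub[of M b] M b x by (intro continuous_on_compose2[OF g(1)]) auto
  then have "\<exists>z\<in>{M..b}. \<forall>s\<in>{M..b}. g (w s) \<le> g (w z)"
    using b by (intro continuous_attains_sup) auto
  then obtain z where z: "z \<in> {M..b}" "\<And>s. s \<in> {M..b} \<Longrightarrow> g (w s) \<le> g (w z)" by blast
  define K where "K = g (w z)"
  have p_le: "p r \<le> K * r * (r - M)" if r: "M < r" "r \<le> b" for r
  proof -
    have "\<bar>p r - p M\<bar> \<le> (K * r) * (r - M)"
    proof (rule lipschitz_by_deriv[where \<phi> = p and \<phi>' = "\<lambda>t. t * g (w t)"])
      fix t assume t: "M < t" "t < r"
      show "(p has_real_derivative t * g (w t)) (at t)" using p' t r b x M by simp
      have "0 < g (w t)" using g(3)[OF M(5)[of t]] t r b M by simp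
      moreover have "g (w t) \<le> K" using z(2)[of t] t r by (simp add: K_def)
      ultimately have "t * g (w t) \<le> r * K" using t M by (intro mult_mono) auto
      moreover have "0 \<le> t * g (w t)" using \<open>0 < g (w t)\<close> t M by simp
      ultimately show "\<bar>t * g (w t)\<bar> \<le> K * r" by (simp add: mult.commute)
    qed (use r b x M sub in auto)
    then show ?thesis using M by simp
  qed
  define En where "En = (\<lambda>t. (p t)\<^sup>2 / (2 * t\<^sup>2) + F (w t))"
  have F_mono: "F s \<le> F t" if "0 \<le> s" "s \<le> t" for s t
  proof (rule nondecreasing_by_deriv[where \<phi> = F and \<phi>' = g])
    show "continuous_on {s..t} F" by (rule DERIV_continuous_on, rule has_field_derivative_at_within, rule F)
    fix y assume "s < y" "y < t"
    then show "0 \<le> g y" using g(3)[of y] that by simp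
  qed (use that F in auto)
  have En_le: "En x \<le> En r" if r: "M < r" "r \<le> b" for r
  proof (rule nonincreasing_by_deriv[where \<phi> = En and \<phi>' = "\<lambda>t. - (p t)\<^sup>2 / t ^ 3"])
    have Fc: "continuous_on UNIV F" by (rule DERIV_continuous_on, rule has_field_derivative_at_within, rule F)
    have "continuous_on {r..x} (\<lambda>t. F (w t))"
      using sub[of r x] r x M by (intro continuous_on_compose2[OF Fc]) auto
    then show "continuous_on {r..x} En"
      unfolding En_def using sub[of r x] r x M by (intro continuous_intros) auto
    fix t assume t: "r < t" "t < x"
    have t0: "0 < t" "t < 1" using t r M x by auto
    have Fw: "((\<lambda>t. F (w t)) has_real_derivative g (w t) * (- p t / t)) (at t)"
      by (rule DERIV_chain2[OF F(1) w'[OF t0]])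
    have pp: "((\<lambda>t. (p t)\<^sup>2) has_real_derivative 2 * p t * (t * g (w t))) (at t)"
      using p'[OF t0] by (auto intro!: derivative_eq_intros)
    have tt: "((\<lambda>t. 2 * t\<^sup>2) has_real_derivative 4 * t) (at t)" by (auto intro!: derivative_eq_intros)
    have "(En has_real_derivative (2 * p t * (t * g (w t)) * (2 * t\<^sup>2) - (p t)\<^sup>2 * (4 * t)) / ((2 * t\<^sup>2) * (2 * t\<^sup>2))
        + g (w t) * (- p t / t)) (at t)"
      unfolding En_def using t0 by (intro DERIV_add DERIV_divide pp tt Fw) auto
    moreover have "(2 * p t * (t * g (w t)) * (2 * t\<^sup>2) - (p t)\<^sup>2 * (4 * t)) / ((2 * t\<^sup>2) * (2 * t\<^sup>2))
        + g (w t) * (- p t / t) = - (p t)\<^sup>2 / t ^ 3"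
      using t0 by (simp add: field_simps power2_eq_square power3_eq_cube)
    ultimately show "(En has_real_derivative - (p t)\<^sup>2 / t ^ 3) (at t)" by simp
    show "- (p t)\<^sup>2 / t ^ 3 \<le> 0" using t0 by simp
  qed (use r b in auto)
  have En_up: "En r \<le> (K * (r - M))\<^sup>2 / 2 + F (w M)" if r: "M < r" "r \<le> b" for r
  proof -
    have "p r / r \<le> K * (r - M)" using p_le[OF r] r M by (simp add: divide_le_eq mult_ac)
    moreover have "0 \<le> p r / r" using p_nonneg[of r] r M by simp
    ultimately have "(p r / r)\<^sup>2 \<le> (K * (r - M))\<^sup>2" by (intro power_mono)
    moreover have "F (w r) \<le> F (w M)" using w_le[of r] M(5)[of r] r b by (intro F_mono) auto
    moreover have "(p r)\<^sup>2 / (2 * r\<^sup>2) = (p r / r)\<^sup>2 / 2" by (simp add: power_divide)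
    ultimately show ?thesis unfolding En_def by linarith
  qed
  have "En x \<le> F (w M)"
  proof (rule tendsto_lowerbound)
    have "((\<lambda>r. (K * (r - M))\<^sup>2 / 2 + F (w M)) \<longlongrightarrow> (K * (M - M))\<^sup>2 / 2 + F (w M)) (at_right M)"
      by (intro tendsto_intros) auto
    then show "((\<lambda>r. (K * (r - M))\<^sup>2 / 2 + F (w M)) \<longlongrightarrow> F (w M)) (at_right M)" by simp
    have "\<forall>\<^sub>F r in at_right M. r \<in> {M<..<b}" using b(1) by (rule eventually_at_right_real)
    then show "\<forall>\<^sub>F r in at_right M. En x \<le> (K * (r - M))\<^sup>2 / 2 + F (w M)"
      by eventually_elim (rule order_trans[OF En_le En_up], auto)
  qed simp
  moreover have "0 \<le> (p x)\<^sup>2 / (2 * x\<^sup>2)" by simp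
  ultimately have "F (w x) \<le> F (w M)" unfolding En_def by linarith
  moreover have "F (w x) = F \<bar>w x\<bar>" using F(3)[of "w x"] by (simp add: abs_if)
  ultimately have Fle: "F \<bar>w x\<bar> \<le> F (w M)" by simp
  show ?thesis
  proof (rule ccontr)
    assume "\<not> ?thesis"
    then have lt: "w M < \<bar>w x\<bar>" by simp
    have "F (w M) < F \<bar>w x\<bar>"
    proof (rule DERIV_pos_imp_increasing_open[OF lt])
      fix y assume "w M < y" "y < \<bar>w x\<bar>"
      then show "\<exists>d. (F has_real_derivative d) (at y) \<and> 0 < d"
        using F(1)[of y] g(3)[of y] less_trans[OF M(5)[of M], of y] M(2) by (intro exI[of _ "g y"]) auto
    next
      show "continuous_on {w M..\<bar>w x\<bar>} F" by (rule DERIV_continuous_on, rule has_field_derivative_at_within, rule F)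
    qed
    then show False using Fle by simp
  qed
qed

text \<open>The function \<open>p\<^sup>2 / 2 + t\<^sup>2 F(w)\<close> increases.  At a critical point \<open>z\<close> only the second term is left, so
  \<open>\<bar>w z\<bar>\<close> is bounded below by earlier values of \<open>w\<close>.\<close>
lemma radial_ode_pohozaev:
  assumes ode: "radial_ode g w p" and g: "continuous_on UNIV g" "\<And>y. g (- y) = - g y"
    and lo: "0 \<le> a" "\<And>y. 0 \<le> y \<Longrightarrow> a * y \<le> g y" and hi: "\<And>y. 0 \<le> y \<Longrightarrow> y \<le> \<bar>w z\<bar> \<Longrightarrow> g y \<le> C * y"
    and r: "0 < r" "r \<le> z" "z < 1" and pz: "p z = 0"
  shows "r\<^sup>2 * a * (w r)\<^sup>2 \<le> z\<^sup>2 * C * (w z)\<^sup>2"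
proof -
  have w': "(w has_real_derivative - p t / t) (at t)" and p': "(p has_real_derivative t * g (w t)) (at t)"
    if "0 < t" "t < 1" for t using ode that by (auto simp: radial_ode_def)
  note sub = radial_ode_cont_sub[OF ode]
  obtain F where F: "\<And>y. (F has_real_derivative g y) (at y)" "F 0 = 0" "\<And>y. F (- y) = F y"
    using odd_antiderivative[OF g] by metis
  have F_abs: "F s = F \<bar>s\<bar>" for s using F(3)[of s] by (simp add: abs_if)
  have F_lo: "a * s\<^sup>2 / 2 \<le> F s" for s
    using antiderivative_bounds(1)[OF F(1,2), of "\<bar>s\<bar>" a] lo F_abs[of s] by simp
  have F_hi: "F (w z) \<le> C * (w z)\<^sup>2 / 2"
    using antiderivative_bounds(2)[OF F(1,2), of "\<bar>w z\<bar>" C] hi F_abs[of "w z"] by simp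
  have "(p r)\<^sup>2 / 2 + r\<^sup>2 * F (w r) \<le> (p z)\<^sup>2 / 2 + z\<^sup>2 * F (w z)"
  proof (rule nondecreasing_by_deriv[where \<phi> = "\<lambda>t. (p t)\<^sup>2 / 2 + t\<^sup>2 * F (w t)" and \<phi>' = "\<lambda>t. 2 * t * F (w t)"])
    have Fc: "continuous_on UNIV F" by (rule DERIV_continuous_on, rule has_field_derivative_at_within, rule F)
    have "continuous_on {r..z} (\<lambda>t. F (w t))"
      using sub[of r z] r by (intro continuous_on_compose2[OF Fc]) auto
    then show "continuous_on {r..z} (\<lambda>t. (p t)\<^sup>2 / 2 + t\<^sup>2 * F (w t))"
      using sub[of r z] r by (intro continuous_intros) auto
    fix t assume t: "r < t" "t < z"
    have t0: "0 < t" "t < 1" using t r by auto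
    have Fw: "((\<lambda>t. F (w t)) has_real_derivative g (w t) * (- p t / t)) (at t)"
      by (rule DERIV_chain2[OF F(1) w'[OF t0]])
    have "((\<lambda>t. (p t)\<^sup>2 / 2 + t\<^sup>2 * F (w t)) has_real_derivative
        p t * (t * g (w t)) + (2 * t * F (w t) + t\<^sup>2 * (g (w t) * (- p t / t)))) (at t)"
      using p'[OF t0] Fw by (auto intro!: derivative_eq_intros)
    moreover have "p t * (t * g (w t)) + (2 * t * F (w t) + t\<^sup>2 * (g (w t) * (- p t / t))) = 2 * t * F (w t)"
      using t0 by (simp add: power2_eq_square)
    ultimately show "((\<lambda>t. (p t)\<^sup>2 / 2 + t\<^sup>2 * F (w t)) has_real_derivative 2 * t * F (w t)) (at t)" by simp
    have "0 \<le> a * (w t)\<^sup>2 / 2" using lo by simp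
    then show "0 \<le> 2 * t * F (w t)" using F_lo[of "w t"] t0 by simp
  qed (use r in auto)
  then have "r\<^sup>2 * F (w r) \<le> z\<^sup>2 * F (w z)" 
  proof -
    assume "(p r)\<^sup>2 / 2 + r\<^sup>2 * F (w r) \<le> (p z)\<^sup>2 / 2 + z\<^sup>2 * F (w z)"
    moreover have "(p z)\<^sup>2 / 2 = 0" using pz by simp
    ultimately show ?thesis using zero_le_power2[of "p r"] by linarith
  qed
  moreover have "r\<^sup>2 * (a * (w r)\<^sup>2 / 2) \<le> r\<^sup>2 * F (w r)" using F_lo by (intro mult_left_mono) auto
  moreover have "z\<^sup>2 * F (w z) \<le> z\<^sup>2 * (C * (w z)\<^sup>2 / 2)" using F_hi by (intro mult_left_mono) auto
  ultimately show ?thesis by (simp add: mult.assoc)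
qed

lemma radial_ode_amplitude:
  assumes ode: "radial_ode g w p" and S: "S \<noteq> 0"
  shows "radial_ode (\<lambda>y. g (S * y) / S) (\<lambda>t. w t / S) (\<lambda>t. p t / S)"
proof -
  have wc: "continuous_on {0..1} w" and pc: "continuous_on {0..<1} p" and p0: "p 0 = 0"
    using ode by (auto simp: radial_ode_def)
  show ?thesis unfolding radial_ode_def
  proof (intro conjI ballI)
    show "continuous_on {0..1} (\<lambda>t. w t / S)" using wc S by (intro continuous_intros) auto
    show "continuous_on {0..<1} (\<lambda>t. p t / S)" using pc S by (intro continuous_intros) auto
    show "p 0 / S = 0" using p0 by simp
    fix t :: real assume t: "t \<in> {0<..<1}"
    have D: "(w has_real_derivative - p t / t) (at t)" "(p has_real_derivative t * g (w t)) (at t)"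
      using ode t by (auto simp: radial_ode_def)
    show "((\<lambda>t. w t / S) has_real_derivative - (p t / S) / t) (at t)"
      using DERIV_cdivide[OF D(1), of S] by (simp add: mult.commute)
    show "((\<lambda>t. p t / S) has_real_derivative t * (g (S * (w t / S)) / S)) (at t)"
      using DERIV_cdivide[OF D(2), of S] S by simp
  qed
qed

lemma uniform_limit_at_moving_points:
  fixes f :: "nat \<Rightarrow> real \<Rightarrow> real"
  assumes u: "uniform_limit K f l sequentially" and l: "continuous_on K l"
    and x: "x \<longlonglongrightarrow> y" "\<And>n. x n \<in> K" "y \<in> K"
  shows "(\<lambda>n. f n (x n)) \<longlonglongrightarrow> l y"
proof -
  have "(\<lambda>n. f n (x n) - l (x n)) \<longlonglongrightarrow> 0"
  proof (rule tendstoI)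
    fix e :: real assume "0 < e"
    then have "\<forall>\<^sub>F n in sequentially. \<forall>x\<in>K. dist (f n x) (l x) < e"
      using u unfolding uniform_limit_iff by blast
    then show "\<forall>\<^sub>F n in sequentially. dist (f n (x n) - l (x n)) 0 < e"
      by eventually_elim (use x(2) in \<open>auto simp: dist_norm\<close>)
  qed
  moreover have "(\<lambda>n. l (x n)) \<longlonglongrightarrow> l y"
    using continuous_on_tendsto_compose[OF l x(1,3)] x(2) by auto
  ultimately have "(\<lambda>n. (f n (x n) - l (x n)) + l (x n)) \<longlonglongrightarrow> 0 + l y" by (rule tendsto_add)
  then show ?thesis by simp
qed

section \<open>The heights are unbounded\<close>

lemma f_nl_cont: "0 \<le> \<epsilon> \<Longrightarrow> continuous_on UNIV (f_nl lam \<epsilon>)"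
  unfolding f_nl_def[abs_def] by (intro continuous_intros continuous_on_powr') auto

text \<open>The nonlinearity for \<open>u / S\<close>.  It makes sense for \<open>S = 0\<close>, where it is linear; this allows bounded heights
  and heights tending to zero to be treated together.\<close>
definition scaled_nl :: "real \<Rightarrow> real \<Rightarrow> real \<Rightarrow> real \<Rightarrow> real" where
  "scaled_nl lam S \<epsilon> y = lam * y * exp ((S * y)\<^sup>2 + \<bar>S * y\<bar> powr (1 + \<epsilon>))"

lemma scaled_nl_eq: "S \<noteq> 0 \<Longrightarrow> f_nl lam \<epsilon> (S * y) / S = scaled_nl lam S \<epsilon> y"
  by (simp add: scaled_nl_def f_nl_def)

lemma scaled_nl_cont: "0 \<le> \<epsilon> \<Longrightarrow> continuous_on A (scaled_nl lam S \<epsilon>)"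
  unfolding scaled_nl_def[abs_def] by (intro continuous_intros continuous_on_powr') auto

lemma scaled_nl_odd: "scaled_nl lam S \<epsilon> (- y) = - scaled_nl lam S \<epsilon> y"
  by (simp add: scaled_nl_def)

lemma scaled_nl_ge: "0 < lam \<Longrightarrow> 0 \<le> y \<Longrightarrow> lam * y \<le> scaled_nl lam S \<epsilon> y"
  unfolding scaled_nl_def using mult_left_mono[of 1 "exp ((S * y)\<^sup>2 + \<bar>S * y\<bar> powr (1 + \<epsilon>))" "lam * y"]
  by simp

lemma scaled_nl_le:
  assumes "0 < lam" "0 \<le> \<epsilon>" "\<epsilon> \<le> 1" "0 \<le> S" "S \<le> B" "0 \<le> y" "y \<le> 1"
  shows "scaled_nl lam S \<epsilon> y \<le> lam * exp (B\<^sup>2 + (1 + B)\<^sup>2) * y"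
proof -
  have Sy: "0 \<le> S * y" "S * y \<le> B" using assms mult_mono[of S B y 1] by auto
  have "(S * y)\<^sup>2 \<le> B\<^sup>2" using Sy by (intro power_mono) auto
  moreover have "\<bar>S * y\<bar> powr (1 + \<epsilon>) \<le> (1 + B)\<^sup>2"
  proof -
    have "\<bar>S * y\<bar> powr (1 + \<epsilon>) \<le> (1 + B) powr (1 + \<epsilon>)" using Sy assms by (intro powr_mono2) auto
    also have "\<dots> \<le> (1 + B) powr 2" using Sy assms by (intro powr_mono) auto
    also have "\<dots> = (1 + B)\<^sup>2" using Sy by simp
    finally show ?thesis .
  qed
  ultimately have "exp ((S * y)\<^sup>2 + \<bar>S * y\<bar> powr (1 + \<epsilon>)) \<le> exp (B\<^sup>2 + (1 + B)\<^sup>2)" by simp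
  then have "lam * y * exp ((S * y)\<^sup>2 + \<bar>S * y\<bar> powr (1 + \<epsilon>)) \<le> lam * y * exp (B\<^sup>2 + (1 + B)\<^sup>2)"
    using assms by (intro mult_left_mono) auto
  then show ?thesis by (simp add: scaled_nl_def mult_ac)
qed

text \<open>The scaled nonlinearity is jointly continuous in height, argument and exponent on a compact set.\<close>
lemma scaled_nl_uniform_limit:
  assumes S: "\<And>n. S n \<in> {0..B}" "S \<longlonglongrightarrow> S0" and e: "\<And>n. \<epsilon> n \<in> {0..1}" "\<epsilon> \<longlonglongrightarrow> 0"
  shows "uniform_limit {-1..1} (\<lambda>n. scaled_nl lam (S n) (\<epsilon> n)) (scaled_nl lam S0 0) sequentially"
  unfolding uniform_limit_iff
proof (intro allI impI)
  fix e :: real assume e0: "0 < e"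
  define H where "H = (\<lambda>q :: real \<times> real \<times> real. scaled_nl lam (fst q) (snd (snd q)) (fst (snd q)))"
  define K where "K = {0..B} \<times> {-1..1::real} \<times> {0..1::real}"
  have "continuous_on K H"
    unfolding H_def K_def scaled_nl_def by (intro continuous_intros continuous_on_powr') auto
  moreover have "compact K" unfolding K_def by (intro compact_Times compact_Icc)
  ultimately have "uniformly_continuous_on K H" by (rule compact_uniformly_continuous)
  then obtain d where d: "0 < d" "\<And>q q'. q \<in> K \<Longrightarrow> q' \<in> K \<Longrightarrow> dist q' q < d \<Longrightarrow> dist (H q') (H q) < e"
    using e0 unfolding uniformly_continuous_on_def by metis
  have S0: "S0 \<in> {0..B}" using closed_sequentially[OF closed_atLeastAtMost S(1) S(2)] .
  have "\<forall>\<^sub>F n in sequentially. dist (S n) S0 < d / 2" "\<forall>\<^sub>F n in sequentially. dist (\<epsilon> n) 0 < d / 2"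
    using tendstoD[OF S(2), of "d / 2"] tendstoD[OF e(2), of "d / 2"] d(1) by auto
  then show "\<forall>\<^sub>F n in sequentially. \<forall>y\<in>{-1..1}. dist (scaled_nl lam (S n) (\<epsilon> n) y) (scaled_nl lam S0 0 y) < e"
  proof eventually_elim
    case (elim n)
    show ?case
    proof
      fix y :: real assume y: "y \<in> {-1..1}"
      have "dist (S n, y, \<epsilon> n) (S0, y, 0) \<le> dist (S n) S0 + dist (\<epsilon> n) 0"
        using sqrt_sum_squares_le_sum[of "dist (S n) S0" "dist (\<epsilon> n) 0"]
        by (simp add: dist_Pair_Pair)
      then have "dist (S n, y, \<epsilon> n) (S0, y, 0) < d" using elim by linarith
      then have "dist (H (S n, y, \<epsilon> n)) (H (S0, y, 0)) < e"
        using S(1)[of n] S0 e(1)[of n] y by (intro d(2)) (auto simp: K_def)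
      then show "dist (scaled_nl lam (S n) (\<epsilon> n) y) (scaled_nl lam S0 0 y) < e" by (simp add: H_def)
    qed
  qed
qed

text \<open>For \<open>S = 0\<close> the profile up to its zero \<open>\<rho>\<close>, stretched to the unit disc, is an eigenfunction with
  eigenvalue \<open>\<rho>\<^sup>2 lam < lambda1\<close>.  For \<open>S > 0\<close> the function \<open>S V\<close> is a sign-changing solution for the
  exponent one.\<close>
lemma limit_profile_contradiction:
  assumes lam: "0 < lam" "lam < lambda1" and AY: "no_sign_changing_radial_solution lam"
    and S: "0 \<le> S" and ode: "radial_ode (scaled_nl lam S 0) V Q" and V: "V 0 = 1" "V 1 = 0"
    and \<rho>: "0 \<le> \<rho>" "\<rho> \<le> 1" "V \<rho> = 0" and z: "0 \<le> z" "z \<le> 1" "V z < 0"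
  shows False
proof (cases "S = 0")
  case True
  have r0: "0 < \<rho>" using \<rho> V by (cases "\<rho> = 0") auto
  have "scaled_nl lam S 0 = (\<lambda>y. lam * y)" by (simp add: True scaled_nl_def[abs_def])
  then have "radial_ode (\<lambda>y. lam * y) V Q" using ode by simp
  from radial_ode_scale[OF this r0 \<rho>(2)]
  have "radial_ode (\<lambda>s. (\<rho>\<^sup>2 * lam) * s) (\<lambda>t. V (\<rho> * t)) (\<lambda>t. Q (\<rho> * t))" by (simp add: mult.assoc)
  then have sol: "dirichlet_solution (\<lambda>s. (\<rho>\<^sup>2 * lam) * s) (\<lambda>x. V (\<rho> * norm x))"
    using \<rho> by (intro ode_imp_radial_solution[where V = "\<lambda>t. V (\<rho> * t)"]) (auto intro!: continuous_intros)
  have "dirichlet_eigenvalue (\<rho>\<^sup>2 * lam)" unfolding dirichlet_eigenvalue_def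
    using sol V by (intro exI[of _ "\<lambda>x. V (\<rho> * norm x)"] conjI bexI[of _ 0]) auto
  then have "lambda1 \<le> \<rho>\<^sup>2 * lam" by (rule lambda1_le)
  also have "\<dots> \<le> 1 * lam" using \<rho> lam by (intro mult_right_mono) (auto simp: power_le_one)
  finally show False using lam by simp
next
  case False
  then have S0: "0 < S" using S by simp
  have eq: "(\<lambda>y. scaled_nl lam S 0 (inverse S * y) / inverse S) = f_nl lam 0"
    using S0 by (auto simp: scaled_nl_def f_nl_def field_simps)
  have "radial_ode (f_nl lam 0) (\<lambda>t. V t / inverse S) (\<lambda>t. Q t / inverse S)"
    using radial_ode_amplitude[OF ode, of "inverse S"] S0 unfolding eq by simp
  then have sol: "dirichlet_solution (f_nl lam 0) (\<lambda>x. V (norm x) / inverse S)"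
    using V f_nl_cont by (intro ode_imp_radial_solution[where V = "\<lambda>t. V t / inverse S"]) auto
  have rad: "radial (\<lambda>x. V (norm x) / inverse S)" by (simp add: radial_def)
  have z1: "z < 1" using z V by (cases "z = 1") auto
  have "\<exists>x\<in>disc. V (norm x) / inverse S > 0" using V S0 by (intro bexI[of _ 0]) auto
  moreover have "\<exists>x\<in>disc. V (norm x) / inverse S < 0"
    using z z1 S0 by (intro bexI[of _ "z *\<^sub>R e1"]) (auto intro: divide_neg_pos)
  ultimately show False using AY sol rad unfolding no_sign_changing_radial_solution_def by blast
qed

text \<open>Otherwise there are solutions with \<open>\<epsilon>\<close> and \<open>M\<close> tending to zero and heights at most \<open>B\<close>.  Divided by
  their heights they converge along a subsequence.  The limit vanishes at a limit \<open>\<rho>\<close> of the zeros \<open>R\<close>,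
  and it is negative at a limit of critical points in the following nodal interval, contrary to
  \<open>limit_profile_contradiction\<close>.\<close>
lemma heights_unbounded:
  assumes lam: "0 < lam" "lam < lambda1" and AY: "no_sign_changing_radial_solution lam"
  obtains \<eta> where "0 < \<eta>"
    "\<And>\<epsilon> w p M R R'. 0 < \<epsilon> \<Longrightarrow> \<epsilon> < \<eta> \<Longrightarrow> radial_ode (f_nl lam \<epsilon>) w p \<Longrightarrow> w 1 = 0 \<Longrightarrow>
      0 \<le> M \<Longrightarrow> M < \<eta> \<Longrightarrow> M < R \<Longrightarrow> R < R' \<Longrightarrow> R' \<le> 1 \<Longrightarrow> p M = 0 \<Longrightarrow>
      (\<And>r. M \<le> r \<Longrightarrow> r < R \<Longrightarrow> 0 < w r) \<Longrightarrow> w R = 0 \<Longrightarrow>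
      (\<And>r. R < r \<Longrightarrow> r < R' \<Longrightarrow> w r < 0) \<Longrightarrow> w R' = 0 \<Longrightarrow> B < w M"
proof -
  \<comment> \<open>A counterexample for \<open>\<eta>\<close> is coded as one tuple, so that a sequence of them can be chosen.\<close>
  define bad where "bad = (\<lambda>(\<eta>::real) (q :: real \<times> (real \<Rightarrow> real) \<times> (real \<Rightarrow> real) \<times> real \<times> real \<times> real).
    case q of (\<epsilon>, w, p, M, R, R') \<Rightarrow> 0 < \<epsilon> \<and> \<epsilon> < \<eta> \<and> radial_ode (f_nl lam \<epsilon>) w p \<and> w 1 = 0 \<and>
      0 \<le> M \<and> M < \<eta> \<and> M < R \<and> R < R' \<and> R' \<le> 1 \<and> p M = 0 \<and>
      (\<forall>r. M \<le> r \<and> r < R \<longrightarrow> 0 < w r) \<and> w R = 0 \<and>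
      (\<forall>r. R < r \<and> r < R' \<longrightarrow> w r < 0) \<and> w R' = 0 \<and> w M \<le> B)"
  have "\<exists>\<eta>>0. \<forall>q. \<not> bad \<eta> q"
  proof (rule ccontr)
    assume "\<not> ?thesis"
    then have ex: "\<And>\<eta>. 0 < \<eta> \<Longrightarrow> \<exists>q. bad \<eta> q" by blast
    have "\<forall>n::nat. \<exists>q. bad (1 / (real n + 2)) q" by (intro allI ex) simp
    then obtain q where q: "\<And>n::nat. bad (1 / (real n + 2)) (q n)" by metis
    define \<epsilon> w p M R R' where "\<epsilon> = (\<lambda>n. fst (q n))" and "w = (\<lambda>n. fst (snd (q n)))"
      and "p = (\<lambda>n. fst (snd (snd (q n))))" and "M = (\<lambda>n. fst (snd (snd (snd (q n)))))"
      and "R = (\<lambda>n. fst (snd (snd (snd (snd (q n))))))" and "R' = (\<lambda>n. snd (snd (snd (snd (snd (q n))))))"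
    have qn: "q n = (\<epsilon> n, w n, p n, M n, R n, R' n)" for n
      by (simp add: \<epsilon>_def w_def p_def M_def R_def R'_def)
    have eps: "0 < \<epsilon> n" "\<epsilon> n < 1 / (real n + 2)" and ode: "radial_ode (f_nl lam (\<epsilon> n)) (w n) (p n)"
      and w1: "w n 1 = 0" and Mn: "0 \<le> M n" "M n < 1 / (real n + 2)" "M n < R n"
      and Rn: "R n < R' n" "R' n \<le> 1" and pM: "p n (M n) = 0"
      and wpos: "\<And>r. M n \<le> r \<Longrightarrow> r < R n \<Longrightarrow> 0 < w n r" and wR: "w n (R n) = 0"
      and wneg: "\<And>r. R n < r \<Longrightarrow> r < R' n \<Longrightarrow> w n r < 0" and wR': "w n (R' n) = 0"
      and wB: "w n (M n) \<le> B" for n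
      using q[of n] unfolding qn bad_def by auto
    have inv: "1 / (real n + 2) \<le> 1" for n by simp
    have R1: "R n < 1" for n using Rn[of n] by simp
    have lim0: "(\<lambda>n. 1 / (real n + 2)) \<longlonglongrightarrow> 0" by real_asymp
    have eps_lim: "\<epsilon> \<longlonglongrightarrow> 0"
      by (rule tendsto_sandwich[OF _ _ tendsto_const lim0]) (auto intro!: always_eventually less_imp_le eps)
    have M_lim: "M \<longlonglongrightarrow> 0"
      by (rule tendsto_sandwich[OF _ _ tendsto_const lim0]) (auto intro!: always_eventually less_imp_le Mn)
    have eps1: "\<epsilon> n \<in> {0..1}" for n 
      using eps(1)[of n] less_le_trans[OF eps(2)[of n] inv[of n]] by simp
    have M1: "M n < 1" for n by (rule less_le_trans[OF Mn(2) inv])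
    define S where "S = (\<lambda>n. w n (M n))"
    have S: "0 < S n" "S n \<le> B" for n using wpos[of n "M n"] Mn[of n] wB[of n] by (auto simp: S_def)
    define v where "v = (\<lambda>n t. w n t / S n)"
    define P where "P = (\<lambda>n t. p n t / S n)"
    define g where "g = (\<lambda>n. scaled_nl lam (S n) (\<epsilon> n))"
    have ode': "radial_ode (g n) (v n) (P n)" for n
    proof -
      have "radial_ode (\<lambda>y. f_nl lam (\<epsilon> n) (S n * y) / S n) (v n) (P n)"
        unfolding v_def P_def using radial_ode_amplitude[OF ode] S(1)[of n] by simp
      moreover have "(\<lambda>y. f_nl lam (\<epsilon> n) (S n * y) / S n) = g n"
        unfolding g_def using scaled_nl_eq S(1)[of n] by fastforce
      ultimately show ?thesis by simp
    qed
    have g_cont: "continuous_on UNIV (g n)" and g_odd: "g n (- y) = - g n y" for n y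
      using eps[of n] by (auto simp: g_def scaled_nl_odd intro!: scaled_nl_cont)
    have g_ge: "lam * y \<le> g n y" if "0 \<le> y" for n y unfolding g_def using scaled_nl_ge[OF lam(1) that] .
    have g_pos: "0 < g n y" if "0 < y" for n y
      by (rule less_le_trans[OF mult_pos_pos[OF lam(1) that] g_ge[OF less_imp_le[OF that]]])
    define C where "C = lam * exp (B\<^sup>2 + (1 + B)\<^sup>2)"
    have C0: "0 < C" using lam by (simp add: C_def)
    have g_le: "g n y \<le> C * y" if "0 \<le> y" "y \<le> 1" for n y
      unfolding g_def C_def using lam eps1[of n] S[of n] that by (intro scaled_nl_le) auto
    have g_abs: "\<bar>g n y\<bar> \<le> C" if "\<bar>y\<bar> \<le> 1" for n y
    proof -
      have "\<bar>g n y\<bar> = g n \<bar>y\<bar>"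
      proof (cases "0 \<le> y")
        case True
        have "0 \<le> lam * y" using lam True by simp
        then show ?thesis using g_ge[OF True, of n] True by simp
      next
        case False
        have "0 \<le> lam * - y" using lam False by (intro mult_nonneg_nonneg) auto
        then have "0 \<le> g n (- y)" using g_ge[of "- y" n] False by linarith
        then show ?thesis using g_odd[of n y] False by simp
      qed
      also have "\<dots> \<le> C * \<bar>y\<bar>" using g_le that by simp
      also have "\<dots> \<le> C * 1" using that C0 by (intro mult_left_mono) auto
      finally show ?thesis by simp
    qed
    have vM: "v n (M n) = 1" for n using S(1)[of n] by (simp add: v_def S_def)
    have PM: "P n (M n) = 0" for n using pM by (simp add: P_def)
    have vpos: "0 < v n r" if "M n \<le> r" "r < R n" for n r using wpos[OF that] S by (simp add: v_def)
    have vR: "v n (R n) = 0" and v1: "v n 1 = 0" for n using wR w1 by (auto simp: v_def)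
    have v_le: "\<bar>v n x\<bar> \<le> 1" if "M n \<le> x" "x \<le> 1" for n x
    proof (cases "x = 1")
      case False
      then show ?thesis
        using radial_ode_max_bound[OF ode' g_cont g_odd g_pos Mn(1) Mn(3) less_imp_le[OF R1] PM vpos, of n x]
          that vM by simp
    qed (simp add: v1)
    have "\<exists>z. R n < z \<and> z < R' n \<and> p n z = 0" for n
    proof -
      have R0: "0 < R n" using Mn[of n] by simp
      have wd: "(w n has_real_derivative - p n t / t) (at t)" if "R n < t" "t < R' n" for t
        using ode[of n] that R0 Rn[of n] by (auto simp: radial_ode_def)
      have "\<exists>z. R n < z \<and> z < R' n \<and> (w n has_real_derivative 0) (at z)"
      proof (rule Rolle[OF Rn(1)])
        show "w n (R n) = w n (R' n)" using wR wR' by simp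
        have "continuous_on {0..1} (w n)" using ode[of n] by (simp add: radial_ode_def)
        then show "continuous_on {R n..R' n} (w n)"
          by (rule continuous_on_subset) (use R0 Rn[of n] in auto)
        show "w n differentiable (at t)" if "R n < t" "t < R' n" for t
          using wd[OF that] by (auto simp: real_differentiable_def)
      qed
      then obtain z where z: "R n < z" "z < R' n" "(w n has_real_derivative 0) (at z)" by blast
      have "- p n z / z = 0" using DERIV_unique[OF wd[OF z(1,2)] z(3)] .
      then show ?thesis using z R0 by (intro exI[of _ z]) auto
    qed
    then obtain z where z: "\<And>n. R n < z n" "\<And>n. z n < R' n" "\<And>n. p n (z n) = 0" by metis
    have z01: "0 \<le> z n" "z n < 1" for n using z[of n] Rn[of n] Mn[of n] by auto
    \<comment> \<open>By the Lipschitz bound \<open>C\<close>, the normalised solutions are at least 1/2 at the fixed radius \<open>r0\<close>; the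
        Pohozaev estimate carries this over to the bound \<open>cc\<close> at the critical points \<open>z n\<close>.\<close>
    define r0 where "r0 = min (1/2) (1 / (2 * C))"
    have r0: "0 < r0" "r0 \<le> 1 / (2 * C)" "r0 < 1" using C0 by (auto simp: r0_def)
    define cc where "cc = r0 * sqrt (lam / C) / 2"
    have cc: "0 < cc" using r0 lam C0 by (simp add: cc_def)
    have vz: "v n (z n) \<le> - cc" if Mr: "M n < r0" for n
    proof -
      have lip: "\<bar>v n x - v n (M n)\<bar> \<le> C * (x - M n)" if x: "M n \<le> x" "x < 1" for x
      proof (rule lipschitz_by_deriv[where \<phi> = "v n" and \<phi>' = "\<lambda>t. - P n t / t"])
        show "continuous_on {M n..x} (v n)" using radial_ode_cont_sub[OF ode'] Mn(1) x by simp
        fix t assume t: "M n < t" "t < x"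
        have t0: "0 < t" using t Mn(1)[of n] by simp
        show "(v n has_real_derivative - P n t / t) (at t)"
          using ode'[of n] t0 t x by (auto simp: radial_ode_def)
        have "\<bar>P n t - P n (M n)\<bar> \<le> C * (t - M n)"
        proof (rule lipschitz_by_deriv[where \<phi> = "P n" and \<phi>' = "\<lambda>s. s * g n (v n s)"])
          show "continuous_on {M n..t} (P n)" using radial_ode_cont_sub[OF ode'] Mn(1) x t by simp
          fix s assume s: "M n < s" "s < t"
          have s0: "0 < s" "s < 1" using s t x Mn(1)[of n] by auto
          show "(P n has_real_derivative s * g n (v n s)) (at s)"
            using ode'[of n] s0 by (auto simp: radial_ode_def)
          have "\<bar>s\<bar> * \<bar>g n (v n s)\<bar> \<le> 1 * C" using s0 g_abs[OF v_le[of n s]] s by (intro mult_mono) auto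
          then show "\<bar>s * g n (v n s)\<bar> \<le> C" by (simp add: abs_mult)
        qed (use t in auto)
        also have "\<dots> \<le> C * t" using C0 Mn(1)[of n] by (intro mult_left_mono) auto
        finally show "\<bar>- P n t / t\<bar> \<le> C" using t0 PM by (simp add: divide_le_eq)
      qed (use x in auto)
      have half: "1 / 2 \<le> v n r0"
      proof -
        have "C * (r0 - M n) \<le> C * r0" using C0 Mn(1)[of n] by (intro mult_left_mono) auto
        also have "\<dots> \<le> C * (1 / (2 * C))" using C0 r0 by (intro mult_left_mono) auto
        also have "\<dots> = 1 / 2" using C0 by simp
        finally show ?thesis using lip[of r0] Mr r0 vM[of n] by linarith
      qed
      have "r0 < R n"
      proof (rule ccontr)
        assume "\<not> r0 < R n"
        then have "R n \<le> r0" by simp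
        have "C * (R n - M n) \<le> C * r0" using C0 Mn(1)[of n] \<open>R n \<le> r0\<close> by (intro mult_left_mono) auto
        also have "\<dots> \<le> C * (1 / (2 * C))" using C0 r0 by (intro mult_left_mono) auto
        also have "\<dots> = 1 / 2" using C0 by simp
        finally show False using lip[of "R n"] Mn(3)[of n] R1[of n] vM[of n] vR[of n] by linarith
      qed
      then have rz: "r0 \<le> z n" using z(1)[of n] by simp
      have Pz: "P n (z n) = 0" using z(3) by (simp add: P_def)
      have vz1: "\<bar>v n (z n)\<bar> \<le> 1" using v_le[of n "z n"] rz Mr z01(2)[of n] by simp
      have "r0\<^sup>2 * lam * (v n r0)\<^sup>2 \<le> (z n)\<^sup>2 * C * (v n (z n))\<^sup>2"
        by (rule radial_ode_pohozaev[OF ode' g_cont g_odd _ g_ge _ r0(1) rz z01(2) Pz])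
          (use lam g_le vz1 in auto)
      also have "\<dots> \<le> 1 * C * (v n (z n))\<^sup>2"
        using C0 z01[of n] by (intro mult_right_mono) (auto simp: power_le_one)
      finally have "r0\<^sup>2 * lam * (v n r0)\<^sup>2 \<le> C * (v n (z n))\<^sup>2" by simp
      moreover have "r0\<^sup>2 * lam * (1/2)\<^sup>2 \<le> r0\<^sup>2 * lam * (v n r0)\<^sup>2"
        using half lam by (intro mult_left_mono power_mono) auto
      ultimately have "r0\<^sup>2 * lam * (1/2)\<^sup>2 / C \<le> (v n (z n))\<^sup>2" using C0 by (simp add: divide_le_eq mult.commute)
      moreover have "r0\<^sup>2 * lam * (1/2)\<^sup>2 / C = cc\<^sup>2"
        using lam C0 by (simp add: cc_def power_mult_distrib power_divide)
      ultimately have "cc\<^sup>2 \<le> (- v n (z n))\<^sup>2" by simp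
      moreover have "0 \<le> - v n (z n)"
        using wneg[OF z(1,2), of n] S(1)[of n] by (simp add: v_def divide_nonpos_pos less_imp_le)
      ultimately have "cc \<le> - v n (z n)" by (rule power2_le_imp_le)
      then show ?thesis by simp
    qed
    have "\<exists>l\<in>{0..B} \<times> {0..1} \<times> {0..1}. \<exists>\<phi>. strict_mono \<phi> \<and> ((\<lambda>n. (S n, R n, z n)) \<circ> \<phi>) \<longlonglongrightarrow> l"
    proof -
      have cK: "compact ({0..B} \<times> {0..1::real} \<times> {0..1::real})" by (intro compact_Times compact_Icc)
      show ?thesis
      proof (rule cK[unfolded compact_def, rule_format])
        show "(S n, R n, z n) \<in> {0..B} \<times> {0..1} \<times> {0..1}" for n
          using S[of n] R1[of n] Mn[of n] z01[of n] by auto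
      qed
    qed
    then obtain S0 \<rho> \<zeta> \<phi> where l: "S0 \<in> {0..B}" "\<rho> \<in> {0..1}" "\<zeta> \<in> {0..1}" and \<phi>: "strict_mono \<phi>"
      and lm: "((\<lambda>n. (S n, R n, z n)) \<circ> \<phi>) \<longlonglongrightarrow> (S0, \<rho>, \<zeta>)" by blast
    have S_lim: "(\<lambda>n. S (\<phi> n)) \<longlonglongrightarrow> S0" using tendsto_fst[OF lm] by (simp add: o_def)
    have R_lim: "(\<lambda>n. R (\<phi> n)) \<longlonglongrightarrow> \<rho>" using tendsto_fst[OF tendsto_snd[OF lm]] by (simp add: o_def)
    have z_lim: "(\<lambda>n. z (\<phi> n)) \<longlonglongrightarrow> \<zeta>" using tendsto_snd[OF tendsto_snd[OF lm]] by (simp add: o_def)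
    have eps_lim': "(\<lambda>n. \<epsilon> (\<phi> n)) \<longlonglongrightarrow> 0" using LIMSEQ_subseq_LIMSEQ[OF eps_lim \<phi>] by (simp add: o_def)
    have M_lim': "(\<lambda>n. M (\<phi> n)) \<longlonglongrightarrow> 0" using LIMSEQ_subseq_LIMSEQ[OF M_lim \<phi>] by (simp add: o_def)
    have g_lim: "uniform_limit {-1..1} (\<lambda>n. g (\<phi> n)) (scaled_nl lam S0 0) sequentially"
      unfolding g_def using S eps1 by (intro scaled_nl_uniform_limit[where B = B] S_lim eps_lim') (auto simp: less_imp_le)
    have v_cont: "continuous_on {M n..1} (v n)" for n
      using ode'[of n] Mn(1)[of n] by (auto simp: radial_ode_def elim!: continuous_on_subset)
    have P_cont: "continuous_on {M n..<1} (P n)" for n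
      using ode'[of n] Mn(1)[of n] by (auto simp: radial_ode_def elim!: continuous_on_subset)
    have dv: "(v n has_real_derivative - P n x / x) (at x)" and dP: "(P n has_real_derivative x * g n (v n x)) (at x)"
      if "M n < x" "x < 1" for n x
      using ode'[of n] Mn(1)[of n] that by (auto simp: radial_ode_def)
    have "\<exists>\<psi> V Q. strict_mono (\<psi> :: nat \<Rightarrow> nat)
      \<and> uniform_limit {0..1} (\<lambda>n x. v (\<phi> (\<psi> n)) (max (M (\<phi> (\<psi> n))) x)) V sequentially
      \<and> radial_ode (scaled_nl lam S0 0) V Q \<and> V 0 = 1"
    proof (rule radial_ode_compactness[of "\<lambda>n. M (\<phi> n)" "\<lambda>n. v (\<phi> n)" "\<lambda>n. P (\<phi> n)"
          "\<lambda>n. g (\<phi> n)" C "scaled_nl lam S0 0"])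
      show "continuous_on {-1..1} (scaled_nl lam S0 0)" by (rule scaled_nl_cont) simp
    qed ((rule Mn(1) M1 M_lim' v_cont P_cont vM PM g_lim, assumption?)
        | (rule dv dP v_le g_abs; assumption) | blast)+
    then obtain \<psi> V Q where \<psi>: "strict_mono (\<psi> :: nat \<Rightarrow> nat)"
      and vV: "uniform_limit {0..1} (\<lambda>n x. v (\<phi> (\<psi> n)) (max (M (\<phi> (\<psi> n))) x)) V sequentially"
      and odeV: "radial_ode (scaled_nl lam S0 0) V Q" and V0: "V 0 = 1" by blast
    have V_cont: "continuous_on {0..1} V" using odeV by (simp add: radial_ode_def)
    define F where "F = (\<lambda>n x. v (\<phi> (\<psi> n)) (max (M (\<phi> (\<psi> n))) x))"
    have V1: "V 1 = 0"
    proof (rule LIMSEQ_unique)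
      show "(\<lambda>n. F n 1) \<longlonglongrightarrow> V 1" unfolding F_def
        by (rule uniform_limit_at_moving_points[OF vV V_cont]) auto
      have "F n 1 = 0" for n using M1[of "\<phi> (\<psi> n)"] v1 by (simp add: F_def max_def)
      then show "(\<lambda>n. F n 1) \<longlonglongrightarrow> 0" by simp
    qed
    have V\<rho>: "V \<rho> = 0"
    proof (rule LIMSEQ_unique)
      show "(\<lambda>n. F n (R (\<phi> (\<psi> n)))) \<longlonglongrightarrow> V \<rho>" unfolding F_def
      proof (rule uniform_limit_at_moving_points[OF vV V_cont])
        show "(\<lambda>n. R (\<phi> (\<psi> n))) \<longlonglongrightarrow> \<rho>" using LIMSEQ_subseq_LIMSEQ[OF R_lim \<psi>] by (simp add: o_def)
        show "R (\<phi> (\<psi> n)) \<in> {0..1}" for n using R1[of "\<phi> (\<psi> n)"] Mn[of "\<phi> (\<psi> n)"] by simp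
      qed (rule l(2))
      have "F n (R (\<phi> (\<psi> n))) = 0" for n using Mn(3)[of "\<phi> (\<psi> n)"] vR by (simp add: F_def max_def)
      then show "(\<lambda>n. F n (R (\<phi> (\<psi> n)))) \<longlonglongrightarrow> 0" by simp
    qed
    have Vz: "V \<zeta> \<le> - cc"
    proof (rule tendsto_upperbound)
      show "(\<lambda>n. F n (z (\<phi> (\<psi> n)))) \<longlonglongrightarrow> V \<zeta>" unfolding F_def
      proof (rule uniform_limit_at_moving_points[OF vV V_cont])
        show "(\<lambda>n. z (\<phi> (\<psi> n))) \<longlonglongrightarrow> \<zeta>" using LIMSEQ_subseq_LIMSEQ[OF z_lim \<psi>] by (simp add: o_def)
        show "z (\<phi> (\<psi> n)) \<in> {0..1}" for n using z01[of "\<phi> (\<psi> n)"] by simp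
      qed (rule l(3))
      have "(\<lambda>n. M (\<phi> (\<psi> n))) \<longlonglongrightarrow> 0" using LIMSEQ_subseq_LIMSEQ[OF M_lim' \<psi>] by (simp add: o_def)
      then have "\<forall>\<^sub>F n in sequentially. M (\<phi> (\<psi> n)) < r0" using r0(1) by (rule order_tendstoD(2))
      then show "\<forall>\<^sub>F n in sequentially. F n (z (\<phi> (\<psi> n))) \<le> - cc"
      proof eventually_elim
        case (elim n)
        have "M (\<phi> (\<psi> n)) < z (\<phi> (\<psi> n))" using Mn(3) z(1) less_trans by blast
        then show ?case using vz[OF elim] by (simp add: F_def max_def)
      qed
    qed simp
    show False
      by (rule limit_profile_contradiction[OF lam AY _ odeV V0 V1 _ _ V\<rho>, of \<zeta>]) (use l Vz cc in auto)
  qed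
  then obtain \<eta> where \<eta>: "0 < \<eta>" "\<And>q. \<not> bad \<eta> q" by blast
  have main: "B < w M"
    if a: "0 < \<epsilon>" "\<epsilon> < \<eta>" "radial_ode (f_nl lam \<epsilon>) w p" "w 1 = 0"
      "0 \<le> M" "M < \<eta>" "M < R" "R < R'" "R' \<le> 1" "p M = 0"
      "\<And>r. M \<le> r \<Longrightarrow> r < R \<Longrightarrow> 0 < w r" "w R = 0"
      "\<And>r. R < r \<Longrightarrow> r < R' \<Longrightarrow> w r < 0" "w R' = 0" for \<epsilon> w p M R R'
  proof (rule ccontr)
    assume "\<not> B < w M"
    then have "w M \<le> B" by simp
    then have "bad \<eta> (\<epsilon>, w, p, M, R, R')" unfolding bad_def prod.case using a by blast
    then show False using \<eta>(2) by blast
  qed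
  show thesis using \<eta>(1) main by (rule that)
qed

section \<open>The nodal intervals of a solution\<close>

text \<open>The essential supremum bounds a continuous function almost everywhere on the open interval, hence
  on a closed set of full measure, which contains the closed interval.\<close>
lemma abs_le_Linf_norm:
  fixes v :: "real \<Rightarrow> real"
  assumes ab: "a < b" and v: "continuous_on {a..b} v" and t: "t \<in> {a..b}"
  shows "\<bar>v t\<bar> \<le> Linf_norm {a<..<b} v"
proof -
  let ?N = "restrict_space lborel {a<..<b}"
  let ?f = "\<lambda>t. ereal \<bar>v t\<bar>"
  have vi: "continuous_on {a<..<b} v" by (rule continuous_on_subset[OF v]) auto
  have meas: "?f \<in> borel_measurable ?N"
  proof -
    have "v \<in> borel_measurable (restrict_space borel {a<..<b})"
      using vi by (rule borel_measurable_continuous_on_restrict)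
    moreover have "measurable ?N borel = measurable (restrict_space borel {a<..<b}) (borel :: real measure)"
      by (rule measurable_cong_sets) (simp_all add: sets_restrict_space)
    ultimately have "v \<in> borel_measurable ?N" by (simp only: )
    then show ?thesis by (intro borel_measurable_ereal borel_measurable_abs)
  qed
  obtain C where C: "\<And>s. s \<in> {a..b} \<Longrightarrow> \<bar>v s\<bar> \<le> C"
  proof -
    have "compact (v ` {a..b})" using v by (intro compact_continuous_image) auto
    then have "bounded (v ` {a..b})" by (rule compact_imp_bounded)
    then obtain C where "\<forall>x\<in>v ` {a..b}. norm x \<le> C" unfolding bounded_iff by blast
    then show thesis by (intro that[of C]) auto
  qed
  have up: "esssup ?N ?f \<le> ereal C"
  proof (rule esssup_I[OF meas AE_I2])
    fix s assume "s \<in> space ?N"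
    then have "s \<in> {a..b}" by (simp add: space_restrict_space)
    then show "?f s \<le> ereal C" using C by simp
  qed
  have ae: "AE s in lebesgue. s \<in> {a<..<b} \<longrightarrow> ?f s \<le> esssup ?N ?f"
  proof -
    have "AE s in ?N. ?f s \<le> esssup ?N ?f" by (rule esssup_AE)
    then have "AE s in lborel. s \<in> {a<..<b} \<longrightarrow> ?f s \<le> esssup ?N ?f"
      by (subst (asm) AE_restrict_space_iff) auto
    then show ?thesis by (rule AE_completion)
  qed
  have lo: "0 \<le> esssup ?N ?f"
  proof (rule ccontr)
    assume "\<not> 0 \<le> esssup ?N ?f"
    then have lt: "esssup ?N ?f < 0" by (simp only: not_le)
    have neg: "\<not> ?f s \<le> esssup ?N ?f" for s
      unfolding not_le by (rule less_le_trans[OF lt]) simp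
    have "AE s \<in> {a<..<b} in lebesgue. s \<in> {}" using ae by (rule eventually_mono) (use neg in blast)
    then have "(a + b) / 2 \<in> ({} :: real set)"
      by (rule mem_closed_if_AE_lebesgue_open[rotated 2]) (use ab in auto)
    then show False by simp
  qed
  define L where "L = Linf_norm {a<..<b} v"
  have L: "esssup ?N ?f = ereal L"
    unfolding L_def Linf_norm_def using up lo by (intro ereal_real'[symmetric]) auto
  define K where "K = {a..b} \<inter> (\<lambda>s. \<bar>v s\<bar>) -` {..L}"
  have "closed K" unfolding K_def
    by (rule continuous_closed_preimage) (use v in \<open>auto intro!: continuous_intros\<close>)
  moreover have "{a<..<b} \<subseteq> K"
  proof
    fix s assume s: "s \<in> {a<..<b}"
    have "AE x \<in> {a<..<b} in lebesgue. x \<in> K"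
      using ae by (rule eventually_mono) (auto simp: L K_def)
    then show "s \<in> K" by (rule mem_closed_if_AE_lebesgue_open[OF open_greaterThanLessThan \<open>closed K\<close> _ s])
  qed
  ultimately have "closure {a<..<b} \<subseteq> K" by (intro closure_minimal)
  then show ?thesis using t ab by (auto simp: K_def L_def)
qed

lemma radial_ode_sign:
  assumes "radial_ode g w p" "\<And>y. g (- y) = - g y" "\<sigma> = 1 \<or> \<sigma> = -1"
  shows "radial_ode g (\<lambda>t. \<sigma> * w t) (\<lambda>t. \<sigma> * p t)"
proof -
  have "(\<lambda>y. g (\<sigma> * y) / \<sigma>) = g" "(\<lambda>t. w t / \<sigma>) = (\<lambda>t. \<sigma> * w t)" "(\<lambda>t. p t / \<sigma>) = (\<lambda>t. \<sigma> * p t)"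
    using assms(2,3) by auto
  then show ?thesis using radial_ode_amplitude[OF assms(1), of \<sigma>] assms(3) by auto
qed

lemma same_sign_if_no_zero:
  fixes w :: "real \<Rightarrow> real"
  assumes c: "continuous_on {x..y} w" and xy: "x \<le> y" and nz: "\<And>t. x \<le> t \<Longrightarrow> t \<le> y \<Longrightarrow> w t \<noteq> 0"
  shows "0 < w x \<longleftrightarrow> 0 < w y"
proof (rule ccontr)
  assume a: "\<not> ?thesis"
  have "w x \<noteq> 0" "w y \<noteq> 0" using nz xy by auto
  then consider "w x < 0" "0 < w y" | "0 < w x" "w y < 0" using a by fastforce
  then have "\<exists>t. x \<le> t \<and> t \<le> y \<and> w t = 0"
  proof cases
    case 1 then show ?thesis using IVT'[of w x 0 y] c xy by auto
  next
    case 2 then show ?thesis using IVT2'[of w y 0 x] c xy by auto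
  qed
  then show False using nz by blast
qed

lemma nodes_mono:
  fixes r :: "nat \<Rightarrow> real"
  assumes rs: "\<And>i. i \<le> k \<Longrightarrow> r i < r (Suc i)" and "a \<le> b" "b \<le> Suc k"
  shows "r a \<le> r b"
  using assms(2,3)
proof (induction b rule: nat_induct)
  case (Suc b)
  show ?case
  proof (cases "a = Suc b")
    case False
    then have "r a \<le> r b" using Suc by simp
    then show ?thesis using rs[of b] Suc(3) by simp
  qed simp
qed simp

text \<open>Everything the induction over the nodal intervals uses about the \<open>i\<close>-th one, after multiplication by
  the sign \<open>\<sigma>\<close> that makes the solution positive there.  The sign changes at \<open>r i\<close> because the flux is
  strictly positive at the end of a bump.\<close>
lemma nodal_piece:
  assumes lam: "0 < lam" and eps: "0 < \<epsilon>" "\<epsilon> \<le> 1/2"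
    and ode: "radial_ode (f_nl lam \<epsilon>) w p" and w1: "w 1 = 0"
    and r0: "r 0 = 0" and rs: "\<And>i. i \<le> k \<Longrightarrow> r i < r (Suc i)" and rk: "r (Suc k) = 1"
    and zeros: "{t \<in> {0<..<1}. w t = 0} = r ` {1..k}"
    and i: "1 \<le> i" "i \<le> k"
    and M: "M \<in> {r (i - 1)..<r i}" and wM: "\<bar>w M\<bar> = S"
    and wS: "\<And>t. t \<in> {r (i - 1)..r i} \<Longrightarrow> \<bar>w t\<bar> \<le> S"
    and d: "0 < d" "2 * lam * exp (S\<^sup>2 + S powr (1 + \<epsilon>)) * S\<^sup>2 * d\<^sup>2 = 1"
  obtains \<sigma> :: real where "\<sigma> = 1 \<or> \<sigma> = -1"
    "radial_ode (f_nl lam \<epsilon>) (\<lambda>t. \<sigma> * w t) (\<lambda>t. \<sigma> * p t)"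
    "bump lam \<epsilon> M (r i) S d (\<lambda>t. \<sigma> * w t) (\<lambda>t. \<sigma> * p t)"
    "r (Suc i) \<le> 1" "\<And>t. r i < t \<Longrightarrow> t < r (Suc i) \<Longrightarrow> \<sigma> * w t < 0" "w (r (Suc i)) = 0"
    "i = 1 \<Longrightarrow> M = 0"
    "i \<noteq> 1 \<Longrightarrow> 0 < r (i - 1) \<and> r (i - 1) < M \<and> w (r (i - 1)) = 0 \<and>
       (\<forall>t. r (i - 1) < t \<and> t \<le> M \<longrightarrow> 0 < \<sigma> * w t)"
proof -
  have r_mono: "r a \<le> r b" if "a \<le> b" "b \<le> Suc k" for a b
    by (rule nodes_mono[of k r a b]) (use rs that in auto)
  have r_nonneg: "0 \<le> r a" if "a \<le> Suc k" for a using r_mono[of 0 a] that r0 by simp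
  have r_le1: "r a \<le> 1" if "a \<le> Suc k" for a using r_mono[of a "Suc k"] that rk by simp
  have no_zero: "w t \<noteq> 0" if j: "j \<le> k" and t: "r j < t" "t < r (Suc j)" for j t
  proof
    assume "w t = 0"
    moreover have "0 < t" "t < 1" using t r_nonneg[of j] r_le1[of "Suc j"] j by auto
    ultimately have "t \<in> r ` {1..k}" using zeros by auto
    then obtain a where a: "a \<in> {1..k}" "t = r a" by auto
    show False
    proof (cases "a \<le> j")
      case True then show False using r_mono[of a j] t a j by simp
    next
      case False then show False using r_mono[of "Suc j" a] t a by simp
    qed
  qed
  have node0: "w (r a) = 0" if "1 \<le> a" "a \<le> Suc k" for a
  proof (cases "a = Suc k")
    case False
    then have "r a \<in> r ` {1..k}" using that by auto
    then show ?thesis using zeros by auto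
  qed (simp add: rk w1)
  define a where "a = r (i - 1)"
  have Si: "Suc (i - 1) = i" using i by simp
  have ai: "a < r i" using rs[of "i - 1"] i Si by (simp add: a_def)
  have a0: "0 \<le> a" using r_nonneg[of "i - 1"] i by (simp add: a_def)
  have ri1: "r i < 1" using rs[of i] r_le1[of "Suc i"] i by simp
  have wc: "continuous_on {0..1} w" using ode by (simp add: radial_ode_def)
  have wsub: "continuous_on {x..y} w" if "0 \<le> x" "y \<le> 1" for x y
    using wc that by (auto elim!: continuous_on_subset)
  have nz: "w t \<noteq> 0" if "a < t" "t < r i" for t
    using no_zero[of "i - 1" t] that i Si by (simp add: a_def)
  have S0: "0 < S"
  proof -
    have "w ((a + r i) / 2) \<noteq> 0" using nz ai by simp
    moreover have "\<bar>w ((a + r i) / 2)\<bar> \<le> S" using wS[of "(a + r i) / 2"] ai by (simp add: a_def)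
    ultimately show ?thesis by linarith
  qed
  have wM0: "w M \<noteq> 0" using wM S0 by auto
  have Ma: "a < M" if "i \<noteq> 1"
  proof -
    have "w a = 0" using node0[of "i - 1"] i that by (simp add: a_def)
    then show ?thesis using wM0 M by (cases "M = a") (auto simp: a_def)
  qed
  have nz': "w t \<noteq> 0" if "a < t \<or> t = M" "t < r i" for t
    using nz that wM0 by blast
  define \<sigma> where "\<sigma> = sgn (w M)"
  have \<sigma>: "\<sigma> = 1 \<or> \<sigma> = -1" using wM0 by (auto simp: \<sigma>_def sgn_if)
  have \<sigma>M: "\<sigma> * w M = S" using wM by (auto simp: \<sigma>_def sgn_if)
  define W P where "W = (\<lambda>t. \<sigma> * w t)" and "P = (\<lambda>t. \<sigma> * p t)"
  have odeW: "radial_ode (f_nl lam \<epsilon>) W P"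
    unfolding W_def P_def by (rule radial_ode_sign[OF ode _ \<sigma>]) (rule f_nl_odd)
  have W0: "W t = 0 \<longleftrightarrow> w t = 0" for t using \<sigma> by (auto simp: W_def)
  have Wsub: "continuous_on {x..y} W" if "0 \<le> x" "y \<le> 1" for x y
    unfolding W_def using wsub[OF that] by (intro continuous_intros)
  have Wabs: "\<bar>W t\<bar> = \<bar>w t\<bar>" for t using \<sigma> by (auto simp: W_def)
  have WM: "W M = S" using \<sigma>M by (simp add: W_def)
  have W': "(W has_real_derivative - P t / t) (at t)" and P': "(P has_real_derivative t * f_nl lam \<epsilon> (W t)) (at t)"
    if "0 < t" "t < 1" for t using odeW that by (auto simp: radial_ode_def)
  have M_bd: "a \<le> M" "M < r i" "0 \<le> M" using M a0 by (auto simp: a_def)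
  have Wpos: "0 < W t" if t: "a < t \<or> t = M" "t < r i" for t
  proof (cases "M \<le> t")
    case True
    have "0 < W M \<longleftrightarrow> 0 < W t"
    proof (rule same_sign_if_no_zero[where w = W and x = M and y = t, OF _ True])
      show "continuous_on {M..t} W" using M_bd t ri1 by (intro Wsub) auto
      show "W s \<noteq> 0" if "M \<le> s" "s \<le> t" for s
        unfolding W0 using nz'[of s] that t M_bd by (cases "s = M") auto
    qed
    then show ?thesis using WM S0 by simp
  next
    case False
    then have at: "a < t" using t by auto
    have "0 < W t \<longleftrightarrow> 0 < W M"
    proof (rule same_sign_if_no_zero[where w = W and x = t and y = M])
      show "continuous_on {t..M} W" using at a0 M_bd ri1 by (intro Wsub) auto
      show "W s \<noteq> 0" if "t \<le> s" "s \<le> M" for s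
        unfolding W0 using nz[of s] that at M_bd by simp
    qed (use False in simp)
    then show ?thesis using WM S0 by simp
  qed
  have PM: "P M = 0"
  proof (cases "M = 0")
    case True then show ?thesis using odeW by (simp add: radial_ode_def)
  next
    case False
    then have M0: "0 < M" using M_bd by simp
    have aM: "a < M" using Ma False M0 r0 by (cases "i = 1") (auto simp: a_def)
    define e where "e = min (M - a) (r i - M)"
    have e: "0 < e" using aM M_bd by (simp add: e_def)
    have "- P M / M = 0"
    proof (rule DERIV_local_max[OF W'[OF M0] e])
      show "M < 1" using M_bd ri1 by simp
      show "\<forall>y. \<bar>M - y\<bar> < e \<longrightarrow> W y \<le> W M"
      proof (intro allI impI)
        fix y assume y: "\<bar>M - y\<bar> < e"
        then have "y \<in> {r (i - 1)..r i}" unfolding e_def a_def by (auto simp: abs_less_iff)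
        then have "\<bar>W y\<bar> \<le> S" using wS[of y] Wabs by simp
        then show "W y \<le> W M" using WM by simp
      qed
    qed
    then show ?thesis using M0 by simp
  qed
  have Psub: "continuous_on {x..y} P" if "0 \<le> x" "y < 1" for x y
    using radial_ode_cont_sub(2)[OF odeW that] .
  have M1: "M = 0" if i1: "i = 1"
  proof (rule ccontr)
    assume "M \<noteq> 0"
    then have M0: "0 < M" using M_bd by simp
    have a00: "a = 0" using i1 r0 by (simp add: a_def)
    have "P 0 < P M"
    proof (rule DERIV_pos_imp_increasing_open[OF M0])
      fix x assume x: "0 < x" "x < M"
      have "0 < x * f_nl lam \<epsilon> (W x)"
        using x f_nl_pos[OF lam Wpos[of x], of \<epsilon>] M_bd a00 by simp
      then show "\<exists>y. (P has_real_derivative y) (at x) \<and> 0 < y"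
        using P'[of x] x M_bd ri1 by (intro exI[of _ "x * f_nl lam \<epsilon> (W x)"]) auto
    qed (use Psub M_bd ri1 in auto)
    moreover have "P 0 = 0" using odeW by (simp add: radial_ode_def)
    ultimately show False using PM by simp
  qed
  have bump: "bump lam \<epsilon> M (r i) S d W P"
  proof
    show "continuous_on {M..r i} W" using M_bd ri1 by (intro Wsub) auto
    show "continuous_on {M..r i} P" using M_bd ri1 by (intro Psub) auto
    show "(W has_real_derivative - P t / t) (at t)" if "M < t" "t < r i" for t
      using W' that M_bd ri1 by simp
    show "(P has_real_derivative t * f_nl lam \<epsilon> (W t)) (at t)" if "M < t" "t < r i" for t
      using P' that M_bd ri1 by simp
    show "0 < W t" if "M \<le> t" "t < r i" for t
      using Wpos[of t] that M_bd by (cases "t = M") auto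
    show "W (r i) = 0" using node0[of i] i by (simp add: W0)
    show "2 * S * f_nl lam \<epsilon> S * d\<^sup>2 = 1"
      using d(2) S0 by (simp add: f_nl_eq hexp_def power2_eq_square mult_ac)
  qed (use lam eps M_bd WM PM d in auto)
  interpret b: bump lam \<epsilon> M "r i" S d W P by (rule bump)
  have rip: "0 < r i" using ai a0 by simp
  have rSi: "r (Suc i) \<le> 1" using r_le1[of "Suc i"] i by simp
  have after: "W t < 0" if t: "r i < t" "t < r (Suc i)" for t
  proof -
    have dneg: "- P (r i) / r i < 0" using b.p_pos[of "r i"] M_bd rip by simp
    obtain e where e: "0 < e" "\<And>h. 0 < h \<Longrightarrow> h < e \<Longrightarrow> W (r i + h) < W (r i)"
      using DERIV_neg_dec_right[OF W'[OF rip ri1] dneg] by auto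
    define s where "s = r i + min e (t - r i) / 2"
    have s: "r i < s" "s < t" using e(1) t by (auto simp: s_def min_def field_simps)
    have Ws: "W s < 0"
    proof -
      have "0 < min e (t - r i) / 2" "min e (t - r i) / 2 < e" using e(1) t by (auto simp: min_def)
      from e(2)[OF this] show ?thesis using b.w_R by (simp add: s_def)
    qed
    have nzt: "W x \<noteq> 0" if "r i < x" "x < r (Suc i)" for x
      unfolding W0 using no_zero[of i x] that i by simp
    have "0 < W s \<longleftrightarrow> 0 < W t"
    proof (rule same_sign_if_no_zero[where w = W and x = s and y = t])
      show "continuous_on {s..t} W" using s rip t rSi by (intro Wsub) auto
      show "W x \<noteq> 0" if "s \<le> x" "x \<le> t" for x using nzt[of x] that s t by simp
    qed (use s in simp)
    then show ?thesis using Ws nzt[OF t] by linarith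
  qed
  have wSi: "w (r (Suc i)) = 0" using node0[of "Suc i"] i by simp
  have later: "0 < r (i - 1) \<and> r (i - 1) < M \<and> w (r (i - 1)) = 0 \<and>
       (\<forall>t. r (i - 1) < t \<and> t \<le> M \<longrightarrow> 0 < \<sigma> * w t)" if "i \<noteq> 1"
  proof (intro conjI allI impI)
    have "r 0 < r 1" using rs[of 0] by simp
    also have "r 1 \<le> r (i - 1)" using r_mono[of 1 "i - 1"] i that by simp
    finally show "0 < r (i - 1)" using r0 by simp
    show "r (i - 1) < M" using Ma[OF that] by (simp add: a_def)
    show "w (r (i - 1)) = 0" using node0[of "i - 1"] i that by simp
    show "0 < \<sigma> * w t" if "r (i - 1) < t \<and> t \<le> M" for t
      using Wpos[of t] that M_bd by (simp add: a_def W_def)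
  qed
  show thesis
    by (rule that[OF \<sigma> odeW[unfolded W_def P_def] bump[unfolded W_def P_def] rSi after[unfolded W_def] wSi M1 later])
qed

section \<open>Proof of the theorem\<close>

lemma bump_scale_small:
  assumes b: "bump lam \<epsilon> M R S d w p" and \<eta>: "0 < \<eta>" and S: "1 / (2 * lam * \<eta>\<^sup>2) + 1 \<le> S"
  shows "d < \<eta>"
proof -
  interpret bump lam \<epsilon> M R S d w p by (rule b)
  have q: "0 < 2 * lam * \<eta>\<^sup>2" using lam_pos \<eta> by simp
  then have S1: "1 < S" using S divide_pos_pos[OF zero_less_one q] by linarith
  have "1 / (2 * lam * \<eta>\<^sup>2) < S" using S by linarith
  also have "S \<le> S * S" using S1 mult_left_mono[of 1 S S] by simp
  finally have "1 < S * S * (2 * lam * \<eta>\<^sup>2)" using q by (simp add: pos_divide_less_eq)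
  moreover have "2 * S * (lam * S) * d\<^sup>2 \<le> 2 * S * f_nl lam \<epsilon> S * d\<^sup>2"
    using f_nl_ge_linear[OF lam_pos, of S \<epsilon>] S1 by (intro mult_right_mono mult_left_mono) auto
  ultimately have "2 * S * (lam * S) * d\<^sup>2 < 2 * S * (lam * S) * \<eta>\<^sup>2"
    using d_eq by (simp add: mult_ac)
  then have "d\<^sup>2 < \<eta>\<^sup>2" using S1 lam_pos by simp
  then show ?thesis by (rule power2_less_imp_less) (use \<eta> in simp)
qed

text \<open>A compact subset of the half-line lies below some \<open>X\<close>, and eventually \<open>M + d X\<close> lies to the left of the
  zero \<open>R\<close>, so that the rescaled functions are given by the bump there.\<close>
lemma rescaled_bumps_converge:
  fixes F :: "'a filter" and S M d R \<epsilon> :: "'a \<Rightarrow> real" and v :: "'a \<Rightarrow> real \<Rightarrow> real"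
  assumes ev: "\<forall>\<^sub>F e in F. \<exists>W P. bump lam (\<epsilon> e) (M e) (R e) (S e) (d e) W P \<and>
        (\<forall>t. M e \<le> t \<longrightarrow> t < R e \<longrightarrow> \<bar>v e t\<bar> = W t)"
    and S: "\<And>B. \<forall>\<^sub>F e in F. B < S e" and m: "\<And>\<mu>. 0 < \<mu> \<Longrightarrow> \<forall>\<^sub>F e in F. (M e)\<^sup>2 \<le> \<mu> * (d e)\<^sup>2"
  shows "C1_loc_limit {0<..} (\<lambda>e t. 2 * S e * (\<bar>v e (M e + d e * t)\<bar> - S e))
      (\<lambda>t. ln (1 / (1 + t\<^sup>2 / 8)\<^sup>2)) F"
  unfolding C1_loc_limit_def bubble_def[symmetric]
proof (intro allI impI)
  fix K :: "real set" assume K: "compact K \<and> K \<subseteq> {0<..}"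
  define f where "f = (\<lambda>e t. 2 * S e * (\<bar>v e (M e + d e * t)\<bar> - S e))"
  obtain X where X: "0 < X" "\<And>t. t \<in> K \<Longrightarrow> 0 < t \<and> t < X"
  proof -
    have "bounded K" using K compact_imp_bounded by blast
    then obtain B where B: "\<And>t. t \<in> K \<Longrightarrow> \<bar>t\<bar> \<le> B" unfolding bounded_iff by auto
    show thesis
    proof (rule that[of "\<bar>B\<bar> + 1"])
      fix t assume t: "t \<in> K"
      then have "0 < t" using K by auto
      then show "0 < t \<and> t < \<bar>B\<bar> + 1" using B[OF t] by simp
    qed simp
  qed
  have main: "\<forall>\<^sub>F e in F. \<exists>D. continuous_on {0<..<X} D \<and> (\<forall>t\<in>{0<..<X}.
      (f e has_real_derivative D t) (at t) \<and> \<bar>f e t - bubble t\<bar> \<le> \<eta> \<and> \<bar>D t - bubble' t\<bar> \<le> \<eta>)"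
    if \<eta>: "0 < \<eta>" for \<eta>
  proof -
    show ?thesis
    proof (rule bump_bubble[OF X(1) \<eta>])
      fix S0 \<mu> :: real
      assume \<mu>: "0 < \<mu>"
        and bb: "\<And>lam \<epsilon> M R S d w p t. bump lam \<epsilon> M R S d w p \<Longrightarrow> S0 \<le> S \<Longrightarrow> M\<^sup>2 \<le> \<mu> * d\<^sup>2 \<Longrightarrow> 0 < t \<Longrightarrow> t \<le> X \<Longrightarrow>
          M + d * t < R \<and> \<bar>2 * S * (w (M + d * t) - S) - bubble t\<bar> \<le> \<eta>
          \<and> \<bar>2 * S * d * (- p (M + d * t) / (M + d * t)) - bubble' t\<bar> \<le> \<eta>"
      show ?thesis using ev S[of S0] m[OF \<mu>]
      proof eventually_elim
        case (elim e)
        then obtain W P where b: "bump lam (\<epsilon> e) (M e) (R e) (S e) (d e) W P"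
          and vW: "\<And>t. M e \<le> t \<Longrightarrow> t < R e \<Longrightarrow> \<bar>v e t\<bar> = W t" by blast
        interpret bump lam "\<epsilon> e" "M e" "R e" "S e" "d e" W P by (rule b)
        have bt: "M e + d e * t < R e" "\<bar>2 * S e * (W (M e + d e * t) - S e) - bubble t\<bar> \<le> \<eta>"
          "\<bar>2 * S e * d e * (- P (M e + d e * t) / (M e + d e * t)) - bubble' t\<bar> \<le> \<eta>"
          if "0 < t" "t < X" for t
          using bb[OF b less_imp_le[OF elim(2)] elim(3) that(1) less_imp_le[OF that(2)]] by auto
        have gt: "M e < M e + d e * t" if "0 < t" for t using d_pos that by simp
        have fW: "f e t = 2 * S e * (W (M e + d e * t) - S e)" if "0 < t" "t < X" for t
          unfolding f_def using vW[OF less_imp_le[OF gt[OF that(1)]] bt(1)[OF that]] by simp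
        define D where "D = (\<lambda>t. 2 * S e * d e * (- P (M e + d e * t) / (M e + d e * t)))"
        have pos: "0 < M e + d e * t" if "0 < t" for t using gt[OF that] M_nonneg by linarith
        have "continuous_on {0<..<X} D"
        proof -
          have "continuous_on {0<..<X} (\<lambda>t. P (M e + d e * t))"
          proof (rule continuous_on_compose2[OF p_cont])
            show "(\<lambda>t. M e + d e * t) ` {0<..<X} \<subseteq> {M e..R e}"
            proof
              fix y assume "y \<in> (\<lambda>t. M e + d e * t) ` {0<..<X}"
              then obtain t where "y = M e + d e * t" "t \<in> {0<..<X}" by (rule imageE)
              then show "y \<in> {M e..R e}" using gt[of t] bt(1)[of t] by simp
            qed
          qed (intro continuous_intros)
          moreover have "\<forall>t\<in>{0<..<X}. M e + d e * t \<noteq> 0"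
          proof
            fix t assume "t \<in> {0<..<X}"
            then show "M e + d e * t \<noteq> 0" using pos[of t] by simp
          qed
          ultimately show ?thesis unfolding D_def by (intro continuous_intros)
        qed
        moreover have "(f e has_real_derivative D t) (at t)" if t: "t \<in> {0<..<X}" for t
        proof -
          have t': "0 < t" "t < X" using t by auto
          have l: "((\<lambda>t. M e + d e * t) has_real_derivative d e) (at t)"
            by (auto intro!: derivative_eq_intros)
          have Wd: "((\<lambda>t. W (M e + d e * t)) has_real_derivative - P (M e + d e * t) / (M e + d e * t) * d e) (at t)"
            by (rule DERIV_chain2[OF w_deriv[OF gt[OF t'(1)] bt(1)[OF t']] l])
          have "((\<lambda>t. 2 * S e * (W (M e + d e * t) - S e)) has_real_derivative
              2 * S e * (- P (M e + d e * t) / (M e + d e * t) * d e - 0)) (at t)"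
            by (rule DERIV_cmult[OF DERIV_diff[OF Wd DERIV_const]])
          moreover have "2 * S e * (- P (M e + d e * t) / (M e + d e * t) * d e - 0) = D t"
            unfolding D_def by simp
          ultimately have "((\<lambda>t. 2 * S e * (W (M e + d e * t) - S e)) has_real_derivative D t) (at t)"
            by (simp only: )
          then show ?thesis
            by (rule has_field_derivative_transform_within_open[where S = "{0<..<X}"]) (use t fW in auto)
        qed
        moreover have "\<bar>f e t - bubble t\<bar> \<le> \<eta> \<and> \<bar>D t - bubble' t\<bar> \<le> \<eta>" if t: "t \<in> {0<..<X}" for t
          using bt(2,3)[of t] fW[of t] t unfolding D_def by simp
        ultimately show ?case by blast
      qed
    qed
  qed
  have KX: "K \<subseteq> {0<..<X}" using X(2) by auto
  have db: "deriv bubble t = bubble' t" for t using bubble_deriv by (rule DERIV_imp_deriv)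
  have "\<forall>\<^sub>F e in F. f e C1_differentiable_on K"
    using main[OF zero_less_one]
  proof eventually_elim
    case (elim e)
    then obtain D where D: "continuous_on {0<..<X} D" "\<And>t. t \<in> {0<..<X} \<Longrightarrow> (f e has_real_derivative D t) (at t)"
      by blast
    show ?case unfolding C1_differentiable_on_def
    proof (intro exI[of _ D] conjI ballI)
      show "continuous_on K D" by (rule continuous_on_subset[OF D(1) KX])
      show "(f e has_vector_derivative D t) (at t)" if "t \<in> K" for t
        using D(2)[of t] that KX by (auto simp: has_real_derivative_iff_has_vector_derivative)
    qed
  qed
  moreover have "uniform_limit K f bubble F \<and> uniform_limit K (\<lambda>e. deriv (f e)) (deriv bubble) F"
  proof -
    have "\<forall>\<^sub>F e in F. \<forall>t\<in>K. dist (f e t) (bubble t) < \<eta> \<and> dist (deriv (f e) t) (deriv bubble t) < \<eta>"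
      if \<eta>: "0 < \<eta>" for \<eta>
    proof -
      have "0 < \<eta> / 2" using \<eta> by simp
      from main[OF this] show ?thesis
      proof eventually_elim
        case (elim e)
        then obtain D where D: "\<And>t. t \<in> {0<..<X} \<Longrightarrow> (f e has_real_derivative D t) (at t)"
          "\<And>t. t \<in> {0<..<X} \<Longrightarrow> \<bar>f e t - bubble t\<bar> \<le> \<eta> / 2"
          "\<And>t. t \<in> {0<..<X} \<Longrightarrow> \<bar>D t - bubble' t\<bar> \<le> \<eta> / 2"
          by blast
        show ?case
        proof
          fix t assume "t \<in> K"
          then have t: "t \<in> {0<..<X}" using KX by blast
          have "deriv (f e) t = D t" using D(1)[OF t] by (rule DERIV_imp_deriv)
          then show "dist (f e t) (bubble t) < \<eta> \<and> dist (deriv (f e) t) (deriv bubble t) < \<eta>"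
            using D(2,3)[OF t] \<eta> by (simp add: dist_norm db)
        qed
      qed
    qed
    note lim = this
    show ?thesis unfolding uniform_limit_iff
    proof (intro conjI allI impI)
      fix \<eta> :: real assume "0 < \<eta>"
      from lim[OF this] show "\<forall>\<^sub>F e in F. \<forall>t\<in>K. dist (f e t) (bubble t) < \<eta>"
        by (rule eventually_mono) blast
    next
      fix \<eta> :: real assume "0 < \<eta>"
      from lim[OF this] show "\<forall>\<^sub>F e in F. \<forall>t\<in>K. dist (deriv (f e) t) (deriv bubble t) < \<eta>"
        by (rule eventually_mono) blast
    qed
  qed
  moreover have "(\<lambda>t. bubble t) = bubble" ..
  ultimately show "(\<forall>\<^sub>F e in F. (\<lambda>t. 2 * S e * (\<bar>v e (M e + d e * t)\<bar> - S e)) C1_differentiable_on K) \<and>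
      uniform_limit K (\<lambda>e t. 2 * S e * (\<bar>v e (M e + d e * t)\<bar> - S e)) (\<lambda>t. bubble t) F \<and>
      uniform_limit K (\<lambda>e. deriv (\<lambda>t. 2 * S e * (\<bar>v e (M e + d e * t)\<bar> - S e))) (deriv (\<lambda>t. bubble t)) F"
    unfolding f_def by blast
qed

theorem theorem1p3:
  fixes k :: nat
    and lam lamAY :: real
    and u :: "real \<Rightarrow> plane \<Rightarrow> real"
    and r :: "real \<Rightarrow> nat \<Rightarrow> real"
    and S M \<gamma> \<delta> :: "nat \<Rightarrow> real \<Rightarrow> real"
  assumes "k \<ge> 1"
    and "lamAY > 0"
    and "\<forall>\<mu>\<in>{0<..<lamAY}. no_sign_changing_radial_solution \<mu>"
    and "0 < lam" and "lam < min lambda1 lamAY"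
    and "\<forall>\<^sub>F \<epsilon> in at_right 0. least_energy_nodal_solution k lam \<epsilon> (u \<epsilon>) \<and>
           interior_nodes k (u \<epsilon>) (r \<epsilon>) \<and> u \<epsilon> 0 > 0"
  defines "S \<equiv> \<lambda>i \<epsilon>. Linf_norm {r \<epsilon> (i - 1)<..<r \<epsilon> i} (profile (u \<epsilon>))"
  assumes "\<forall>\<^sub>F \<epsilon> in at_right 0. \<forall>i\<in>{1..k}.
           M i \<epsilon> \<in> {r \<epsilon> (i - 1)..<r \<epsilon> i} \<and> \<bar>profile (u \<epsilon>) (M i \<epsilon>)\<bar> = S i \<epsilon>"
    and "\<forall>\<^sub>F \<epsilon> in at_right 0. \<forall>i\<in>{1..k}. \<gamma> i \<epsilon> > 0 \<and>
           2 * lam * (r \<epsilon> i)\<^sup>2 * exp ((S i \<epsilon>)\<^sup>2 + S i \<epsilon> powr (1 + \<epsilon>)) * (S i \<epsilon>)\<^sup>2 * (\<gamma> i \<epsilon>)\<^sup>2 = 1"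
  defines "\<delta> \<equiv> \<lambda>i \<epsilon>. r \<epsilon> i * \<gamma> i \<epsilon>"
  shows "\<forall>i\<in>{1..k}.
    (\<delta> i \<longlongrightarrow> 0) (at_right 0) \<and>
    C1_loc_limit {0<..}
      (\<lambda>\<epsilon> t. 2 * S i \<epsilon> * (\<bar>profile (u \<epsilon>) (M i \<epsilon> + \<delta> i \<epsilon> * t)\<bar> - S i \<epsilon>))
      (\<lambda>t. ln (1 / (1 + t\<^sup>2 / 8)\<^sup>2))
      (at_right 0)"
proof -
  have lam: "0 < lam" "lam < lambda1" and AY: "no_sign_changing_radial_solution lam"
    using assms(3-5) by auto
  define w where "w = (\<lambda>\<epsilon>. profile (u \<epsilon>))"
  define p where "p = (\<lambda>\<epsilon> t. - t * deriv (w \<epsilon>) t)"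
  \<comment> \<open>The conclusion of \<open>nodal_piece\<close>, with the sign \<open>\<sigma>\<close> as a parameter.\<close>
  define piece where "piece = (\<lambda>i \<epsilon> \<sigma>. (\<sigma> = 1 \<or> \<sigma> = - 1) \<and>
     radial_ode (f_nl lam \<epsilon>) (\<lambda>t. \<sigma> * w \<epsilon> t) (\<lambda>t. \<sigma> * p \<epsilon> t) \<and> w \<epsilon> 1 = 0 \<and>
     bump lam \<epsilon> (M i \<epsilon>) (r \<epsilon> i) (S i \<epsilon>) (\<delta> i \<epsilon>) (\<lambda>t. \<sigma> * w \<epsilon> t) (\<lambda>t. \<sigma> * p \<epsilon> t) \<and>
     r \<epsilon> i < r \<epsilon> (Suc i) \<and> r \<epsilon> (Suc i) \<le> 1 \<and>
     (\<forall>t. r \<epsilon> i < t \<longrightarrow> t < r \<epsilon> (Suc i) \<longrightarrow> \<sigma> * w \<epsilon> t < 0) \<and> w \<epsilon> (r \<epsilon> (Suc i)) = 0 \<and>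
     (i = 1 \<longrightarrow> M i \<epsilon> = 0) \<and>
     (i \<noteq> 1 \<longrightarrow> 0 < r \<epsilon> (i - 1) \<and> r \<epsilon> (i - 1) < M i \<epsilon> \<and> w \<epsilon> (r \<epsilon> (i - 1)) = 0 \<and>
       (\<forall>t. r \<epsilon> (i - 1) < t \<and> t \<le> M i \<epsilon> \<longrightarrow> 0 < \<sigma> * w \<epsilon> t)))"
  have small: "\<forall>\<^sub>F \<epsilon> in at_right 0. 0 < \<epsilon> \<and> \<epsilon> < (b :: real)" if "0 < b" for b
    using eventually_at_right_real[OF that] by simp
  have pieces: "\<forall>\<^sub>F \<epsilon> in at_right 0. \<forall>i\<in>{1..k}. \<exists>\<sigma>. piece i \<epsilon> \<sigma>"
    using assms(6,8,9) small[of "1/2", simplified]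
  proof eventually_elim
    case (elim \<epsilon>)
    have un: "u \<epsilon> \<in> nehari_nodal k lam \<epsilon>" and sol: "dirichlet_solution (f_nl lam \<epsilon>) (u \<epsilon>)"
      using elim(1) by (simp_all add: least_energy_nodal_solution_def)
    have rad: "radial (u \<epsilon>)" using un by (simp add: nehari_nodal_def H10_rad_def)
    have ode: "radial_ode (f_nl lam \<epsilon>) (w \<epsilon>) (p \<epsilon>)" and w1: "w \<epsilon> 1 = 0"
      using radial_solution_imp_ode[OF rad sol] by (simp_all add: w_def p_def)
    have r0: "r \<epsilon> 0 = 0" and rs: "\<And>i. i \<le> k \<Longrightarrow> r \<epsilon> i < r \<epsilon> (Suc i)" and rk: "r \<epsilon> (Suc k) = 1"
      and zeros: "{t \<in> {0<..<1}. w \<epsilon> t = 0} = r \<epsilon> ` {1..k}"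
      using elim(1) by (simp_all add: interior_nodes_def w_def)
    have e: "0 < \<epsilon>" "\<epsilon> \<le> 1/2" using elim(4) by simp_all
    show ?case
    proof
      fix i assume i: "i \<in> {1..k}"
      then have i': "1 \<le> i" "i \<le> k" "Suc (i - 1) = i" by auto
      have rpos: "0 < r \<epsilon> i" using nodes_mono[of k "r \<epsilon>" 0 "i - 1", OF rs] rs[of "i - 1"] r0 i' by simp
      have Mi: "M i \<epsilon> \<in> {r \<epsilon> (i - 1)..<r \<epsilon> i}" "\<bar>w \<epsilon> (M i \<epsilon>)\<bar> = S i \<epsilon>"
        using elim(2) i by (simp_all add: w_def)
      have d: "0 < \<delta> i \<epsilon>" using elim(3) i rpos by (simp add: \<delta>_def)
      have deq: "2 * lam * exp ((S i \<epsilon>)\<^sup>2 + S i \<epsilon> powr (1 + \<epsilon>)) * (S i \<epsilon>)\<^sup>2 * (\<delta> i \<epsilon>)\<^sup>2 = 1"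
      proof -
        have "2 * lam * (r \<epsilon> i)\<^sup>2 * exp ((S i \<epsilon>)\<^sup>2 + S i \<epsilon> powr (1 + \<epsilon>)) * (S i \<epsilon>)\<^sup>2 * (\<gamma> i \<epsilon>)\<^sup>2 = 1"
          using elim(3) i by blast
        then show ?thesis by (simp add: \<delta>_def power_mult_distrib mult_ac)
      qed
      have wS: "\<bar>w \<epsilon> t\<bar> \<le> S i \<epsilon>" if "t \<in> {r \<epsilon> (i - 1)..r \<epsilon> i}" for t
      proof -
        have wu: "profile (u \<epsilon>) = w \<epsilon>" by (simp add: w_def)
        show ?thesis unfolding S_def wu
        proof (rule abs_le_Linf_norm[OF _ _ that])
        show "r \<epsilon> (i - 1) < r \<epsilon> i" using rs[of "i - 1"] i' by simp
        have "0 \<le> r \<epsilon> (i - 1)" using nodes_mono[of k "r \<epsilon>" 0 "i - 1", OF rs] r0 i' by simp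
        moreover have "r \<epsilon> i \<le> 1" using nodes_mono[of k "r \<epsilon>" i "Suc k", OF rs] rk i' by simp
        ultimately show "continuous_on {r \<epsilon> (i - 1)..r \<epsilon> i} (w \<epsilon>)"
          using ode by (auto simp: radial_ode_def elim!: continuous_on_subset)
        qed
      qed
      show "\<exists>\<sigma>. piece i \<epsilon> \<sigma>"
      proof (rule nodal_piece[where lam = lam and \<epsilon> = \<epsilon> and w = "w \<epsilon>" and p = "p \<epsilon>" and r = "r \<epsilon>"
            and k = k and i = i and M = "M i \<epsilon>" and S = "S i \<epsilon>" and d = "\<delta> i \<epsilon>",
            OF lam(1) e ode w1 r0 rs rk zeros i'(1,2) Mi wS d deq], assumption, assumption, goal_cases)
        case (1 \<sigma>)
        then have "piece i \<epsilon> \<sigma>" unfolding piece_def using w1 rs[OF i'(2)] by blast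
        then show ?case by blast
      qed
    qed
  qed
  \<comment> \<open>The property handed over from one nodal interval to the next.\<close>
  define H where "H = (\<lambda>i. \<forall>\<eta>>0. \<forall>\<^sub>F \<epsilon> in at_right 0. r \<epsilon> i \<le> \<eta> \<and> (p \<epsilon> (r \<epsilon> i))\<^sup>2 * ln (1 / r \<epsilon> i) \<le> \<eta>)"
  have step: "(\<forall>B. \<forall>\<^sub>F \<epsilon> in at_right 0. B < S i \<epsilon>) \<and>
      (\<forall>\<mu>>0. \<forall>\<^sub>F \<epsilon> in at_right 0. (M i \<epsilon>)\<^sup>2 \<le> \<mu> * (\<delta> i \<epsilon>)\<^sup>2) \<and> H i"
    if i: "i \<in> {1..k}" and IH: "i \<noteq> 1 \<Longrightarrow> H (i - 1)" for i
  proof -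
    have pc: "\<forall>\<^sub>F \<epsilon> in at_right 0. \<exists>\<sigma>. piece i \<epsilon> \<sigma>"
      using pieces by eventually_elim (use i in blast)
    have Mz: "\<forall>\<^sub>F \<epsilon> in at_right 0. M i \<epsilon> < \<eta>" if \<eta>: "0 < \<eta>" for \<eta>
    proof (cases "i = 1")
      case True
      show ?thesis using pc 
      proof eventually_elim
        case (elim \<epsilon>)
        then have "M i \<epsilon> = 0" using True unfolding piece_def by blast
        then show ?case using \<eta> by simp
      qed
    next
      case False
      \<comment> \<open>If \<open>M \<ge> \<eta>\<close> and the left end is below \<open>\<eta> exp (- c)\<close>, the ascent has logarithmic length at least \<open>c\<close>;
            this \<open>c\<close> is so large that \<open>entry_max_point_small\<close> forces \<open>M < \<eta>\<close>.\<close>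
      define c where "c = 4 + 8 / (lam * \<eta>\<^sup>2)"
      have c: "4 < c" using lam \<eta> by (simp add: c_def)
      have "0 < \<eta> * exp (- c)" using \<eta> by simp
      then have "\<forall>\<^sub>F \<epsilon> in at_right 0. r \<epsilon> (i - 1) \<le> \<eta> * exp (- c)"
      proof -
        assume "0 < \<eta> * exp (- c)"
        with IH[OF False] have "\<forall>\<^sub>F \<epsilon> in at_right 0. r \<epsilon> (i - 1) \<le> \<eta> * exp (- c)
            \<and> (p \<epsilon> (r \<epsilon> (i - 1)))\<^sup>2 * ln (1 / r \<epsilon> (i - 1)) \<le> \<eta> * exp (- c)"
          unfolding H_def by blast
        then show ?thesis by (rule eventually_mono) blast
      qed
      then show ?thesis using pc small[of "1", simplified]
      proof eventually_elim
        case (elim \<epsilon>)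
        then obtain \<sigma> where pc: "piece i \<epsilon> \<sigma>" by blast
        let ?a = "r \<epsilon> (i - 1)"
        have a: "0 < ?a" "?a < M i \<epsilon>" "w \<epsilon> ?a = 0" and pos: "\<And>t. ?a < t \<Longrightarrow> t \<le> M i \<epsilon> \<Longrightarrow> 0 < \<sigma> * w \<epsilon> t"
          using pc False unfolding piece_def by blast+
        have b: "bump lam \<epsilon> (M i \<epsilon>) (r \<epsilon> i) (S i \<epsilon>) (\<delta> i \<epsilon>) (\<lambda>t. \<sigma> * w \<epsilon> t) (\<lambda>t. \<sigma> * p \<epsilon> t)"
          and ode: "radial_ode (f_nl lam \<epsilon>) (\<lambda>t. \<sigma> * w \<epsilon> t) (\<lambda>t. \<sigma> * p \<epsilon> t)"
          using pc unfolding piece_def by blast+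
        have M1: "M i \<epsilon> < 1"
        proof -
          have "r \<epsilon> i < r \<epsilon> (Suc i)" "r \<epsilon> (Suc i) \<le> 1" using pc unfolding piece_def by blast+
          then show ?thesis using bump.MR[OF b] by linarith
        qed
        show "M i \<epsilon> < \<eta>"
        proof (rule ccontr)
          assume "\<not> M i \<epsilon> < \<eta>"
          then have Me: "\<eta> \<le> M i \<epsilon>" by simp
          have "ln ?a \<le> ln (\<eta> * exp (- c))" using elim(1) a \<eta> by (subst ln_le_cancel_iff) auto
          also have "\<dots> = ln \<eta> - c" using \<eta> by (simp add: ln_mult_pos)
          also have "ln \<eta> \<le> ln (M i \<epsilon>)" using Me \<eta> by (subst ln_le_cancel_iff) auto
          finally have L: "c \<le> ln (M i \<epsilon> / ?a)" using a by (simp add: ln_div)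
          have "(M i \<epsilon>)\<^sup>2 \<le> 8 / (lam * (ln (M i \<epsilon> / ?a) - 1))"
          proof (rule entry_max_point_small[where w = "\<lambda>t. \<sigma> * w \<epsilon> t" and p = "\<lambda>t. \<sigma> * p \<epsilon> t" and \<epsilon> = \<epsilon>])
            show "continuous_on {?a..M i \<epsilon>} (\<lambda>t. \<sigma> * w \<epsilon> t)" "continuous_on {?a..M i \<epsilon>} (\<lambda>t. \<sigma> * p \<epsilon> t)"
              using radial_ode_cont_sub[OF ode, of ?a "M i \<epsilon>"] a M1 by auto
            show "((\<lambda>t. \<sigma> * w \<epsilon> t) has_real_derivative - (\<sigma> * p \<epsilon> x) / x) (at x)"
              "((\<lambda>t. \<sigma> * p \<epsilon> t) has_real_derivative x * f_nl lam \<epsilon> (\<sigma> * w \<epsilon> x)) (at x)"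
              if "?a < x" "x < M i \<epsilon>" for x
              using ode that a M1 by (auto simp: radial_ode_def)
            show "\<sigma> * p \<epsilon> (M i \<epsilon>) = 0" using bump.p_M[OF b] .
          qed (use lam elim(3) a pos L c in auto)
          also have "\<dots> < \<eta>\<^sup>2"
          proof -
            have "8 / (lam * \<eta>\<^sup>2) < ln (M i \<epsilon> / ?a) - 1" using L by (simp add: c_def)
            then have "8 < (ln (M i \<epsilon> / ?a) - 1) * (lam * \<eta>\<^sup>2)" using lam \<eta> by (simp add: pos_divide_less_eq)
            moreover have "0 < lam * (ln (M i \<epsilon> / ?a) - 1)" using lam L c by simp
            ultimately show ?thesis by (simp add: pos_divide_less_eq mult_ac)
          qed
          also have "\<eta>\<^sup>2 \<le> (M i \<epsilon>)\<^sup>2" using Me \<eta> by (intro power_mono) auto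
          finally show False by simp
        qed
      qed
    qed
    have Sinf: "\<forall>\<^sub>F \<epsilon> in at_right 0. B < S i \<epsilon>" for B
    proof -
      show ?thesis
      proof (rule heights_unbounded[OF lam AY, of B])
        fix \<eta> :: real
        assume \<eta>: "0 < \<eta>"
          "\<And>\<epsilon> w p M R R'. 0 < \<epsilon> \<Longrightarrow> \<epsilon> < \<eta> \<Longrightarrow> radial_ode (f_nl lam \<epsilon>) w p \<Longrightarrow> w 1 = 0 \<Longrightarrow>
            0 \<le> M \<Longrightarrow> M < \<eta> \<Longrightarrow> M < R \<Longrightarrow> R < R' \<Longrightarrow> R' \<le> 1 \<Longrightarrow> p M = 0 \<Longrightarrow>
            (\<And>r. M \<le> r \<Longrightarrow> r < R \<Longrightarrow> 0 < w r) \<Longrightarrow> w R = 0 \<Longrightarrow>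
            (\<And>r. R < r \<Longrightarrow> r < R' \<Longrightarrow> w r < 0) \<Longrightarrow> w R' = 0 \<Longrightarrow> B < w M"
        show ?thesis using Mz[OF \<eta>(1)] small[OF \<eta>(1)] pc
        proof eventually_elim
          case (elim \<epsilon>)
          then obtain \<sigma> where pc: "piece i \<epsilon> \<sigma>" by blast
          then have b: "bump lam \<epsilon> (M i \<epsilon>) (r \<epsilon> i) (S i \<epsilon>) (\<delta> i \<epsilon>) (\<lambda>t. \<sigma> * w \<epsilon> t) (\<lambda>t. \<sigma> * p \<epsilon> t)"
            and ode: "radial_ode (f_nl lam \<epsilon>) (\<lambda>t. \<sigma> * w \<epsilon> t) (\<lambda>t. \<sigma> * p \<epsilon> t)"
            and w1: "w \<epsilon> 1 = 0" and R': "r \<epsilon> i < r \<epsilon> (Suc i)" "r \<epsilon> (Suc i) \<le> 1" "w \<epsilon> (r \<epsilon> (Suc i)) = 0"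
            and neg: "\<And>t. r \<epsilon> i < t \<Longrightarrow> t < r \<epsilon> (Suc i) \<Longrightarrow> \<sigma> * w \<epsilon> t < 0"
            unfolding piece_def by blast+
          interpret bump lam \<epsilon> "M i \<epsilon>" "r \<epsilon> i" "S i \<epsilon>" "\<delta> i \<epsilon>" "\<lambda>t. \<sigma> * w \<epsilon> t" "\<lambda>t. \<sigma> * p \<epsilon> t" by (rule b)
          have "B < \<sigma> * w \<epsilon> (M i \<epsilon>)"
            by (rule \<eta>(2)[OF _ _ ode _ M_nonneg elim(1) MR R'(1,2) p_M w_pos w_R neg])
              (use elim(2) w1 R'(3) in auto)
          then show ?case using w_M by simp
        qed
      qed
    qed
    have Md: "\<forall>\<^sub>F \<epsilon> in at_right 0. (M i \<epsilon>)\<^sup>2 \<le> \<mu> * (\<delta> i \<epsilon>)\<^sup>2" if \<mu>: "0 < \<mu>" for \<mu>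
    proof (cases "i = 1")
      case True
      show ?thesis using pc
      proof eventually_elim
        case (elim \<epsilon>)
        then have "M i \<epsilon> = 0" using True unfolding piece_def by blast
        then show ?case using \<mu> by simp
      qed
    next
      case False
      define \<kappa> where "\<kappa> = min (1/32) (\<mu> / 32)"
      have \<kappa>: "0 < \<kappa>" "\<kappa> \<le> 1/32" "32 * \<kappa> \<le> \<mu>" using \<mu> by (auto simp: \<kappa>_def)
      have "\<forall>\<^sub>F \<epsilon> in at_right 0. r \<epsilon> (i - 1) \<le> \<kappa> \<and> (p \<epsilon> (r \<epsilon> (i - 1)))\<^sup>2 * ln (1 / r \<epsilon> (i - 1)) \<le> \<kappa>"
        using IH[OF False] \<kappa>(1) unfolding H_def by blast
      then show ?thesis using pc small[of "1", simplified] Sinf[of 1]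
      proof eventually_elim
        case (elim \<epsilon>)
        then obtain \<sigma> where pc: "piece i \<epsilon> \<sigma>" by blast
        let ?a = "r \<epsilon> (i - 1)"
        have a: "0 < ?a" "?a < M i \<epsilon>" "w \<epsilon> ?a = 0" and pos: "\<And>t. ?a < t \<Longrightarrow> t \<le> M i \<epsilon> \<Longrightarrow> 0 < \<sigma> * w \<epsilon> t"
          using pc False unfolding piece_def by blast+
        have b: "bump lam \<epsilon> (M i \<epsilon>) (r \<epsilon> i) (S i \<epsilon>) (\<delta> i \<epsilon>) (\<lambda>t. \<sigma> * w \<epsilon> t) (\<lambda>t. \<sigma> * p \<epsilon> t)"
          and ode: "radial_ode (f_nl lam \<epsilon>) (\<lambda>t. \<sigma> * w \<epsilon> t) (\<lambda>t. \<sigma> * p \<epsilon> t)"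
          and \<sigma>: "\<sigma> = 1 \<or> \<sigma> = -1"
          using pc unfolding piece_def by blast+
        have M1: "M i \<epsilon> < 1"
        proof -
          have "r \<epsilon> i < r \<epsilon> (Suc i)" "r \<epsilon> (Suc i) \<le> 1" using pc unfolding piece_def by blast+
          then show ?thesis using bump.MR[OF b] by linarith
        qed
        have wM: "\<sigma> * w \<epsilon> (M i \<epsilon>) = S i \<epsilon>" using bump.w_M[OF b] .
        have p2: "(\<sigma> * p \<epsilon> ?a)\<^sup>2 = (p \<epsilon> ?a)\<^sup>2" using \<sigma> by auto
        have "(M i \<epsilon>)\<^sup>2 \<le> 32 * \<kappa> * (\<delta> i \<epsilon>)\<^sup>2"
        proof (rule entry_max_point_vs_scale[where w = "\<lambda>t. \<sigma> * w \<epsilon> t" and p = "\<lambda>t. \<sigma> * p \<epsilon> t" and \<epsilon> = \<epsilon> and a = ?a and lam = lam])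
          show "continuous_on {?a..M i \<epsilon>} (\<lambda>t. \<sigma> * w \<epsilon> t)" "continuous_on {?a..M i \<epsilon>} (\<lambda>t. \<sigma> * p \<epsilon> t)"
            using radial_ode_cont_sub[OF ode, of ?a "M i \<epsilon>"] a M1 by auto
          show "((\<lambda>t. \<sigma> * w \<epsilon> t) has_real_derivative - (\<sigma> * p \<epsilon> x) / x) (at x)"
            "((\<lambda>t. \<sigma> * p \<epsilon> t) has_real_derivative x * f_nl lam \<epsilon> (\<sigma> * w \<epsilon> x)) (at x)"
            if "?a < x" "x < M i \<epsilon>" for x
            using ode that a M1 by (auto simp: radial_ode_def)
          show "\<sigma> * p \<epsilon> (M i \<epsilon>) = 0" using bump.p_M[OF b] .
          show "2 * (\<sigma> * w \<epsilon> (M i \<epsilon>)) * f_nl lam \<epsilon> (\<sigma> * w \<epsilon> (M i \<epsilon>)) * (\<delta> i \<epsilon>)\<^sup>2 = 1"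
            unfolding wM using bump.d_eq[OF b] .
          show "(\<sigma> * p \<epsilon> ?a)\<^sup>2 * ln (1 / ?a) \<le> \<kappa>" unfolding p2 using elim(1) by blast
          show "1 \<le> \<sigma> * w \<epsilon> (M i \<epsilon>)" unfolding wM using elim(4) by simp
        qed (use lam elim(3) a pos M1 \<kappa> in auto)
        also have "\<dots> \<le> \<mu> * (\<delta> i \<epsilon>)\<^sup>2" using \<kappa> by (intro mult_right_mono) auto
        finally show ?case .
      qed
    qed
    have "H i" unfolding H_def
    proof (intro allI impI)
      fix \<eta> :: real assume \<eta>: "0 < \<eta>"
      show "\<forall>\<^sub>F \<epsilon> in at_right 0. r \<epsilon> i \<le> \<eta> \<and> (p \<epsilon> (r \<epsilon> i))\<^sup>2 * ln (1 / r \<epsilon> i) \<le> \<eta>"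
      proof (rule bump_exit[OF lam(1) \<eta>])
        fix S0 \<mu> :: real
        assume \<mu>: "0 < \<mu>"
          "\<And>\<epsilon> M R S d w p. bump lam \<epsilon> M R S d w p \<Longrightarrow> S0 \<le> S \<Longrightarrow> M\<^sup>2 \<le> \<mu> * d\<^sup>2 \<Longrightarrow>
            R \<le> \<eta> \<and> (p R)\<^sup>2 * ln (1 / R) \<le> \<eta>"
        show "\<forall>\<^sub>F \<epsilon> in at_right 0. r \<epsilon> i \<le> \<eta> \<and> (p \<epsilon> (r \<epsilon> i))\<^sup>2 * ln (1 / r \<epsilon> i) \<le> \<eta>"
          using pc Sinf[of S0] Md[OF \<mu>(1)]
        proof eventually_elim
          case (elim \<epsilon>)
          then obtain \<sigma> where pc: "piece i \<epsilon> \<sigma>" by blast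
          then have b: "bump lam \<epsilon> (M i \<epsilon>) (r \<epsilon> i) (S i \<epsilon>) (\<delta> i \<epsilon>) (\<lambda>t. \<sigma> * w \<epsilon> t) (\<lambda>t. \<sigma> * p \<epsilon> t)"
            and \<sigma>: "\<sigma> = 1 \<or> \<sigma> = -1" unfolding piece_def by blast+
          have p2: "(\<sigma> * p \<epsilon> (r \<epsilon> i))\<^sup>2 = (p \<epsilon> (r \<epsilon> i))\<^sup>2" using \<sigma> by auto
          show ?case using \<mu>(2)[OF b less_imp_le[OF elim(2)] elim(3)] unfolding p2 .
        qed
      qed
    qed
    then show ?thesis using Sinf Md by blast
  qed
  have all: "(\<forall>B. \<forall>\<^sub>F \<epsilon> in at_right 0. B < S i \<epsilon>) \<and>
      (\<forall>\<mu>>0. \<forall>\<^sub>F \<epsilon> in at_right 0. (M i \<epsilon>)\<^sup>2 \<le> \<mu> * (\<delta> i \<epsilon>)\<^sup>2) \<and> H i"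
    if "i \<in> {1..k}" for i
    using that
  proof (induction i rule: nat_induct)
    case (Suc i)
    show ?case
    proof (rule step[OF Suc(2)])
      assume "Suc i \<noteq> 1"
      then have "i \<in> {1..k}" using Suc(2) by auto
      then show "H (Suc i - 1)" using Suc(1) by simp
    qed
  qed simp
  show ?thesis
  proof
    fix i assume i: "i \<in> {1..k}"
    have pc: "\<forall>\<^sub>F \<epsilon> in at_right 0. \<exists>\<sigma>. piece i \<epsilon> \<sigma>"
      using pieces by eventually_elim (use i in blast)
    have Sinf: "\<forall>\<^sub>F \<epsilon> in at_right 0. B < S i \<epsilon>" for B using all[OF i] by blast
    have "(\<delta> i \<longlongrightarrow> 0) (at_right 0)"
    proof (rule tendstoI)
      fix \<eta> :: real assume \<eta>: "0 < \<eta>"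
      show "\<forall>\<^sub>F \<epsilon> in at_right 0. dist (\<delta> i \<epsilon>) 0 < \<eta>"
        using pc Sinf[of "1 / (2 * lam * \<eta>\<^sup>2) + 1"]
      proof eventually_elim
        case (elim \<epsilon>)
        then obtain \<sigma> where "piece i \<epsilon> \<sigma>" by blast
        then have b: "bump lam \<epsilon> (M i \<epsilon>) (r \<epsilon> i) (S i \<epsilon>) (\<delta> i \<epsilon>) (\<lambda>t. \<sigma> * w \<epsilon> t) (\<lambda>t. \<sigma> * p \<epsilon> t)"
          unfolding piece_def by blast
        show ?case using bump_scale_small[OF b \<eta> less_imp_le[OF elim(2)]] bump.d_pos[OF b] by simp
      qed
    qed
    moreover have "C1_loc_limit {0<..}
      (\<lambda>\<epsilon> t. 2 * S i \<epsilon> * (\<bar>w \<epsilon> (M i \<epsilon> + \<delta> i \<epsilon> * t)\<bar> - S i \<epsilon>)) (\<lambda>t. ln (1 / (1 + t\<^sup>2 / 8)\<^sup>2)) (at_right 0)"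
    proof (rule rescaled_bumps_converge[where lam = lam and \<epsilon> = "\<lambda>\<epsilon>. \<epsilon>" and R = "\<lambda>\<epsilon>. r \<epsilon> i"])
      show "\<forall>\<^sub>F \<epsilon> in at_right 0. \<exists>W P. bump lam \<epsilon> (M i \<epsilon>) (r \<epsilon> i) (S i \<epsilon>) (\<delta> i \<epsilon>) W P \<and>
          (\<forall>t. M i \<epsilon> \<le> t \<longrightarrow> t < r \<epsilon> i \<longrightarrow> \<bar>w \<epsilon> t\<bar> = W t)"
        using pc
      proof eventually_elim
        case (elim \<epsilon>)
        then obtain \<sigma> where pc: "piece i \<epsilon> \<sigma>" by blast
        then have b: "bump lam \<epsilon> (M i \<epsilon>) (r \<epsilon> i) (S i \<epsilon>) (\<delta> i \<epsilon>) (\<lambda>t. \<sigma> * w \<epsilon> t) (\<lambda>t. \<sigma> * p \<epsilon> t)"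
          and \<sigma>: "\<sigma> = 1 \<or> \<sigma> = -1" unfolding piece_def by blast+
        have "\<bar>w \<epsilon> t\<bar> = \<sigma> * w \<epsilon> t" if "M i \<epsilon> \<le> t" "t < r \<epsilon> i" for t
          using bump.w_pos[OF b that] \<sigma> by auto
        then show ?case using b by blast
      qed
      show "\<forall>\<^sub>F \<epsilon> in at_right 0. B < S i \<epsilon>" for B by (rule Sinf)
      show "\<forall>\<^sub>F \<epsilon> in at_right 0. (M i \<epsilon>)\<^sup>2 \<le> \<mu> * (\<delta> i \<epsilon>)\<^sup>2" if "0 < \<mu>" for \<mu> using all[OF i] that by blast
    qed
    ultimately show "(\<delta> i \<longlongrightarrow> 0) (at_right 0) \<and> C1_loc_limit {0<..}
      (\<lambda>\<epsilon> t. 2 * S i \<epsilon> * (\<bar>profile (u \<epsilon>) (M i \<epsilon> + \<delta> i \<epsilon> * t)\<bar> - S i \<epsilon>))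
      (\<lambda>t. ln (1 / (1 + t\<^sup>2 / 8)\<^sup>2)) (at_right 0)" unfolding w_def by blast
  qed
qed

end
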